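(* Let $N\ge1$. The following identity holds in the algebra of formal power series $\mathbb Q(\mathbf k)[[x_1,\dots,x_N,u_1^{-1},\dots,u_N^{-1}]]$: $$ \sum_{\mu\in\mathbb Y(N)}I_{\mu|N}(x_1,\dots,x_N;\mathbf k)\,\widetilde H_{\mu|N}(u_1,\dots,u_N;\mathbf k)=\prod_{i=1}^N\prod_{j=1}^N\frac{F(x_i,u_j;\mathbf k)}{F(-(i-1)\mathbf k,u_j;\mathbf k)} , $$ where $$ F(x,u;\mathbf k)=1+\sum_{m=1}^\infty\frac{(\mathbf k)_m}{m!}\,\frac{x(x-1)\cdots(x-m+1)}{(u-1)\cdots(u-m)} . $$
   Context: $\mathbf k$ is a formal variable (inverse to the usual Jack parameter $\alpha$); the base field is $\mathbb Q(\mathbf k)$. $(\mathbf k)_m=\mathbf k(\mathbf k+1)\cdots(\mathbf k+m-1)$. $\mathbb Y(N)$ is the set of partitions (= Young diagrams) with at most $N$ nonzero parts; $\ell(\mu)$ is the number of nonzero parts. $\mu\succ\nu$ means $\mu_i\ge\nu_i\ge\mu_{i+1}$ for all $i$ (i.e. $\nu\subseteq\mu$ and $\mu/\nu$ is a horizontal strip). Rational functions of $u$ are expanded as power series in $u^{-1}$; $F(x,u;\mathbf k)$ is a power series in $u^{-1}$ whose coefficients are polynomials in $x$ and $\mathbf k$, so that $x$ may be specialized to $-(i-1)\mathbf k$. $\mathrm{RTab}(\mu,N)$ is the set of reverse semistandard tableaux $T$ of shape $\mu$ with values in $\{1,\dots,N\}$ (weakly decreasing along rows, strictly decreasing down columns).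 Such $T$ is identified with a chain $\mu=\mu(0)\succ\mu(1)\succ\dots\succ\mu(N)=\varnothing$, where the boxes of $\mu(i-1)/\mu(i)$ are those filled with $i$. For a box $s\in\lambda$ let $a(s),l(s)$ be its arm and leg lengths in $\lambda$ and $b_\lambda(s)=\frac{a(s)+\mathbf k\,l(s)+\mathbf k}{a(s)+\mathbf k\,l(s)+1}$; put $b_\lambda(s)=1$ if $s\notin\lambda$. For a horizontal strip $\lambda/\varkappa$: $\varphi_{\lambda/\varkappa}(\mathbf k)=\prod_s b_\lambda(s)/b_\varkappa(s)$ over boxes $s\in\lambda$ lying in columns meeting $\lambda/\varkappa$; $\psi_{\lambda/\varkappa}(\mathbf k)=\prod_s b_\varkappa(s)/b_\lambda(s)$ over boxes $s\in\lambda$ lying in rows meeting $\lambda/\varkappa$ but in columns not meeting $\lambda/\varkappa$. For $T\in\mathrm{RTab}(\mu,N)$, $\psi_T(\mathbf k)=\prod_{i=1}^N\psi_{\mu(i-1)/\mu(i)}(\mathbf k)$. (These are the coefficients in the combinatorial formulas for the Jack polynomials.) The interpolation Jack polynomials are $$I_{\mu|N}(x_1,\dots,x_N;\mathbf k)=\sum_{T\in\mathrm{RTab}(\mu,N)}\psi_T(\mathbf k)\prod_{(i,j)\in\mu}\bigl(x_{T(i,j)}-(j-1)+(T(i,j)+i-2)\mathbf k\bigr),$$ and $$\widetilde H_{\mu|N}(u_1,\dots,u_N;\mathbf k)=\sum_{T\in\mathrm{RTab}(\mu,N)}\prod_{i=1}^N\mathcal W_{\mu(i-1)/\mu(i)}(u_i;\mathbf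 k),$$ $$\mathcal W_{\lambda/\varkappa}(u;\mathbf k)=\varphi_{\lambda/\varkappa}(\mathbf k)\,\frac{\prod_{i=1}^{\ell(\lambda)}\prod_{j=1}^{\varkappa_i-\lambda_{i+1}}\bigl(u-(\varkappa_i-j+1)+i\mathbf k\bigr)}{(u-1)\cdots(u-\lambda_1)} .$$ *)

theory Defs
  imports
    "HOL-Library.Multiset"
    "HOL-Library.FuncSet"
    "HOL-Computational_Algebra.Computational_Algebra"
begin

section \<open>Multivariate formal power series\<close>

text \<open>
  A monomial in variables from \<^typ>\<open>'v\<close> is a finite multiset of variables, so that \<open>A + B\<close>
  is the product of two monomials and \<open>A \<subseteq># M\<close> is divisibility.  A power series is an
  arbitrary assignment of coefficients to monomials.
\<close>

typedef ('v, 'a) mps = "UNIV :: ('v multiset \<Rightarrow> 'a) set"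
  morphisms mps_nth Abs_mps by simp

lemma mps_nth_Abs [simp]: "mps_nth (Abs_mps f) = f"
  by (simp add: Abs_mps_inverse)

lemma mps_eqI: "(\<And>M. mps_nth f M = mps_nth g M) \<Longrightarrow> f = g"
  by (metis ext mps_nth_inject)

lemma finite_submultisets [simp]: "finite {A. A \<subseteq># M}"
proof (induction M)
  case (add x M)
  have "{A. A \<subseteq># add_mset x M} \<subseteq> {A. A \<subseteq># M} \<union> add_mset x ` {A. A \<subseteq># M}"
  proof
    fix A assume "A \<in> {A. A \<subseteq># add_mset x M}"
    then have A: "A \<subseteq># add_mset x M" by simp
    show "A \<in> {A. A \<subseteq># M} \<union> add_mset x ` {A. A \<subseteq># M}"
    proof (cases "x \<in># A")
      case True
      then obtain B where "A = add_mset x B" by (metis insert_DiffM)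
      with A show ?thesis by auto
    next
      case False
      with A have "A \<subseteq># M" 
        by (metis diff_single_trivial add_mset_remove_trivial subset_eq_diff_conv
            add_mset_add_single)
      then show ?thesis by simp
    qed
  qed
  with add show ?case by (meson finite_UnI finite_imageI finite_subset)
qed auto

instantiation mps :: (type, comm_ring_1) comm_ring_1
begin

definition zero_mps :: "('a, 'b) mps" where
  "0 = Abs_mps (\<lambda>_. 0)"

definition one_mps :: "('a, 'b) mps" where
  "1 = Abs_mps (\<lambda>M. if M = {#} then 1 else 0)"

definition plus_mps :: "('a, 'b) mps \<Rightarrow> ('a, 'b) mps \<Rightarrow> ('a, 'b) mps" where
  "f + g = Abs_mps (\<lambda>M. mps_nth f M + mps_nth g M)"

definition minus_mps :: "('a, 'b) mps \<Rightarrow> ('a, 'b) mps \<Rightarrow> ('a, 'b) mps" where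
  "f - g = Abs_mps (\<lambda>M. mps_nth f M - mps_nth g M)"

definition uminus_mps :: "('a, 'b) mps \<Rightarrow> ('a, 'b) mps" where
  "- f = Abs_mps (\<lambda>M. - mps_nth f M)"

definition times_mps :: "('a, 'b) mps \<Rightarrow> ('a, 'b) mps \<Rightarrow> ('a, 'b) mps" where
  "f * g = Abs_mps (\<lambda>M. \<Sum>A | A \<subseteq># M. mps_nth f A * mps_nth g (M - A))"

instance
proof
  fix f g h :: "('a, 'b) mps"
  have sub1: "B \<subseteq># M" "A - B \<subseteq># M - B" if "A \<subseteq># M" "B \<subseteq># A" for A B M :: "'a multiset"
    using that by (auto simp: subseteq_mset_def intro: order_trans diff_le_mono)
  have sub2: "B + C \<subseteq># M" if "B \<subseteq># M" "C \<subseteq># M - B" for B C M :: "'a multiset"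
    using that unfolding subseteq_mset_def
    by (metis (no_types, lifting) count_diff count_union add.commute le_diff_conv2)
  show "f * g * h = f * (g * h)"
  proof (rule mps_eqI)
    fix M
    have "mps_nth (f * g * h) M = (\<Sum>A | A \<subseteq># M. \<Sum>B | B \<subseteq># A.
            mps_nth f B * mps_nth g (A - B) * mps_nth h (M - A))"
      by (simp add: times_mps_def sum_distrib_right)
    also have "\<dots> = (\<Sum>(A, B)\<in>(SIGMA A:{A. A \<subseteq># M}. {B. B \<subseteq># A}).
            mps_nth f B * mps_nth g (A - B) * mps_nth h (M - A))"
      by (subst sum.Sigma) auto
    also have "\<dots> = (\<Sum>(B, C)\<in>(SIGMA B:{B. B \<subseteq># M}. {C. C \<subseteq># M - B}).
            mps_nth f B * (mps_nth g C * mps_nth h (M - B - C)))"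
      by (rule sum.reindex_bij_witness[where i = "\<lambda>(B, C). (B + C, B)" and j = "\<lambda>(A, B). (B, A - B)"])
         (auto simp: mult.assoc intro: sub1 sub2)
    also have "\<dots> = (\<Sum>B | B \<subseteq># M. \<Sum>C | C \<subseteq># M - B.
            mps_nth f B * (mps_nth g C * mps_nth h (M - B - C)))"
      by (subst sum.Sigma) auto
    also have "\<dots> = mps_nth (f * (g * h)) M"
      by (simp add: times_mps_def sum_distrib_left)
    finally show "mps_nth (f * g * h) M = mps_nth (f * (g * h)) M" .
  qed
  have dd: "M - (M - A) = A" if "A \<subseteq># M" for A M :: "'a multiset"
    using that by (auto simp: multiset_eq_iff subseteq_mset_def)
  show "f * g = g * f"
  proof (rule mps_eqI)
    fix M
    show "mps_nth (f * g) M = mps_nth (g * f) M"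
      unfolding times_mps_def mps_nth_Abs
      by (rule sum.reindex_bij_witness[where i = "\<lambda>A. M - A" and j = "\<lambda>A. M - A"])
         (auto simp: dd mult.commute)
  qed
  show "1 * f = f"
  proof (rule mps_eqI)
    fix M
    have "mps_nth (1 * f) M = (\<Sum>A | A \<subseteq># M. if A = {#} then mps_nth f M else 0)"
      unfolding times_mps_def one_mps_def mps_nth_Abs by (rule sum.cong) auto
    then show "mps_nth (1 * f) M = mps_nth f M" by simp
  qed
  show "(f + g) * h = f * h + g * h"
    by (rule mps_eqI) (simp add: times_mps_def plus_mps_def distrib_right sum.distrib)
  show "(0 :: ('a, 'b) mps) \<noteq> 1"
  proof
    assume "(0 :: ('a, 'b) mps) = 1"
    then have "mps_nth (0 :: ('a, 'b) mps) {#} = mps_nth 1 {#}" by (rule arg_cong)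
    then show False by (simp add: zero_mps_def one_mps_def)
  qed
qed (auto intro!: mps_eqI simp: zero_mps_def plus_mps_def minus_mps_def uminus_mps_def)

end

function mps_inverse_nth :: "('v multiset \<Rightarrow> 'a :: field) \<Rightarrow> 'v multiset \<Rightarrow> 'a" where
  "mps_inverse_nth f M = (if M = {#} then inverse (f {#})
     else - inverse (f {#}) * (\<Sum>A | A \<subset># M. mps_inverse_nth f A * f (M - A)))"
  by auto
termination
  by (relation "measure (size \<circ> snd)") (auto simp: mset_subset_size)

declare mps_inverse_nth.simps [simp del]

text \<open>As for \<^typ>\<open>'a fps\<close>, a series with vanishing constant term has inverse 0.\<close>

instantiation mps :: (type, field) inverse
begin

definition inverse_mps :: "('a, 'b) mps \<Rightarrow> ('a, 'b) mps" where
  "inverse f = (if mps_nth f {#} = 0 then 0 else Abs_mps (mps_inverse_nth (mps_nth f)))"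

definition divide_mps_def: "f div g = f * inverse g" for f g :: "('a, 'b) mps"

instance ..

end

lemma mps_inverse_mult:
  fixes f :: "('v, 'a :: field) mps"
  assumes "mps_nth f {#} \<noteq> 0"
  shows "inverse f * f = 1"
proof (rule mps_eqI)
  fix M :: "'v multiset"
  let ?g = "mps_inverse_nth (mps_nth f)"
  have *: "{A. A \<subseteq># M} = insert M {A. A \<subset># M}" by (auto simp: subset_mset.le_less)
  have fin: "finite {A. A \<subset># M}"
    by (rule finite_subset[OF _ finite_submultisets[of M]]) auto
  have "mps_nth (inverse f * f) M = ?g M * mps_nth f {#} + (\<Sum>A | A \<subset># M. ?g A * mps_nth f (M - A))"
    using assms fin unfolding times_mps_def inverse_mps_def by (simp add: *)
  also have "\<dots> = mps_nth 1 M"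
    using assms by (subst mps_inverse_nth.simps) (auto simp: one_mps_def)
  finally show "mps_nth (inverse f * f) M = mps_nth 1 M" .
qed

definition mps_const :: "'a :: zero \<Rightarrow> ('v, 'a) mps" where
  "mps_const c = Abs_mps (\<lambda>M. if M = {#} then c else 0)"

definition mps_var :: "'v \<Rightarrow> ('v, 'a :: zero_neq_one) mps" where
  "mps_var v = Abs_mps (\<lambda>M. if M = {#v#} then 1 else 0)"

text \<open>Substitution of the variable \<open>v\<close> into a one-variable series; used only for Laurent series
  without terms of negative degree.\<close>

definition mps_of_fls :: "'v \<Rightarrow> 'a :: zero fls \<Rightarrow> ('v, 'a) mps" where
  "mps_of_fls v f = Abs_mps (\<lambda>M. if M = replicate_mset (size M) v
     then fls_nth f (int (size M)) else 0)"

text \<open>Infinite sums in the formal topology: every coefficient is a finite sum.\<close>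

definition mps_summable :: "('i \<Rightarrow> ('v, 'a :: comm_monoid_add) mps) \<Rightarrow> 'i set \<Rightarrow> bool" where
  "mps_summable f A \<longleftrightarrow> (\<forall>M. finite {a \<in> A. mps_nth (f a) M \<noteq> 0})"

definition mps_infsum :: "('i \<Rightarrow> ('v, 'a :: comm_monoid_add) mps) \<Rightarrow> 'i set \<Rightarrow> ('v, 'a) mps" where
  "mps_infsum f A = Abs_mps (\<lambda>M. \<Sum>a | a \<in> A \<and> mps_nth (f a) M \<noteq> 0. mps_nth (f a) M)"

definition mps_has_sum ::
    "('i \<Rightarrow> ('v, 'a :: comm_monoid_add) mps) \<Rightarrow> 'i set \<Rightarrow> ('v, 'a) mps \<Rightarrow> bool" where
  "mps_has_sum f A s \<longleftrightarrow> mps_summable f A \<and> mps_infsum f A = s"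

section \<open>The base field and the variables\<close>

type_synonym Qk = "rat poly fract"

definition kk :: Qk where
  "kk = Fract [:0, 1:] 1"

text \<open>\<open>XV i\<close> stands for \<open>x\<^sub>i\<close> and \<open>UinvV j\<close> for the inverse of \<open>u\<^sub>j\<close>.\<close>

datatype var = XV nat | UinvV nat

type_synonym series = "(var, Qk) mps"

text \<open>Rational functions of \<open>u\<close> live in the field of Laurent series in \<open>1/u\<close>, where \<open>u\<close> itself
  is the inverse of the variable.\<close>

definition uu :: "Qk fls" where
  "uu = fls_X_inv"

section \<open>Young diagrams and reverse tableaux\<close>

text \<open>Partitions are identified with their Young diagrams; a box is a pair (row, column), both
  counted from 1.\<close>

type_synonym diagram = "(nat \<times> nat) set"

definition young_diagram :: "diagram \<Rightarrow> bool" where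
  "young_diagram D \<longleftrightarrow> finite D \<and> D \<subseteq> {1..} \<times> {1..} \<and>
     (\<forall>i j i' j'. (i, j) \<in> D \<longrightarrow> i' \<in> {1..i} \<longrightarrow> j' \<in> {1..j} \<longrightarrow> (i', j') \<in> D)"

definition row_len :: "diagram \<Rightarrow> nat \<Rightarrow> nat" where
  "row_len D i = card {j. (i, j) \<in> D}"

definition col_len :: "diagram \<Rightarrow> nat \<Rightarrow> nat" where
  "col_len D j = card {i. (i, j) \<in> D}"

definition num_rows :: "diagram \<Rightarrow> nat" where
  "num_rows D = card {i. row_len D i \<noteq> 0}"

definition Young :: "nat \<Rightarrow> diagram set" where
  "Young N = {D. young_diagram D \<and> num_rows D \<le> N}"

definition RTab :: "diagram \<Rightarrow> nat \<Rightarrow> (nat \<times> nat \<Rightarrow> nat) set" where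
  "RTab \<mu> N = {T \<in> \<mu> \<rightarrow>\<^sub>E {1..N}.
     (\<forall>i j j'. (i, j) \<in> \<mu> \<longrightarrow> (i, j') \<in> \<mu> \<longrightarrow> j < j' \<longrightarrow> T (i, j') \<le> T (i, j)) \<and>
     (\<forall>i i' j. (i, j) \<in> \<mu> \<longrightarrow> (i', j) \<in> \<mu> \<longrightarrow> i < i' \<longrightarrow> T (i', j) < T (i, j))}"

text \<open>The chain \<open>\<mu> = \<mu>(0) \<succ> \<mu>(1) \<succ> \<dots> \<succ> \<mu>(N) = \<emptyset>\<close> of a tableau:
  the boxes of \<open>\<mu>(i-1)/\<mu>(i)\<close> are those filled with \<open>i\<close>.\<close>

definition tab_chain :: "diagram \<Rightarrow> (nat \<times> nat \<Rightarrow> nat) \<Rightarrow> nat \<Rightarrow> diagram" where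
  "tab_chain \<mu> T i = {s \<in> \<mu>. i < T s}"

section \<open>Jack coefficients\<close>

definition arm :: "diagram \<Rightarrow> nat \<times> nat \<Rightarrow> nat" where
  "arm D s = row_len D (fst s) - snd s"

definition leg :: "diagram \<Rightarrow> nat \<times> nat \<Rightarrow> nat" where
  "leg D s = col_len D (snd s) - fst s"

definition bfac :: "diagram \<Rightarrow> nat \<times> nat \<Rightarrow> Qk" where
  "bfac D s = (if s \<in> D
     then (of_nat (arm D s) + kk * of_nat (leg D s) + kk) / (of_nat (arm D s) + kk * of_nat (leg D s) + 1)
     else 1)"

definition meets_row :: "diagram \<Rightarrow> nat \<times> nat \<Rightarrow> bool" where
  "meets_row S s \<longleftrightarrow> (\<exists>j. (fst s, j) \<in> S)"

definition meets_col :: "diagram \<Rightarrow> nat \<times> nat \<Rightarrow> bool" where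
  "meets_col S s \<longleftrightarrow> (\<exists>i. (i, snd s) \<in> S)"

definition jack_phi :: "diagram \<Rightarrow> diagram \<Rightarrow> Qk" where
  "jack_phi lam kap = (\<Prod>s | s \<in> lam \<and> meets_col (lam - kap) s. bfac lam s / bfac kap s)"

definition jack_psi :: "diagram \<Rightarrow> diagram \<Rightarrow> Qk" where
  "jack_psi lam kap = (\<Prod>s | s \<in> lam \<and> meets_row (lam - kap) s \<and> \<not> meets_col (lam - kap) s.
     bfac kap s / bfac lam s)"

definition jack_psi_tab :: "diagram \<Rightarrow> nat \<Rightarrow> (nat \<times> nat \<Rightarrow> nat) \<Rightarrow> Qk" where
  "jack_psi_tab \<mu> N T = (\<Prod>i=1..N. jack_psi (tab_chain \<mu> T (i - 1)) (tab_chain \<mu> T i))"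

section \<open>Interpolation Jack polynomials and the dual functions\<close>

text \<open>Entries and coordinates are at least 1, so the natural number subtractions below are exact.\<close>

definition interp_jack :: "diagram \<Rightarrow> nat \<Rightarrow> (nat \<Rightarrow> series) \<Rightarrow> series" where
  "interp_jack \<mu> N x = (\<Sum>T\<in>RTab \<mu> N. mps_const (jack_psi_tab \<mu> N T) *
     (\<Prod>(i, j)\<in>\<mu>. x (T (i, j)) - of_nat (j - 1) + of_nat (T (i, j) + i - 2) * mps_const kk))"

definition W_weight :: "diagram \<Rightarrow> diagram \<Rightarrow> Qk fls" where
  "W_weight lam kap = fls_const (jack_phi lam kap) *
     (\<Prod>i=1..num_rows lam. \<Prod>j=1..row_len kap i - row_len lam (i + 1).
        uu - of_nat (row_len kap i - j + 1) + of_nat i * fls_const kk) /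
     (\<Prod>l=1..row_len lam 1. uu - of_nat l)"

definition dual_H :: "diagram \<Rightarrow> nat \<Rightarrow> series" where
  "dual_H \<mu> N = (\<Sum>T\<in>RTab \<mu> N. \<Prod>i=1..N.
     mps_of_fls (UinvV i) (W_weight (tab_chain \<mu> T (i - 1)) (tab_chain \<mu> T i)))"

definition F_term :: "series \<Rightarrow> nat \<Rightarrow> nat \<Rightarrow> series" where
  "F_term x j m = mps_const (pochhammer kk m / fact m) * (\<Prod>l<m. x - of_nat l) *
     mps_of_fls (UinvV j) (1 / (\<Prod>l=1..m. uu - of_nat l))"

text \<open>\<open>F(x, u\<^sub>j; k)\<close>, where \<open>x\<close> may be a variable or a constant.\<close>

definition F_series :: "series \<Rightarrow> nat \<Rightarrow> series" where
  "F_series x j = 1 + mps_infsum (F_term x j) {1..}"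

section \<open>The expansions at infinity are well defined\<close>

lemma uu_minus_const:
  "fls_subdegree (uu - fls_const c) = -1" "uu - fls_const c \<noteq> 0"
proof -
  have "fls_subdegree (fls_X_inv - fls_const c :: Qk fls) = -1"
    by (intro fls_subdegree_eqI) auto
  then show "fls_subdegree (uu - fls_const c) = -1" by (simp add: uu_def)
  then show "uu - fls_const c \<noteq> 0" by auto
qed

lemma subdegree_prod_uu:
  assumes "finite A" and "\<And>a. a \<in> A \<Longrightarrow> \<exists>c. f a = uu - fls_const c"
  shows "(\<Prod>a\<in>A. f a) \<noteq> 0 \<and> fls_subdegree (\<Prod>a\<in>A. f a) = - int (card A)"
  using assms
proof (induction A)
  case (insert a A)
  obtain c where "f a = uu - fls_const c" using insert.prems by blast
  moreover from this have "f a \<noteq> 0" "fls_subdegree (f a) = -1"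
    using uu_minus_const by auto
  moreover have "prod f A \<noteq> 0 \<and> fls_subdegree (prod f A) = - int (card A)"
    using insert by blast
  ultimately show ?case using insert.hyps by simp
qed auto

lemma subdegree_F_denom:
  "(\<Prod>l=1..m. uu - of_nat l) \<noteq> 0 \<and> fls_subdegree (\<Prod>l=1..m. uu - of_nat l) = - int m"
  using subdegree_prod_uu[of "{1..m}" "\<lambda>l. uu - of_nat l"] by (auto simp: fls_of_nat)

lemma F_term_nth_eq_0:
  assumes "size M < m"
  shows "mps_nth (F_term x j m) M = 0"
proof -
  have "fls_subdegree (1 / (\<Prod>l=1..m. uu - of_nat l)) = int m"
    using subdegree_F_denom[of m] by (simp add: fls_divide_subdegree)
  then have "fls_nth (1 / (\<Prod>l=1..m. uu - of_nat l)) (int (size (M - A))) = 0" for A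
    using assms size_mset_mono[OF diff_subset_eq_self, of M A] by (intro fls_eq0_below_subdegree) simp
  then show ?thesis
    unfolding F_term_def by (subst times_mps_def) (auto simp: mps_of_fls_def intro!: sum.neutral)
qed

lemma F_term_summable: "mps_summable (F_term x j) A"
  unfolding mps_summable_def
proof
  fix M :: "var multiset"
  have "{m \<in> A. mps_nth (F_term x j m) M \<noteq> 0} \<subseteq> {..size M}"
    using F_term_nth_eq_0[of M] by (auto simp: not_less[symmetric])
  then show "finite {m \<in> A. mps_nth (F_term x j m) M \<noteq> 0}"
    by (rule finite_subset) simp
qed

lemma F_series_nth_empty: "mps_nth (F_series x j) {#} = 1"
proof -
  have "{m \<in> {1..}. mps_nth (F_term x j m) {#} \<noteq> 0} = {}"
    using F_term_nth_eq_0[of "{#}"] by auto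
  then show ?thesis
    by (simp add: F_series_def plus_mps_def one_mps_def mps_infsum_def)
qed

lemma young_diagram_rows:
  assumes "young_diagram D"
  shows "finite {j. (i, j) \<in> D}" and "row_len D (i + 2) \<le> row_len D (i + 1)"
proof -
  have fin: "finite {j. (i, j) \<in> D}" for i
  proof -
    have "{j. (i, j) \<in> D} \<subseteq> snd ` D" by force
    with assms show ?thesis unfolding young_diagram_def by (meson finite_imageI finite_subset)
  qed
  show "finite {j. (i, j) \<in> D}" by (rule fin)
  have "{j. (i + 2, j) \<in> D} \<subseteq> {j. (i + 1, j) \<in> D}"
    using assms unfolding young_diagram_def by fastforce
  then show "row_len D (i + 2) \<le> row_len D (i + 1)"
    unfolding row_len_def by (intro card_mono fin)
qed

lemma W_weight_subdegree:
  assumes "young_diagram lam" "kap \<subseteq> lam"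
  shows "fls_subdegree (W_weight lam kap) \<ge> 0"
proof -
  let ?I = "SIGMA i:{1..num_rows lam}. {1..row_len kap i - row_len lam (i + 1)}"
  let ?f = "\<lambda>(i, j). uu - of_nat (row_len kap i - j + 1) + of_nat i * fls_const kk"
  define P where "P = (\<Prod>a\<in>?I. ?f a)"
  define Q where "Q = (\<Prod>l=1..row_len lam 1. uu - of_nat l)"
  have rows: "row_len kap i \<le> row_len lam i" for i
    unfolding row_len_def using assms by (intro card_mono young_diagram_rows) auto
  have W: "W_weight lam kap = fls_const (jack_phi lam kap) * P / Q"
    unfolding W_weight_def P_def Q_def by (subst prod.Sigma) auto
  have "\<exists>c. ?f a = uu - fls_const c" if "a \<in> ?I" for a
  proof (cases a)
    case (Pair i j)
    have "?f a = uu - fls_const (of_nat (row_len kap i - j + 1) - of_nat i * kk)"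
      unfolding Pair by (simp only: case_prod_conv fls_of_nat fls_const_mult_const
          fls_minus_const[symmetric] diff_diff_eq2) algebra
    then show ?thesis by blast
  qed
  then have P: "P \<noteq> 0 \<and> fls_subdegree P = - int (card ?I)"
    unfolding P_def by (intro subdegree_prod_uu) auto
  have Q: "Q \<noteq> 0 \<and> fls_subdegree Q = - int (row_len lam 1)"
    unfolding Q_def by (rule subdegree_F_denom)
  have tele: "(\<Sum>i=1..n. row_len lam i - row_len lam (i + 1)) + row_len lam (n + 1) = row_len lam 1" for n
  proof (induction n)
    case (Suc n)
    then show ?case using young_diagram_rows(2)[OF assms(1), of n] by simp
  qed simp
  have "card ?I \<le> (\<Sum>i=1..num_rows lam. row_len lam i - row_len lam (i + 1))"
    using rows by (simp add: card_SigmaI) (meson sum_mono diff_le_mono)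
  also have "\<dots> \<le> row_len lam 1" using tele[of "num_rows lam"] by linarith
  finally have "card ?I \<le> row_len lam 1" .
  moreover obtain n where "card ?I = n" by blast
  ultimately show ?thesis
    using P Q unfolding W by (cases "jack_phi lam kap = 0") (auto simp: fls_divide_subdegree fls_const_nonzero)
qed

end

theory Submission
  imports Defs
begin

text \<open>
  Write \<open>y\<^sub>i = x\<^sub>i + (i - 1) k\<close> and let \<open>A\<^sub>\<lambda>\<^sub>/\<^sub>\<rho>(y)\<close> be the branching coefficients of the interpolation
  polynomials.  Everything follows from the skew identity
  \<open>\<Sum>\<^sub>\<lambda> W\<^sub>\<lambda>\<^sub>/\<^sub>\<kappa>(u) A\<^sub>\<lambda>\<^sub>/\<^sub>\<rho>(y) = F(y, u) \<Sum>\<^sub>\<tau> A\<^sub>\<kappa>\<^sub>/\<^sub>\<tau>(y) W\<^sub>\<rho>\<^sub>/\<^sub>\<tau>(u + k)\<close>.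
  Iterated over the \<open>y\<^sub>i\<close> it gives the Pieri rule
  \<open>\<Sum>\<^sub>\<lambda> I\<^sub>\<lambda> W\<^sub>\<lambda>\<^sub>/\<^sub>\<kappa>(u) = I\<^sub>\<kappa> \<Prod>\<^sub>i F(y\<^sub>i, u + (i - 1) k)\<close>, whose factors equal
  \<open>F(x\<^sub>i, u) / F(-(i - 1) k, u)\<close>, and the Pieri rule iterated over the \<open>u\<^sub>j\<close> gives the Cauchy identity.

  The coefficients of the skew identity are polynomials in \<open>y\<close>, so it suffices to take \<open>y = M\<close> for
  large integers \<open>M\<close>.  Then only columns \<open>1, \<dots>, M\<close> matter and a horizontal strip is a set of columns.
  Both sides become sums over subsets of one set of columns, and after complementing the subsets
  on the right the claim is that the rational function \<open>subset_sum\<close> is symmetric in \<open>M\<close> and \<open>u\<close>.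
\<close>

section \<open>Symmetry of a subset sum\<close>

text \<open>Setting \<open>y\<close> equal to the number \<open>M\<close> of columns kept is what
  makes both sides subset sums. Cutting after \<open>M\<close> columns leaves in phi a boundary
  factor \<open>(w j + M + k) / (w j + M + 1)\<close> for every added box, and in the columns that
  depend on the subset the factor of A at \<open>y = M\<close> cancels its denominator. Apart from
  pair weights, the subset then enters only through linear factors in \<open>M\<close> and in
  \<open>u\<close>, with \<open>k\<close> attached to \<open>M\<close> on one side and to
  \<open>u\<close> on the other. The prefactor F(M, u) is the quotient of the two denominators, the
  products of all u + k - l and of all u - l for l up to M. The other obstacle is that the sums over
  \<lambda> are infinite. W has order at least the number of boxes of its strip, so each coefficient
  sees finitely many \<lambda>, and the identities are proved up to a degree. The Pieri rule for
  \<kappa>, cut at diagrams of size m, is exact only below degree m - |\<kappa>|; in the Cauchy sum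
  the missing |\<kappa>| degrees are supplied by the dual function of \<kappa>.\<close>

text \<open>
  Let \<open>w\<^sub>j = k c\<^sub>j - j\<close>, where \<open>c\<^sub>j\<close> is the length of column \<open>j\<close> of \<open>\<kappa>\<close>.  If \<open>\<lambda>/\<kappa>\<close> is a
  horizontal strip that meets column \<open>i\<close> but not column \<open>j\<close>, then this pair contributes
  \<open>pair_weight k (w\<^sub>i - w\<^sub>j)\<close> to \<open>\<phi>\<close> when \<open>i < j\<close> and to \<open>\<psi>\<close> when \<open>j < i\<close>.
\<close>

definition pair_weight :: "'a::field \<Rightarrow> 'a \<Rightarrow> 'a" where
  "pair_weight k y = (y + 1) * (y + k - 1) / (y * (y + k))"

text \<open>Says that no denominator of \<open>pair_weight k (w i - w j)\<close> vanishes.\<close>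

definition generic_points :: "'a::field \<Rightarrow> ('b \<Rightarrow> 'a) \<Rightarrow> 'b set \<Rightarrow> bool" where
  "generic_points k w A \<longleftrightarrow> (\<forall>i\<in>A. \<forall>j\<in>A. i \<noteq> j \<longrightarrow> w i \<noteq> w j \<and> w i - w j + k \<noteq> 0)"

lemma generic_points_subset: "generic_points k w A \<Longrightarrow> B \<subseteq> A \<Longrightarrow> generic_points k w B"
  unfolding generic_points_def by blast

text \<open>The zeros -1 and 1 - k are exchanged by y -> - y - k, and so are the poles 0 and -k.
  This trades a reversed difference for a shift by \<open>k\<close>, which is how strips above and
  below are compared later.\<close>

lemma pair_weight_reflect: "pair_weight k (- y - k) = pair_weight k y"
proof -
  have "(- y - k + 1) * (- y - k + k - 1) = (y + 1) * (y + k - 1)"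
    "(- y - k) * (- y - k + k) = y * (y + k)"
    by algebra+
  then show ?thesis unfolding pair_weight_def by metis
qed

section \<open>Partial fractions of products of pair weights\<close>

lemma pair_weight_partial_fractions:
  assumes "k \<noteq> 0" "y \<noteq> 0" "y + k \<noteq> 0"
  shows "pair_weight k y = 1 + (k - 1) / k * (1 / y - 1 / (y + k))"
proof -
  have "1 / y - 1 / (y + k) = k / (y * (y + k))"
    using assms by (simp add: diff_frac_eq)
  then have "1 + (k - 1) / k * (1 / y - 1 / (y + k)) = 1 + (k - 1) / (y * (y + k))"
    using assms(1) by simp
  also have "\<dots> = (y * (y + k) + (k - 1)) / (y * (y + k))"
    using assms by (simp add: add_divide_distrib)
  also have "y * (y + k) + (k - 1) = (y + 1) * (y + k - 1)"
    by (simp add: algebra_simps)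
  finally show ?thesis unfolding pair_weight_def by simp
qed

lemma partial_fraction_two:
  fixes a b z :: "'a::field"
  assumes "z \<noteq> a" "z \<noteq> b" "a \<noteq> b"
  shows "1 / (z - a) * (1 / (z - b)) = 1 / (a - b) * (1 / (z - a)) + 1 / (b - a) * (1 / (z - b))"
proof -
  have "1 / (a - b) * (1 / (z - a)) + 1 / (b - a) * (1 / (z - b))
    = 1 / (a - b) * (1 / (z - a) - 1 / (z - b))"
  proof -
    have "1 / (b - a) = - (1 / (a - b))"
      by (metis minus_diff_eq minus_divide_right)
    then show ?thesis by (simp only: right_diff_distrib) simp
  qed
  also have "1 / (z - a) - 1 / (z - b) = (a - b) / ((z - a) * (z - b))"
    using assms by (simp add: diff_frac_eq)
  finally show ?thesis using assms by simp
qed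

text \<open>The contribution of the poles \<open>z = w j\<close> and \<open>z = w j - k\<close> to
  the partial fractions of the product of \<open>pair_weight k (z - w l)\<close> over
  \<open>A\<close>, up to the common factor \<open>(k - 1) / k\<close>. The second residue contains
  \<open>pair_weight k (w j - k - w l)\<close>, which is \<open>pair_weight k (w l - w j)\<close> by
  reflection.\<close>

definition pf_term :: "'a::field \<Rightarrow> ('b \<Rightarrow> 'a) \<Rightarrow> 'b set \<Rightarrow> 'b \<Rightarrow> 'a \<Rightarrow> 'a" where
  "pf_term k w A j z = (\<Prod>l\<in>A-{j}. pair_weight k (w j - w l)) / (z - w j)
     - (\<Prod>l\<in>A-{j}. pair_weight k (w l - w j)) / (z - w j + k)"

text \<open>A ring identity once every reciprocal is an atom. \<open>A\<close> and \<open>B\<close>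
  stand for the denominators of a new point, \<open>C\<close> and \<open>D\<close> for those of an
  old one, and the hypotheses split the four mixed products.\<close>

lemma pf_combine:
  fixes A B C D r s t a b c :: "'a::field"
  assumes "1 / A * (1 / C) = 1 / r * (1 / A) + - (1 / r) * (1 / C)"
    "1 / B * (1 / C) = 1 / t * (1 / B) + 1 / s * (1 / C)"
    "1 / A * (1 / D) = 1 / q * (1 / A) + - (1 / q) * (1 / D)"
    "1 / B * (1 / D) = 1 / r * (1 / B) + - (1 / r) * (1 / D)"
  shows "(1 + c * (1 / A - 1 / B)) * (a / C - b / D)
    = (1 + c * (- (1 / r) - 1 / s)) * a / C - (1 + c * (1 / r - 1 / q)) * b / D
      + c * ((a / r - b / q) / A - (a / t - b / r) / B)"
proof -
  define A' B' C' D' r' s' t' q' where d: "A' = 1 / A" "B' = 1 / B" "C' = 1 / C" "D' = 1 / D"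
    "r' = 1 / r" "s' = 1 / s" "t' = 1 / t" "q' = 1 / q"
  have e: "x / A = x * A'" "x / B = x * B'" "x / C = x * C'" "x / D = x * D'"
    "x / r = x * r'" "x / s = x * s'" "x / t = x * t'" "x / q = x * q'" for x
    by (simp_all add: d)
  have p: "A' * C' = r' * A' + - r' * C'" "B' * C' = t' * B' + s' * C'"
    "A' * D' = q' * A' + - q' * D'" "B' * D' = r' * B' + - r' * D'"
    using assms unfolding d[symmetric] .
  have "(1 + c * (A' - B')) * (a * C' - b * D') = a * C' - b * D' + c * a * (A' * C') - c * a * (B' * C')
     - c * b * (A' * D') + c * b * (B' * D')"
    by (simp add: algebra_simps)
  also have "\<dots> = (1 + c * (- r' - s')) * a * C' - (1 + c * (r' - q')) * b * D'
      + c * ((a * r' - b * q') * A' - (a * t' - b * r') * B')"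
    unfolding p by (simp add: algebra_simps)
  finally show ?thesis unfolding e mult_1_left .
qed

text \<open>Multiplication by the factor of a new point \<open>n\<close> updates the residues at the
  old poles; the residues at the new poles \<open>w n\<close> and \<open>w n - k\<close> are the
  values of the old term there.\<close>

lemma pf_term_insert:
  assumes fin: "finite A" and nA: "n \<notin> A" and j: "j \<in> A" and k: "k \<noteq> 0"
    and wn: "w n \<noteq> w j" "w n - w j + k \<noteq> 0" "w j - w n + k \<noteq> 0"
    and z: "z \<noteq> w j" "z - w j + k \<noteq> 0" "z \<noteq> w n" "z - w n + k \<noteq> 0"
  shows "pair_weight k (z - w n) * pf_term k w A j z = pf_term k w (insert n A) j z
    + (k - 1) / k * (pf_term k w A j (w n) / (z - w n) - pf_term k w A j (w n - k) / (z - w n + k))"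
proof -
  define a where "a = (\<Prod>l\<in>A-{j}. pair_weight k (w j - w l))"
  define b where "b = (\<Prod>l\<in>A-{j}. pair_weight k (w l - w j))"
  define c where "c = (k - 1) / k"
  have ins: "insert n A - {j} = insert n (A - {j})" using nA j by auto
  have T: "pf_term k w A j y = a / (y - w j) - b / (y - w j + k)" for y
    unfolding pf_term_def a_def b_def ..
  have T': "pf_term k w (insert n A) j z = pair_weight k (w j - w n) * a / (z - w j)
      - pair_weight k (w n - w j) * b / (z - w j + k)"
    unfolding pf_term_def ins using fin nA by (simp add: a_def b_def)
  have h1: "pair_weight k (z - w n) = 1 + c * (1 / (z - w n) - 1 / (z - w n + k))"
    using pair_weight_partial_fractions[of k "z - w n"] k z unfolding c_def by simp
  have h2: "pair_weight k (w j - w n) = 1 + c * (1 / (w j - w n) - 1 / (w j - w n + k))"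
    using pair_weight_partial_fractions[of k "w j - w n"] k wn unfolding c_def by auto
  have h3: "pair_weight k (w n - w j) = 1 + c * (1 / (w n - w j) - 1 / (w n - w j + k))"
    using pair_weight_partial_fractions[of k "w n - w j"] k wn unfolding c_def by auto
  have ne: "z \<noteq> w n - k" "z \<noteq> w j - k" "w n \<noteq> w j - k" "w j \<noteq> w n - k"
    using z wn by (auto simp: algebra_simps)
  have p: "1 / (z - w n) * (1 / (z - w j)) = 1 / (w n - w j) * (1 / (z - w n)) + 1 / (w j - w n) * (1 / (z - w j))"
    "1 / (z - (w n - k)) * (1 / (z - w j)) = 1 / (w n - k - w j) * (1 / (z - (w n - k))) + 1 / (w j - (w n - k)) * (1 / (z - w j))"
    "1 / (z - w n) * (1 / (z - (w j - k))) = 1 / (w n - (w j - k)) * (1 / (z - w n)) + 1 / (w j - k - w n) * (1 / (z - (w j - k)))"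
    "1 / (z - (w n - k)) * (1 / (z - (w j - k))) = 1 / (w n - k - (w j - k)) * (1 / (z - (w n - k))) + 1 / (w j - k - (w n - k)) * (1 / (z - (w j - k)))"
    by (rule partial_fraction_two; use ne z wn in auto)+
  have e1: "z - (w n - k) = z - w n + k" "z - (w j - k) = z - w j + k"
     "w n - k - (w j - k) = w n - w j" "w j - k - (w n - k) = w j - w n"
     "w j - (w n - k) = w j - w n + k" "w n - (w j - k) = w n - w j + k"
     "w n - k - w j + k = w n - w j"
    by (simp_all add: algebra_simps)
  note p = p[unfolded e1]
  have e2: "1 / (w j - k - w n) = - (1 / (w n - w j + k))" "1 / (w j - w n) = - (1 / (w n - w j))"
    using minus_divide_right[of 1 "w n - w j + k"] minus_divide_right[of 1 "w n - w j"] by (simp_all add: algebra_simps)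
  show ?thesis
    unfolding T T' h1 h2 h3 c_def[symmetric] e1 e2    by (rule pf_combine[OF p[unfolded e2]])
qed

text \<open>The last claim allows an expansion over \<open>A\<close> to be evaluated at the second
  new pole \<open>w n - k\<close>.\<close>

lemma generic_points_insertD:
  assumes "generic_points k w (insert n A)" "n \<notin> A"
  shows "generic_points k w A" "\<And>j. j \<in> A \<Longrightarrow> w n \<noteq> w j" "\<And>j. j \<in> A \<Longrightarrow> w n - w j + k \<noteq> 0"
    "\<And>j. j \<in> A \<Longrightarrow> w j - w n + k \<noteq> 0" "\<forall>j\<in>A. w n - k \<noteq> w j \<and> w n - k - w j + k \<noteq> 0"
proof -
  have "w n \<noteq> w j \<and> w n - w j + k \<noteq> 0 \<and> w j - w n + k \<noteq> 0" if "j \<in> A" for j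
    using assms that unfolding generic_points_def by (metis insertCI)
  note wn = this
  show "generic_points k w A" using generic_points_subset[OF assms(1)] by blast
  show "\<forall>j\<in>A. w n - k \<noteq> w j \<and> w n - k - w j + k \<noteq> 0" using wn by (force simp: algebra_simps)
qed (use assms in \<open>auto simp: generic_points_def\<close>)

text \<open>Every factor tends to 1 at infinity and all poles are simple, hence the constant term 1.
  The induction keeps \<open>z\<close> free because the hypothesis is used at three points: at
  \<open>z\<close>, and at \<open>w n\<close> and \<open>w n - k\<close>, where it evaluates the
  residues at the new poles.\<close>

lemma prod_pair_weight_partial_fractions:
  assumes "finite A" "generic_points k w A" "k \<noteq> 0" "\<forall>j\<in>A. z \<noteq> w j \<and> z - w j + k \<noteq> 0"
  shows "(\<Prod>j\<in>A. pair_weight k (z - w j)) = 1 + (k - 1) / k * (\<Sum>j\<in>A. pf_term k w A j z)"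
  using assms
proof (induction A arbitrary: z rule: finite_induct)
  case (insert n A)
  define c where "c = (k - 1) / k"
  define P where "P z = (\<Prod>j\<in>A. pair_weight k (z - w j))" for z
  note gA = generic_points_insertD(1)[OF insert.prems(1) insert.hyps(2)]
  note wn = generic_points_insertD(2-4)[OF insert.prems(1) insert.hyps(2)]
  note n1 = generic_points_insertD(5)[OF insert.prems(1) insert.hyps(2)]
  have IH: "P y = 1 + c * (\<Sum>j\<in>A. pf_term k w A j y)" if "\<forall>j\<in>A. y \<noteq> w j \<and> y - w j + k \<noteq> 0" for y
    unfolding P_def c_def using insert.IH[OF gA insert.prems(2) that] .
  have "(\<Prod>j\<in>A. pair_weight k (w n - w j)) = P (w n)" unfolding P_def ..
  have Pk: "P (w n - k) = (\<Prod>j\<in>A. pair_weight k (w j - w n))"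
    unfolding P_def
  proof (rule prod.cong)
    fix j have "w n - k - w j = - (w j - w n) - k" by simp
    then show "pair_weight k (w n - k - w j) = pair_weight k (w j - w n)"
      using pair_weight_reflect by metis
  qed simp
  have tn: "pf_term k w (insert n A) n z = P (w n) / (z - w n) - P (w n - k) / (z - w n + k)"
    unfolding pf_term_def Pk using insert.hyps by (simp add: P_def)
  have zA: "\<forall>j\<in>A. z \<noteq> w j \<and> z - w j + k \<noteq> 0" and zn: "z \<noteq> w n" "z - w n + k \<noteq> 0"
    using insert.prems by auto
  have h: "pair_weight k (z - w n) = 1 + c * (1 / (z - w n) - 1 / (z - w n + k))"
    using pair_weight_partial_fractions[of k "z - w n"] insert.prems(2) zn unfolding c_def by simp
  have "(\<Prod>j\<in>insert n A. pair_weight k (z - w j)) = pair_weight k (z - w n) * P z"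
    using insert.hyps by (simp add: P_def)
  also have "\<dots> = pair_weight k (z - w n) + c * (\<Sum>j\<in>A. pair_weight k (z - w n) * pf_term k w A j z)"
    unfolding IH[OF zA] by (simp add: algebra_simps sum_distrib_left)
  also have "(\<Sum>j\<in>A. pair_weight k (z - w n) * pf_term k w A j z) =
     (\<Sum>j\<in>A. pf_term k w (insert n A) j z
    + c * (pf_term k w A j (w n) / (z - w n) - pf_term k w A j (w n - k) / (z - w n + k)))"
    by (rule sum.cong) (use pf_term_insert[of A n _ k w z] wn zA zn insert in \<open>auto simp: c_def\<close>)
  also have "\<dots> = (\<Sum>j\<in>A. pf_term k w (insert n A) j z)
      + ((c * (\<Sum>j\<in>A. pf_term k w A j (w n))) / (z - w n) - (c * (\<Sum>j\<in>A. pf_term k w A j (w n - k))) / (z - w n + k))"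
    by (simp add: sum.distrib sum_distrib_left sum_subtractf sum_divide_distrib right_diff_distrib)
  also have "c * (\<Sum>j\<in>A. pf_term k w A j (w n)) = P (w n) - 1"
    using IH[of "w n"] wn by auto
  also have "c * (\<Sum>j\<in>A. pf_term k w A j (w n - k)) = P (w n - k) - 1"
    using IH[OF n1] by auto
  finally show ?case
    using insert.hyps unfolding h c_def[symmetric] by (simp add: tn) (simp add: algebra_simps diff_divide_distrib)
qed simp

text \<open>The difference of the two sides is, up to \<open>(k - 1) / k\<close>, the sum of all
  residues of the product of the \<open>pair_weight k (z - w j)\<close>, a function of the form 1 +
  O(1/z^2) at infinity. Instead of residues the proof uses induction, with the preceding expansion
  taken at \<open>w n\<close> and \<open>w n - k\<close>.\<close>

lemma sum_prod_pair_weight_reverse: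
  assumes "finite A" "generic_points k w A" "k \<noteq> 0"
  shows "(\<Sum>j\<in>A. \<Prod>l\<in>A-{j}. pair_weight k (w j - w l)) = (\<Sum>j\<in>A. \<Prod>l\<in>A-{j}. pair_weight k (w l - w j))"
  using assms
proof (induction A rule: finite_induct)
  case (insert n A)
  define c where "c = (k - 1) / k"
  define a where "a j = (\<Prod>l\<in>A-{j}. pair_weight k (w j - w l))" for j
  define b where "b j = (\<Prod>l\<in>A-{j}. pair_weight k (w l - w j))" for j
  note gA = generic_points_insertD(1)[OF insert.prems(1) insert.hyps(2)]
  note wn = generic_points_insertD(2-4)[OF insert.prems(1) insert.hyps(2)]
  note n1 = generic_points_insertD(5)[OF insert.prems(1) insert.hyps(2)]
  have IH: "(\<Sum>j\<in>A. a j) = (\<Sum>j\<in>A. b j)" using insert.IH gA insert.prems unfolding a_def b_def by simp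
  have ins: "insert n A - {j} = insert n (A - {j})" if "j \<in> A" for j using insert.hyps that by auto
  have P1: "(\<Prod>l\<in>A. pair_weight k (w n - w l)) = 1 + c * (\<Sum>j\<in>A. a j / (w n - w j) - b j / (w n - w j + k))"
    using prod_pair_weight_partial_fractions[OF insert.hyps(1) gA insert.prems(2), of "w n"] wn
    unfolding pf_term_def c_def a_def b_def by auto
  have refl: "pair_weight k (w l - w n) = pair_weight k (w n - k - w l)" for l
    using pair_weight_reflect[of k "w l - w n"] by (simp add: algebra_simps)
  have P2: "(\<Prod>l\<in>A. pair_weight k (w l - w n)) = 1 + c * (\<Sum>j\<in>A. a j / (w n - k - w j) - b j / (w n - w j))"
    unfolding refl using prod_pair_weight_partial_fractions[OF insert.hyps(1) gA insert.prems(2) n1]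
    unfolding pf_term_def c_def a_def b_def by simp
  \<comment> \<open>The fractions with \<open>w n\<close> cancel term by term once the pair weights
    are expanded. What remains is \<open>a j - b j\<close>, whose sum vanishes by induction.\<close>
  have key: "a j * pair_weight k (w j - w n) + c * (a j / (w n - w j) - b j / (w n - w j + k))
     = a j - b j + (b j * pair_weight k (w n - w j) + c * (a j / (w n - k - w j) - b j / (w n - w j)))" if "j \<in> A" for j
  proof -
    have h2: "pair_weight k (w j - w n) = 1 + c * (1 / (w j - w n) - 1 / (w j - w n + k))"
      using pair_weight_partial_fractions[of k "w j - w n"] insert.prems(2) wn[OF that] unfolding c_def by auto
    have h3: "pair_weight k (w n - w j) = 1 + c * (1 / (w n - w j) - 1 / (w n - w j + k))"
      using pair_weight_partial_fractions[of k "w n - w j"] insert.prems(2) wn[OF that] unfolding c_def by auto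
    have m1: "inverse (w j - w n) = - inverse (w n - w j)" by (metis inverse_minus_eq minus_diff_eq)
    have m2: "inverse (w n - k - w j) = - inverse (w j - w n + k)"
      by (metis (no_types, opaque_lifting) diff_add_eq diff_diff_eq2 inverse_minus_eq minus_diff_eq diff_right_commute add.commute)
    show ?thesis unfolding h2 h3 divide_inverse mult_1_left m1 m2 by (simp add: algebra_simps)
  qed
  have "(\<Sum>j\<in>insert n A. \<Prod>l\<in>insert n A-{j}. pair_weight k (w j - w l))
      = (\<Prod>l\<in>A. pair_weight k (w n - w l)) + (\<Sum>j\<in>A. a j * pair_weight k (w j - w n))"
    using insert.hyps by (simp add: ins a_def mult.commute)
  also have "\<dots> = 1 + (\<Sum>j\<in>A. a j * pair_weight k (w j - w n) + c * (a j / (w n - w j) - b j / (w n - w j + k)))"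
    unfolding P1 by (simp add: sum.distrib sum_distrib_left)
  also have "\<dots> = 1 + (\<Sum>j\<in>A. a j - b j + (b j * pair_weight k (w n - w j) + c * (a j / (w n - k - w j) - b j / (w n - w j))))"
    using key by simp
  also have "\<dots> = (\<Prod>l\<in>A. pair_weight k (w l - w n)) + (\<Sum>j\<in>A. b j * pair_weight k (w n - w j))"
    unfolding P2 sum.distrib sum_subtractf IH by (simp add: sum_distrib_left[symmetric] sum_subtractf)
  also have "\<dots> = (\<Sum>j\<in>insert n A. \<Prod>l\<in>insert n A-{j}. pair_weight k (w l - w j))"
    using insert.hyps by (simp add: ins b_def mult.commute)
  finally show ?case .
qed simp

text \<open>Multiplying the expansion by a linear factor creates an extra constant,
  \<open>(k - 1) / k\<close> times the sum of all \<open>a j - b j\<close>; it vanishes by the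
  preceding lemma.\<close>

lemma linear_times_prod_pair_weight:
  assumes "finite A" "generic_points k w A" "k \<noteq> 0" "\<forall>j\<in>A. z \<noteq> w j \<and> z - w j + k \<noteq> 0"
  shows "(v + z) * (\<Prod>j\<in>A. pair_weight k (z - w j)) = (v + z) + (k - 1) / k *
    (\<Sum>j\<in>A. (\<Prod>l\<in>A-{j}. pair_weight k (w j - w l)) * (v + w j) / (z - w j)
        - (\<Prod>l\<in>A-{j}. pair_weight k (w l - w j)) * (v + w j - k) / (z - w j + k))"
proof -
  define a where "a j = (\<Prod>l\<in>A-{j}. pair_weight k (w j - w l))" for j
  define b where "b j = (\<Prod>l\<in>A-{j}. pair_weight k (w l - w j))" for j
  have eq: "(v + z) * pf_term k w A j z = (a j - b j) + (a j * (v + w j) / (z - w j) - b j * (v + w j - k) / (z - w j + k))"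
    if "j \<in> A" for j
  proof -
    have "a j * (v + z) / (z - w j) = a j + a j * (v + w j) / (z - w j)"
      using assms(4) that by (simp add: divide_simps) algebra
    moreover have "b j * (v + z) / (z - w j + k) = b j + b j * (v + w j - k) / (z - w j + k)"
      using assms(4) that by (simp add: divide_simps) algebra
    ultimately show ?thesis unfolding pf_term_def a_def[symmetric] b_def[symmetric]
      by (simp add: algebra_simps)
  qed
  have z: "(\<Sum>j\<in>A. a j - b j) = 0"
    using sum_prod_pair_weight_reverse[OF assms(1-3)] unfolding a_def b_def by (simp add: sum_subtractf)
  have "(v + z) * (\<Sum>j\<in>A. pf_term k w A j z) = (\<Sum>j\<in>A. (a j - b j) + (a j * (v + w j) / (z - w j) - b j * (v + w j - k) / (z - w j + k)))"
    unfolding sum_distrib_left by (rule sum.cong) (use eq in auto)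
  also have "\<dots> = (\<Sum>j\<in>A. a j * (v + w j) / (z - w j) - b j * (v + w j - k) / (z - w j + k))"
    using z by (simp add: sum.distrib)
  finally have *: "(v + z) * (\<Sum>j\<in>A. pf_term k w A j z) = (\<Sum>j\<in>A. a j * (v + w j) / (z - w j) - b j * (v + w j - k) / (z - w j + k))" .
  have "(v + z) * (\<Prod>j\<in>A. pair_weight k (z - w j)) = (v + z) + (k - 1) / k * ((v + z) * (\<Sum>j\<in>A. pf_term k w A j z))"
    unfolding prod_pair_weight_partial_fractions[OF assms] by (simp only: distrib_left mult_1_right mult.left_commute)
  then show ?thesis unfolding * unfolding a_def b_def .
qed

section \<open>The subset sum and its recursion\<close>

definition subset_sum :: "'a::field \<Rightarrow> ('b \<Rightarrow> 'a) \<Rightarrow> 'b set \<Rightarrow> 'a \<Rightarrow> 'a \<Rightarrow> 'a" where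
  "subset_sum k w S X u = (\<Sum>R\<in>Pow S. (\<Prod>i\<in>R. \<Prod>j\<in>S-R. pair_weight k (w i - w j)) *
     ((\<Prod>i\<in>R. X + k + w i) * (\<Prod>j\<in>S-R. u + w j)))"

lemma sum_Pow_insert:
  fixes g :: "'b set \<Rightarrow> 'a::comm_monoid_add"
  assumes "finite S" "n \<notin> S"
  shows "(\<Sum>R\<in>Pow (insert n S). g R) = (\<Sum>R\<in>Pow S. g R + g (insert n R))"
proof -
  have "inj_on (insert n) (Pow S)" using assms(2) by (intro inj_onI) (metis PowD insert_ident subsetD)
  moreover have "Pow S \<inter> insert n ` Pow S = {}" using assms(2) by auto
  ultimately show ?thesis
    using assms(1) by (simp add: Pow_insert sum.union_disjoint sum.reindex sum.distrib o_def)
qed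

lemma subset_sum_term_insert:
  fixes k X u :: "'a::field" and w :: "'b \<Rightarrow> 'a"
  assumes "finite S" "n \<notin> S" "R \<subseteq> S"
  defines "T \<equiv> \<lambda>S R. (\<Prod>i\<in>R. \<Prod>j\<in>S-R. pair_weight k (w i - w j)) *
     ((\<Prod>i\<in>R. X + k + w i) * (\<Prod>j\<in>S-R. u + w j))"
  shows "T (insert n S) R = T S R * ((u + w n) * (\<Prod>i\<in>R. pair_weight k (w i - w n)))"
    and "T (insert n S) (insert n R) = T S R * ((X + k + w n) * (\<Prod>j\<in>S-R. pair_weight k (w n - w j)))"
proof -
  have fR: "finite R" using assms finite_subset by blast
  have s1: "insert n S - R = insert n (S - R)" "insert n S - insert n R = S - R" "n \<notin> R"
    using assms by auto
  show "T (insert n S) R = T S R * ((u + w n) * (\<Prod>i\<in>R. pair_weight k (w i - w n)))"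
    unfolding T_def s1 using assms(1,2) by (simp add: prod.distrib mult_ac)
  show "T (insert n S) (insert n R) = T S R * ((X + k + w n) * (\<Prod>j\<in>S-R. pair_weight k (w n - w j)))"
    unfolding T_def s1 using assms(1,2) fR s1(3) by (simp add: mult_ac)
qed

text \<open>
  Partial fractions in the new point \<open>w n\<close>: the residues at \<open>w n = w j\<close> cancel between \<open>R\<close> and
  \<open>insert j R\<close>, and those at \<open>w n = w j \<plusminus> k\<close> are products of a factor symmetric in \<open>X\<close> and \<open>u\<close> with
  a smaller subset sum.
\<close>

lemma subset_sum_insert:
  fixes k :: "'a::field" and w :: "'b \<Rightarrow> 'a"
  assumes S: "finite S" "n \<notin> S" and g: "generic_points k w (insert n S)" and k: "k \<noteq> 0"
  shows "subset_sum k w (insert n S) X u = (2 * w n + X + u + k) * subset_sum k w S X u + (k - 1) / k *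
    (\<Sum>j\<in>S. ((\<Prod>m\<in>S-{j}. pair_weight k (w j - w m)) * ((X + k + w j) * (u + k + w j)) / (w n - w j - k)
       - (\<Prod>m\<in>S-{j}. pair_weight k (w m - w j)) * ((X + w j) * (u + w j)) / (w n - w j + k))
      * subset_sum k w (S - {j}) X u)"
proof -
  define z where "z = w n"
  define c where "c = (k - 1) / k"
  define T where "T S R = (\<Prod>i\<in>R. \<Prod>j\<in>S-R. pair_weight k (w i - w j)) *
     ((\<Prod>i\<in>R. X + k + w i) * (\<Prod>j\<in>S-R. u + w j))" for S R
  have ss: "subset_sum k w S X u = (\<Sum>R\<in>Pow S. T S R)" for S
    unfolding subset_sum_def T_def ..
  define a where "a A j = (\<Prod>l\<in>A-{j}. pair_weight k (w j - w l))" for A j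
  define b where "b A j = (\<Prod>l\<in>A-{j}. pair_weight k (w l - w j))" for A j
  have zj: "z \<noteq> w j" "z - w j + k \<noteq> 0" "z - k \<noteq> w j" "z - k - w j \<noteq> 0" if "j \<in> S" for j
  proof -
    have "w n \<noteq> w j \<and> w n - w j + k \<noteq> 0 \<and> w j - w n + k \<noteq> 0"
      using g S(2) that unfolding generic_points_def by (metis insertCI)
    then show "z \<noteq> w j" "z - w j + k \<noteq> 0" "z - k \<noteq> w j" "z - k - w j \<noteq> 0"
      by (auto simp: z_def algebra_simps)
  qed
  define E where "E R j = (if j \<in> R then a R j * (u + k + w j) / (z - k - w j) - b R j * (u + w j) / (z - w j)
     else a (S - R) j * (X + k + w j) / (z - w j) - b (S - R) j * (X + w j) / (z - w j + k))" for R j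
  \<comment> \<open>Reflection rewrites \<open>w i - z\<close> as \<open>(z - k) - w i\<close>, so
    the first product is an expansion at \<open>z - k\<close> with linear factor
    \<open>(u + k) + (z - k)\<close>. Both products then have their poles in \<open>z\<close> among
    \<open>w j\<close>, \<open>w j + k\<close> and \<open>w j - k\<close>, and \<open>E R j\<close>
    collects those that belong to \<open>w j\<close>.\<close>
  have lin: "(u + z) * (\<Prod>i\<in>R. pair_weight k (w i - z)) + (X + k + z) * (\<Prod>j\<in>S-R. pair_weight k (z - w j))
      = (2 * z + X + u + k) + c * (\<Sum>j\<in>S. E R j)" if R: "R \<subseteq> S" for R
  proof -
    have fin: "finite R" "finite (S - R)" using S R finite_subset by auto
    have gR: "generic_points k w R" "generic_points k w (S - R)"
      using g R by (auto intro: generic_points_subset)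
    have "pair_weight k (w i - z) = pair_weight k (z - k - w i)" for i
      using pair_weight_reflect[of k "w i - z"] by (simp add: algebra_simps)
    then have "(u + z) * (\<Prod>i\<in>R. pair_weight k (w i - z)) = ((u + k) + (z - k)) * (\<Prod>i\<in>R. pair_weight k (z - k - w i))"
      by simp
    also have "\<dots> = (u + k + (z - k)) + (k - 1) / k * (\<Sum>j\<in>R. a R j * (u + k + w j) / (z - k - w j)
        - b R j * (u + k + w j - k) / (z - k - w j + k))"
      unfolding a_def b_def
      by (rule linear_times_prod_pair_weight[OF fin(1) gR(1) k]) (use zj R in auto)
    also have "\<dots> = (u + z) + c * (\<Sum>j\<in>R. E R j)"
      unfolding E_def c_def by simp
    finally have 1: "(u + z) * (\<Prod>i\<in>R. pair_weight k (w i - z)) = (u + z) + c * (\<Sum>j\<in>R. E R j)" .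
    have "(X + k + z) * (\<Prod>j\<in>S-R. pair_weight k (z - w j)) = (X + k + z) + (k - 1) / k *
        (\<Sum>j\<in>S-R. a (S-R) j * (X + k + w j) / (z - w j) - b (S-R) j * (X + k + w j - k) / (z - w j + k))"
      unfolding a_def b_def
      by (rule linear_times_prod_pair_weight[OF fin(2) gR(2) k]) (use zj R in auto)
    also have "\<dots> = (X + k + z) + c * (\<Sum>j\<in>S-R. E R j)"
      unfolding E_def c_def by simp
    finally have 2: "(X + k + z) * (\<Prod>j\<in>S-R. pair_weight k (z - w j)) = (X + k + z) + c * (\<Sum>j\<in>S-R. E R j)" .
    have "(\<Sum>j\<in>S. E R j) = (\<Sum>j\<in>S-R. E R j) + (\<Sum>j\<in>R. E R j)"
      by (rule sum.subset_diff[OF R S(1)])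
    then show ?thesis unfolding 1 2 by (simp add: algebra_simps)
  qed
  have cross: "(\<Sum>R\<in>Pow S. T S R * E R j) = ((\<Prod>m\<in>S-{j}. pair_weight k (w j - w m)) * ((X + k + w j) * (u + k + w j)) / (w n - w j - k)
       - (\<Prod>m\<in>S-{j}. pair_weight k (w m - w j)) * ((X + w j) * (u + w j)) / (w n - w j + k))
      * subset_sum k w (S - {j}) X u" if j: "j \<in> S" for j
  proof -
    define S' where "S' = S - {j}"
    have S': "S = insert j S'" "j \<notin> S'" "finite S'" using j S by (auto simp: S'_def)
    have "(\<Sum>R\<in>Pow S. T S R * E R j) = (\<Sum>Q\<in>Pow S'. T S Q * E Q j + T S (insert j Q) * E (insert j Q) j)"
      unfolding S'(1) by (rule sum_Pow_insert) (use S' in auto)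
    also have "\<dots> = (\<Sum>Q\<in>Pow S'. T S' Q * (a S j * ((X + k + w j) * (u + k + w j)) / (z - w j - k)
       - b S j * ((X + w j) * (u + w j)) / (z - w j + k)))"
    proof (rule sum.cong)
      fix Q assume "Q \<in> Pow S'"
      then have Q: "Q \<subseteq> S'" "finite Q" "j \<notin> Q" using S' finite_subset by auto
      define p q r s where "p = (\<Prod>i\<in>Q. pair_weight k (w i - w j))" and "q = (\<Prod>i\<in>S'-Q. pair_weight k (w j - w i))"
        and "r = (\<Prod>i\<in>Q. pair_weight k (w j - w i))" and "s = (\<Prod>i\<in>S'-Q. pair_weight k (w i - w j))"
      have e1: "S - Q - {j} = S' - Q" "insert j Q - {j} = Q" "S - {j} = S'" using Q S' by auto
      have t: "T S Q = T S' Q * ((u + w j) * p)" "T S (insert j Q) = T S' Q * ((X + k + w j) * q)"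
        unfolding S'(1) T_def p_def q_def using subset_sum_term_insert[OF S'(3,2) Q(1), of k w X u] by simp_all
      have ab: "a (insert j Q) j = r" "b (insert j Q) j = p" "a (S - Q) j = q" "b (S - Q) j = s"
        unfolding a_def b_def e1 p_def q_def r_def s_def by simp_all
      have ab2: "a S j = r * q" "b S j = p * s"
        unfolding a_def b_def e1 p_def q_def r_def s_def
        using prod.subset_diff[OF Q(1) S'(3)] by (simp_all add: mult.commute)
      have zz: "z - k - w j = z - w j - k" by simp
      show "T S Q * E Q j + T S (insert j Q) * E (insert j Q) j = T S' Q * (a S j * ((X + k + w j) * (u + k + w j)) / (z - w j - k)
       - b S j * ((X + w j) * (u + w j)) / (z - w j + k))"
        unfolding t E_def ab ab2 zz using Q(3) unfolding divide_inverse by (simp, algebra)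
    qed simp
    also have "\<dots> = (a S j * ((X + k + w j) * (u + k + w j)) / (z - w j - k)
       - b S j * ((X + w j) * (u + w j)) / (z - w j + k)) * subset_sum k w S' X u"
      unfolding ss sum_distrib_left by (simp only: mult.commute)
    finally show ?thesis unfolding S'_def a_def b_def z_def .
  qed
  have "subset_sum k w (insert n S) X u = (\<Sum>R\<in>Pow S. T (insert n S) R + T (insert n S) (insert n R))"
    unfolding ss by (rule sum_Pow_insert[OF S])
  also have "\<dots> = (\<Sum>R\<in>Pow S. T S R * ((2 * z + X + u + k) + c * (\<Sum>j\<in>S. E R j)))"
  proof (rule sum.cong)
    fix R assume "R \<in> Pow S"
    then have R: "R \<subseteq> S" by simp
    show "T (insert n S) R + T (insert n S) (insert n R) = T S R * ((2 * z + X + u + k) + c * (\<Sum>j\<in>S. E R j))"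
      unfolding lin[OF R, symmetric] T_def
      using subset_sum_term_insert[OF S R, of k w X u] by (simp only: z_def distrib_left)
  qed simp
  also have "\<dots> = (2 * z + X + u + k) * subset_sum k w S X u + c * (\<Sum>R\<in>Pow S. \<Sum>j\<in>S. T S R * E R j)"
    unfolding ss by (simp add: distrib_left sum.distrib sum_distrib_left mult_ac)
  also have "(\<Sum>R\<in>Pow S. \<Sum>j\<in>S. T S R * E R j) = (\<Sum>j\<in>S. \<Sum>R\<in>Pow S. T S R * E R j)"
    by (rule sum.swap)
  finally show ?thesis unfolding z_def c_def by (simp add: cross)
qed

text \<open>In \<open>subset_sum_insert\<close> every explicit coefficient is symmetric in
  \<open>X\<close> and \<open>u\<close>, although the summands are not, and the remaining subset
  sums run over smaller sets.\<close>

theorem subset_sum_symmetric: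
  assumes "finite S" "generic_points k w S" "k \<noteq> 0"
  shows "subset_sum k w S X u = subset_sum k w S u X"
  using assms
proof (induction "card S" arbitrary: S rule: less_induct)
  case less
  show ?case
  proof (cases "S = {}")
    case True
    then show ?thesis by (simp add: subset_sum_def)
  next
    case False
    then obtain n S' where S: "S = insert n S'" "n \<notin> S'" by (meson mk_disjoint_insert ex_in_conv)
    have f: "finite S'" using S less.prems by simp
    have IH: "subset_sum k w B X u = subset_sum k w B u X" if "B \<subseteq> S'" for B
    proof (rule less.hyps)
      show "card B < card S"
        using that S f by (metis card_mono card_insert_disjoint le_imp_less_Suc)
      show "finite B" using that f finite_subset by blast
      show "generic_points k w B" using generic_points_subset[OF less.prems(2)] that S by blast
    qed fact
    have g: "generic_points k w (insert n S')" using less.prems S by simp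
    show ?thesis unfolding S(1) subset_sum_insert[OF f S(2) g less.prems(3)]
      using IH[of S'] IH[of "S' - {_}"] by (simp add: mult_ac add_ac)
  qed
qed

section \<open>Jack coefficients in terms of column lengths\<close>

lemma kk_gt_of_nat: "of_nat n < kk"
proof -
  have "[:0, 1:] - [:rat_of_nat n:] = [:- of_nat n, 1:]" by simp
  then have "(of_nat n :: rat poly) < [:0, 1:]"
    by (simp add: less_poly_def of_nat_poly pos_poly_def)
  then show ?thesis by (simp add: kk_def of_nat_fract)
qed

lemma kk_pos: "0 < kk" and kk_gt_1: "1 < kk" 
  using kk_gt_of_nat[of 0] kk_gt_of_nat[of 1] by simp_all

text \<open>In the order of Q(k) given by leading coefficients \<open>kk\<close> exceeds every
  natural number, so a nonzero integer multiple of it dominates every integer. This supplies the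
  genericity of the column variables.\<close>

lemma kk_affine_eq_0:
  assumes "of_int a + of_int b * kk = 0"
  shows "a = 0 \<and> b = 0"
proof (rule ccontr)
  assume "\<not> (a = 0 \<and> b = 0)"
  moreover have "b = 0 \<Longrightarrow> a = 0" using assms by simp
  ultimately have "b \<noteq> 0" by auto
  then have "1 \<le> \<bar>b\<bar>" by presburger
  then have "(1::Qk) \<le> of_int \<bar>b\<bar>" by (metis of_int_1 of_int_le_iff)
  then have "kk * 1 \<le> kk * of_int \<bar>b\<bar>"
    using kk_pos by (intro mult_left_mono) auto
  also have "\<dots> = \<bar>of_int b * kk\<bar>" using kk_pos by (simp add: abs_mult)
  also have "of_int b * kk = - of_int a" using assms by (simp add: add_eq_0_iff)
  also have "\<bar>- of_int a\<bar> = (of_nat (nat \<bar>a\<bar>) :: Qk)" by simp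
  finally show False using kk_gt_of_nat[of "nat \<bar>a\<bar>"] by simp
qed

section \<open>Young diagrams and horizontal strips through column lengths\<close>

lemma down_closed_eq_atLeastAtMost_card:
  assumes "finite A" "A \<subseteq> {1::nat..}" "\<And>i i'. i \<in> A \<Longrightarrow> 1 \<le> i' \<Longrightarrow> i' \<le> i \<Longrightarrow> i' \<in> A"
  shows "A = {1..card A}"
proof (cases "A = {}")
  case False
  have "A = {1..Max A}"
  proof
    show "A \<subseteq> {1..Max A}" using assms by auto
    show "{1..Max A} \<subseteq> A" using assms Max_in[OF assms(1) False] by auto
  qed
  then show ?thesis by (metis card_atLeastAtMost diff_Suc_1' diff_add_inverse Suc_eq_plus1 add_diff_cancel_right')
qed simp

lemma young_finite: "young_diagram D \<Longrightarrow> finite D"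
  unfolding young_diagram_def by simp

lemma young_mem_col:
  assumes "young_diagram D"
  shows "(i, j) \<in> D \<longleftrightarrow> 1 \<le> i \<and> 1 \<le> j \<and> i \<le> col_len D j"
proof -
  have "{i. (i, j) \<in> D} \<subseteq> fst ` D" by force
  then have fin: "finite {i. (i, j) \<in> D}"
    using young_finite[OF assms] by (meson finite_imageI finite_subset)
  have "{i. (i, j) \<in> D} = {1..col_len D j}"
    unfolding col_len_def
    by (rule down_closed_eq_atLeastAtMost_card[OF fin])
       (use assms in \<open>auto simp: young_diagram_def, (metis atLeastAtMost_iff le_refl)?\<close>)
  then have "(i, j) \<in> D \<longleftrightarrow> i \<in> {1..col_len D j}" by blast
  moreover have "(i, j) \<in> D \<Longrightarrow> 1 \<le> j" using assms unfolding young_diagram_def by auto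
  ultimately show ?thesis by auto
qed

lemma young_mem_row:
  assumes "young_diagram D"
  shows "(i, j) \<in> D \<longleftrightarrow> 1 \<le> i \<and> 1 \<le> j \<and> j \<le> row_len D i"
proof -
  have fin: "finite {j. (i, j) \<in> D}" by (rule young_diagram_rows(1)[OF assms])
  have "{j. (i, j) \<in> D} = {1..row_len D i}"
    unfolding row_len_def
    by (rule down_closed_eq_atLeastAtMost_card[OF fin])
       (use assms in \<open>auto simp: young_diagram_def, (metis atLeastAtMost_iff le_refl)?\<close>)
  then have "(i, j) \<in> D \<longleftrightarrow> j \<in> {1..row_len D i}" by blast
  moreover have "(i, j) \<in> D \<Longrightarrow> 1 \<le> i" using assms unfolding young_diagram_def by auto
  ultimately show ?thesis by auto
qed

lemma young_closed:
  assumes "young_diagram D" "(i, j) \<in> D" "1 \<le> i'" "i' \<le> i" "1 \<le> j'" "j' \<le> j"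
  shows "(i', j') \<in> D"
  using assms unfolding young_diagram_def by (meson atLeastAtMost_iff)

lemma col_len_antimono:
  assumes "young_diagram D" "1 \<le> j" "j \<le> j'"
  shows "col_len D j' \<le> col_len D j"
proof (cases "col_len D j' = 0")
  case False
  then have "(col_len D j', j') \<in> D" using young_mem_col[OF assms(1)] assms(2,3) by auto
  then have "(col_len D j', j) \<in> D" using young_closed[OF assms(1)] assms False by auto
  then show ?thesis using young_mem_col[OF assms(1)] by auto
qed simp

text \<open>No monotonicity is built in: any change of column lengths gives a set of boxes, and
  whether it is a Young diagram is decided afterwards.\<close>

definition diagram_of :: "(nat \<Rightarrow> nat) \<Rightarrow> diagram" where
  "diagram_of c = {(i, j). 1 \<le> i \<and> 1 \<le> j \<and> i \<le> c j}"

lemma col_len_diagram_of: "1 \<le> j \<Longrightarrow> col_len (diagram_of c) j = c j"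
proof -
  assume "1 \<le> j"
  then have "{i. (i, j) \<in> diagram_of c} = {1..c j}" by (auto simp: diagram_of_def)
  then show ?thesis by (simp add: col_len_def)
qed

lemma young_diagram_of:
  assumes anti: "\<And>j. 1 \<le> j \<Longrightarrow> c (Suc j) \<le> c j" and fin: "\<And>j. j > M \<Longrightarrow> c j = 0"
  shows "young_diagram (diagram_of c)"
proof -
  have mono: "c j' \<le> c j" if "1 \<le> j" "j \<le> j'" for j j'
    using that(2)
  proof (induction rule: dec_induct)
    case (step n)
    then show ?case using anti[of n] that(1) by linarith
  qed simp
  have "diagram_of c \<subseteq> {1..c 1} \<times> {1..M}"
  proof
    fix s assume "s \<in> diagram_of c"
    then obtain i j where s: "s = (i, j)" "1 \<le> i" "1 \<le> j" "i \<le> c j" by (auto simp: diagram_of_def)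
    moreover have "j \<le> M" using fin[of j] s by (metis le_zero_eq not_less one_le_mult_iff mult_0 not_one_le_zero)
    ultimately show "s \<in> {1..c 1} \<times> {1..M}" using mono[of 1 j] by auto
  qed
  then have "finite (diagram_of c)" using finite_subset by blast
  moreover have "(i', j') \<in> diagram_of c" if "(i, j) \<in> diagram_of c" "i' \<in> {1..i}" "j' \<in> {1..j}" for i j i' j'
    using that mono[of j' j] by (auto simp: diagram_of_def)
  ultimately show ?thesis unfolding young_diagram_def by (auto simp: diagram_of_def)
qed

lemma diagram_of_col_len:
  assumes "young_diagram D"
  shows "diagram_of (col_len D) = D"
  using young_mem_col[OF assms] by (auto simp: diagram_of_def)

text \<open>Interlacing of rows, transposed: a horizontal strip has at most one box in each column.
  In this form the strips over a fixed diagram are given by sets of columns.\<close>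

definition hstrip :: "diagram \<Rightarrow> diagram \<Rightarrow> bool" where
  "hstrip lam kap \<longleftrightarrow> young_diagram lam \<and> young_diagram kap \<and>
     (\<forall>j\<ge>1. col_len kap j \<le> col_len lam j \<and> col_len lam j \<le> col_len kap j + 1)"

lemma hstrip_young: "hstrip L K \<Longrightarrow> young_diagram L" "hstrip L K \<Longrightarrow> young_diagram K"
  unfolding hstrip_def by auto

lemma hstrip_col_le:
  "hstrip L K \<Longrightarrow> 1 \<le> j \<Longrightarrow> col_len K j \<le> col_len L j \<and> col_len L j \<le> col_len K j + 1"
  unfolding hstrip_def by auto

lemma hstrip_subset: "hstrip lam kap \<Longrightarrow> kap \<subseteq> lam"
  unfolding hstrip_def using young_mem_col by (metis order_trans subrelI)

definition cols_in :: "nat \<Rightarrow> diagram \<Rightarrow> bool" where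
  "cols_in M D \<longleftrightarrow> (\<forall>(i, j)\<in>D. j \<le> M)"

lemma col_len_eq_0: "young_diagram D \<Longrightarrow> cols_in M D \<Longrightarrow> M < j \<Longrightarrow> col_len D j = 0"
proof -
  assume D: "young_diagram D" "cols_in M D" "M < j"
  then have "(1, j) \<notin> D" unfolding cols_in_def by force
  then show ?thesis using young_mem_col[OF D(1), of 1 j] D(3) by auto
qed

section \<open>Products of b along one column\<close>

definition col_arm :: "(nat \<Rightarrow> nat) \<Rightarrow> nat \<Rightarrow> nat \<Rightarrow> nat \<Rightarrow> nat" where
  "col_arm c M i j = card {d \<in> {j<..M}. i \<le> c d}"

text \<open>The product of \<open>bfac\<close> over column \<open>j\<close> of the diagram cut off
  after column \<open>M\<close>. The cut permits induction on the number of columns, the arms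
  growing one column at a time.\<close>

definition col_prod :: "(nat \<Rightarrow> nat) \<Rightarrow> nat \<Rightarrow> nat \<Rightarrow> Qk" where
  "col_prod c M j = (\<Prod>i=1..c j. (of_nat (col_arm c M i j) + kk * of_nat (c j - i) + kk)
     / (of_nat (col_arm c M i j) + kk * of_nat (c j - i) + 1))"

lemma bfac_pos: "bfac D s > 0"
  unfolding bfac_def using kk_pos by (auto intro!: divide_pos_pos add_nonneg_pos)

lemma col_prod_pos: "col_prod c M j > 0"
  unfolding col_prod_def using kk_pos by (auto intro!: prod_pos divide_pos_pos add_nonneg_pos)

lemma arm_eq_col_arm:
  assumes D: "young_diagram D" "cols_in M D" and s: "(i, j) \<in> D"
  shows "arm D (i, j) = col_arm (col_len D) M i j"
proof -
  have "{d \<in> {j<..M}. i \<le> col_len D d} = {j<..row_len D i}"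
  proof (intro set_eqI iffI)
    fix d assume d: "d \<in> {d \<in> {j<..M}. i \<le> col_len D d}"
    then have "(i, d) \<in> D" using s young_mem_col[OF D(1)] by auto
    then show "d \<in> {j<..row_len D i}" using d young_mem_row[OF D(1)] by auto
  next
    fix d assume d: "d \<in> {j<..row_len D i}"
    then have "(i, d) \<in> D" using s young_mem_row[OF D(1), of i d] young_mem_row[OF D(1), of i j] by auto
    moreover from this have "d \<le> M" using D(2) unfolding cols_in_def by blast
    ultimately show "d \<in> {d \<in> {j<..M}. i \<le> col_len D d}"
      using d young_mem_col[OF D(1), of i d] by auto
  qed
  then show ?thesis unfolding col_arm_def arm_def by simp
qed

lemma prod_bfac_column:
  assumes D: "young_diagram D" "cols_in M D" and j: "1 \<le> j"
  shows "(\<Prod>i=1..col_len D j. bfac D (i, j)) = col_prod (col_len D) M j"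
  unfolding col_prod_def
proof (rule prod.cong)
  fix i assume "i \<in> {1..col_len D j}"
  then have "(i, j) \<in> D" using young_mem_col[OF D(1)] j by auto
  then show "bfac D (i, j) = (of_nat (col_arm (col_len D) M i j) + kk * of_nat (col_len D j - i) + kk)
     / (of_nat (col_arm (col_len D) M i j) + kk * of_nat (col_len D j - i) + 1)"
    unfolding bfac_def by (simp add: arm_eq_col_arm[OF D] leg_def)
qed simp

text \<open>The ratio of the values of b at arm \<open>e + 1\<close> and at arm \<open>e\<close>
  with the same leg \<open>l\<close>. This is where \<open>pair_weight\<close> comes from.\<close>

definition arm_step :: "nat \<Rightarrow> nat \<Rightarrow> Qk" where
  "arm_step e l = inverse (pair_weight kk (of_nat (e + 1) + kk * of_nat l))"

lemma pair_weight_kk_pos: "e > 0 \<Longrightarrow> pair_weight kk (of_nat e + kk * of_nat l) > 0"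
proof -
  assume "e > 0"
  then have y: "0 < of_nat e + kk * of_nat l" using kk_pos by (intro add_pos_nonneg) auto
  then have "0 < of_nat e + kk * of_nat l + kk - 1" using kk_gt_1 by linarith
  with y show ?thesis unfolding pair_weight_def using kk_pos
    by (intro divide_pos_pos mult_pos_pos) simp_all
qed

lemma arm_step_nonzero: "arm_step e l \<noteq> 0"
  unfolding arm_step_def using pair_weight_kk_pos[of "e + 1" l] by (simp add: less_le)

text \<open>Column \<open>M + 1\<close> lengthens exactly the arms in its own rows. These rows are
  full up to column \<open>M\<close>, so before the step all their arms at column \<open>j\<close>
  equal \<open>M - j\<close>.\<close>

lemma col_prod_Suc:
  fixes D :: diagram
  defines "c \<equiv> col_len D"
  assumes D: "young_diagram D" and j: "1 \<le> j" "j \<le> M"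
  shows "col_prod c (Suc M) j = col_prod c M j * (\<Prod>i=1..c (Suc M). arm_step (M - j) (c j - i))"
proof -
  define t where "t a l = (of_nat a + kk * of_nat l + kk) / (of_nat a + kk * of_nat l + 1)" for a l :: nat
  note anti = col_len_antimono[OF D, folded c_def]
  have le: "c (Suc M) \<le> c j" using anti j by simp
  have cut: "(\<Prod>i=1..c j. g i) = (\<Prod>i=1..c (Suc M). g i) * (\<Prod>i=c (Suc M)+1..c j. g i)" for g :: "nat \<Rightarrow> Qk"
    using le by (metis le_add2 Suc_eq_plus1 le_Suc_eq prod.ub_add_nat le_add_diff_inverse add.commute)
  have small: "col_arm c M i j = M - j" "col_arm c (Suc M) i j = Suc (M - j)" if "i \<le> c (Suc M)" for i
  proof -
    have "i \<le> c d" if "d \<in> {j<..Suc M}" for d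
      using anti[of d "Suc M"] that \<open>i \<le> c (Suc M)\<close> j by auto
    then have "{d \<in> {j<..M}. i \<le> c d} = {j<..M}" "{d \<in> {j<..Suc M}. i \<le> c d} = {j<..Suc M}" by auto
    then show "col_arm c M i j = M - j" "col_arm c (Suc M) i j = Suc (M - j)"
      unfolding col_arm_def using j by auto
  qed
  have large: "col_arm c (Suc M) i j = col_arm c M i j" if "i > c (Suc M)" for i
  proof -
    have "{d \<in> {j<..Suc M}. i \<le> c d} = {d \<in> {j<..M}. i \<le> c d}"
      using that by (auto simp: le_Suc_eq)
    then show ?thesis unfolding col_arm_def by simp
  qed
  have step: "t (Suc a) l = t a l * arm_step a l" for a l
  proof -
    define y where "y = of_nat a + 1 + kk * of_nat l"
    have "0 \<le> kk * of_nat l" "0 \<le> (of_nat a :: Qk)" using kk_pos by simp_all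
    then have pos: "y > 0" "y + 1 > 0" "y + kk > 0" "y + kk - 1 > 0"
      using kk_gt_1 unfolding y_def by (simp_all add: add_nonneg_pos add_pos_nonneg)
    have 1: "t (Suc a) l = (y + kk) / (y + 1)" "t a l = (y + kk - 1) / y"
      unfolding t_def y_def by (simp_all add: algebra_simps)
    have 2: "arm_step a l = (y * (y + kk)) / ((y + 1) * (y + kk - 1))"
      unfolding arm_step_def pair_weight_def y_def by (simp add: algebra_simps)
    show ?thesis unfolding 1 2 using pos by (simp add: divide_simps)
  qed
  have "col_prod c (Suc M) j = (\<Prod>i=1..c (Suc M). t (col_arm c (Suc M) i j) (c j - i)) *
      (\<Prod>i=c (Suc M)+1..c j. t (col_arm c (Suc M) i j) (c j - i))"
    unfolding col_prod_def t_def by (rule cut)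
  also have "\<dots> = (\<Prod>i=1..c (Suc M). t (col_arm c M i j) (c j - i) * arm_step (M - j) (c j - i)) *
      (\<Prod>i=c (Suc M)+1..c j. t (col_arm c M i j) (c j - i))"
    using small large step by simp
  also have "\<dots> = col_prod c M j * (\<Prod>i=1..c (Suc M). arm_step (M - j) (c j - i))"
    unfolding col_prod_def t_def[symmetric] cut by (simp add: prod.distrib)
  finally show ?thesis .
qed

definition col_var :: "(nat \<Rightarrow> nat) \<Rightarrow> nat \<Rightarrow> Qk" where
  "col_var c j = kk * of_nat (c j) - of_nat j"

lemma inverse_arm_step_col_var:
  assumes "c d \<le> c j" "j < d"
  shows "pair_weight kk (col_var c j - col_var c d) = inverse (arm_step (d - 1 - j) (c j - c d))"
proof -
  have "col_var c j - col_var c d = of_nat (d - 1 - j + 1) + kk * of_nat (c j - c d)"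
    using assms unfolding col_var_def by (simp add: of_nat_diff algebra_simps)
  then show ?thesis unfolding arm_step_def by simp
qed

text \<open>With the cut directly after column \<open>j\<close> all arms are 0, so one more box
  contributes the factor for leg \<open>kap j\<close>; \<open>col_var kap j + j\<close> is
  \<open>kk\<close> times that leg.\<close>

lemma col_prod_base:
  assumes "lam j = kap j + 1"
  shows "col_prod lam j j = col_prod kap j j * ((col_var kap j + of_nat j + kk) / (col_var kap j + of_nat j + 1))"
proof -
  have "col_prod c j j = (\<Prod>i<c j. (kk * of_nat i + kk) / (kk * of_nat i + 1))" for c
    unfolding col_prod_def col_arm_def
    by (rule prod.reindex_bij_witness[of _ "\<lambda>i. c j - i" "\<lambda>i. c j - i"]) auto
  then show ?thesis using assms unfolding col_var_def by simp
qed

text \<open>An added box moves the legs of column \<open>j\<close> by one row, so its arm factors in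
  \<open>L\<close> are those in \<open>K\<close> preceded by \<open>T (c j)\<close>. If the next
  column is missed by the strip, the list for \<open>L\<close> is one factor shorter, and the
  missing factor is the inverse of the pair weight. The factor \<open>T (c j)\<close> itself carries
  the boundary term from one cut to the next.\<close>

lemma col_prod_phi:
  assumes "hstrip L K" "1 \<le> j" "j \<le> M" "col_len L j = col_len K j + 1"
  defines "w \<equiv> col_var (col_len K)"
  shows "col_prod (col_len L) M j = col_prod (col_len K) M j *
    ((\<Prod>d | d \<in> {j<..M} \<and> col_len L d = col_len K d. pair_weight kk (w j - w d)) *
      ((w j + of_nat M + kk) / (w j + of_nat M + 1)))"
  using assms(3)
proof (induction M rule: dec_induct)
  case base
  have "{d \<in> {j<..j}. col_len L d = col_len K d} = {}" by auto
  then have "(\<Prod>d | d \<in> {j<..j} \<and> col_len L d = col_len K d. pair_weight kk (w j - w d)) = 1"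
    by (metis prod.empty)
  then show ?case using col_prod_base[of "col_len L" j "col_len K", OF assms(4)] unfolding w_def by simp
next
  case (step M)
  define l where "l = col_len L"
  define c where "c = col_len K"
  define d where "d = Suc M"
  define T where "T = arm_step (M - j)"
  note yL = hstrip_young(1)[OF assms(1)] and yK = hstrip_young(2)[OF assms(1)]
  note lc = hstrip_col_le[OF assms(1), folded l_def c_def]
  have lj: "l j = c j + 1" using assms(4) unfolding l_def c_def .
  have jd: "j < d" "1 \<le> d" using step assms(2) unfolding d_def by auto
  have cd: "c d \<le> c j" using col_len_antimono[OF yK assms(2), of d] jd unfolding c_def by simp
  have SL: "col_prod l d j = col_prod l M j * (\<Prod>i=1..l d. T (l j - i))"
    unfolding d_def T_def l_def using col_prod_Suc[OF yL] assms(2) step by simp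
  have SK: "col_prod c d j = col_prod c M j * (\<Prod>i=1..c d. T (c j - i))"
    unfolding d_def T_def c_def using col_prod_Suc[OF yK] assms(2) step by simp
  define y where "y = w j + of_nat d"
  have yT: "y = of_nat (M - j + 1) + kk * of_nat (c j)"
    unfolding y_def w_def col_var_def d_def c_def using step(1) by (simp add: of_nat_diff)
  have ypos: "y > 0" "y + 1 > 0" "y + kk > 0" "y + kk - 1 > 0"
  proof -
    have "0 \<le> kk * of_nat (c j)" "0 \<le> (of_nat (M - j) :: Qk)" using kk_pos by simp_all
    then show "y > 0" "y + 1 > 0" "y + kk > 0" "y + kk - 1 > 0"
      using kk_gt_1 unfolding yT by (simp_all add: add_nonneg_pos add_pos_nonneg)
  qed
  have Tc: "T (c j) = (y * (y + kk)) / ((y + 1) * (y + kk - 1))"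
    unfolding T_def arm_step_def yT[symmetric] pair_weight_def by simp
  \<comment> \<open>Row \<open>i + 1\<close> of column \<open>j\<close> in \<open>L\<close> has the
    leg of row \<open>i\<close> in \<open>K\<close>, and row 1 has the new leg
    \<open>c j\<close>.\<close>
  have shift: "(\<Prod>i=1..Suc n. T (l j - i)) = T (c j) * (\<Prod>i=1..n. T (c j - i))" for n
  proof -
    have "(\<Prod>i=1..Suc n. T (l j - i)) = (\<Prod>i=0..n. T (c j - i))"
      unfolding One_nat_def prod.shift_bounds_cl_Suc_ivl lj by simp
    also have "\<dots> = T (c j) * (\<Prod>i=1..n. T (c j - i))" by (simp add: prod.atLeast_Suc_atMost)
    finally show ?thesis .
  qed
  \<comment> \<open>\<open>(y - 1 + kk) / y\<close> is the boundary factor for the cut at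
    \<open>M\<close>, and the right-hand side the one for the cut at \<open>M + 1\<close>.\<close>
  have ratio: "T (c j) * ((y - 1 + kk) / y) = (y + kk) / (y + 1)"
  proof -
    have "y * r / (s * q) * (q / y) = r / s" if "q > 0" for q r s :: Qk
      using that ypos(1) by simp
    moreover have "y - 1 + kk = y + kk - 1" by simp
    ultimately show ?thesis unfolding Tc using ypos(4) by metis
  qed
  have wM: "w j + of_nat M = y - 1" unfolding y_def d_def by simp
  have wd: "w j + of_nat (Suc M) = y" unfolding y_def d_def by simp
  note IH = step.IH[folded l_def c_def, unfolded wM]
  show ?case
  proof (cases "l d = c d")
    case True
    have "{d' \<in> {j<..d}. l d' = c d'} = insert d {d' \<in> {j<..M}. l d' = c d'}"
      using True jd unfolding d_def by auto
    then have pr: "(\<Prod>d' | d' \<in> {j<..d} \<and> l d' = c d'. pair_weight kk (w j - w d'))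
      = pair_weight kk (w j - w d) * (\<Prod>d' | d' \<in> {j<..M} \<and> l d' = c d'. pair_weight kk (w j - w d'))"
      by (simp add: d_def)
    have h: "pair_weight kk (w j - w d) = inverse (T (c j - c d))"
      unfolding w_def T_def c_def using inverse_arm_step_col_var[of "col_len K" d j] cd jd unfolding c_def d_def by simp
    have "(\<Prod>i=1..c d. T (l j - i)) * T (c j - c d) = (\<Prod>i=1..Suc (c d). T (l j - i))"
      unfolding lj by simp
    then have pT: "(\<Prod>i=1..c d. T (l j - i)) = T (c j) * (\<Prod>i=1..c d. T (c j - i)) * inverse (T (c j - c d))"
      unfolding shift using arm_step_nonzero[of "M - j" "c j - c d"] unfolding T_def by (simp add: field_simps)
    have "col_prod l d j = col_prod c d j * (pair_weight kk (w j - w d) * (\<Prod>d' | d' \<in> {j<..M} \<and> l d' = c d'. pair_weight kk (w j - w d'))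
       * (T (c j) * ((y - 1 + kk) / y)))"
      unfolding SL SK IH True pT h by (simp add: mult_ac)
    then show ?thesis unfolding ratio pr[symmetric] wd unfolding d_def l_def c_def .
  next
    case False
    then have ld: "l d = Suc (c d)" using lc[of d] jd by simp
    have "{d' \<in> {j<..d}. l d' = c d'} = {d' \<in> {j<..M}. l d' = c d'}"
      using False jd unfolding d_def by (auto simp: le_Suc_eq)
    then have pr: "(\<Prod>d' | d' \<in> {j<..d} \<and> l d' = c d'. pair_weight kk (w j - w d'))
      = (\<Prod>d' | d' \<in> {j<..M} \<and> l d' = c d'. pair_weight kk (w j - w d'))"
      by simp
    have "col_prod l d j = col_prod c d j * ((\<Prod>d' | d' \<in> {j<..M} \<and> l d' = c d'. pair_weight kk (w j - w d'))
       * (T (c j) * ((y - 1 + kk) / y)))"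
      unfolding SL SK IH ld shift by (simp add: mult_ac)
    then show ?thesis unfolding ratio pr[symmetric] wd unfolding d_def l_def c_def .
  qed
qed

text \<open>Column \<open>j\<close> keeps its legs. A column \<open>d\<close> to its right that
  gains a box lengthens one more arm, in the row with leg \<open>c j - c d - 1\<close>, and
  reflection turns the resulting argument into \<open>w d - w j\<close>.\<close>

lemma col_prod_psi:
  assumes "hstrip L K" "1 \<le> j" "j \<le> M" "col_len L j = col_len K j"
  defines "w \<equiv> col_var (col_len K)"
  shows "col_prod (col_len K) M j = col_prod (col_len L) M j *
    (\<Prod>d | d \<in> {j<..M} \<and> col_len L d = col_len K d + 1. pair_weight kk (w d - w j))"
  using assms(3)
proof (induction M rule: dec_induct)
  case base
  have "{d \<in> {j<..j}. col_len L d = col_len K d + 1} = {}" by auto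
  then have "(\<Prod>d | d \<in> {j<..j} \<and> col_len L d = col_len K d + 1. pair_weight kk (w d - w j)) = 1"
    by (metis prod.empty)
  then show ?case by (simp add: col_prod_def col_arm_def assms(4))
next
  case (step M)
  define l where "l = col_len L"
  define c where "c = col_len K"
  define d where "d = Suc M"
  define T where "T = arm_step (M - j)"
  note yL = hstrip_young(1)[OF assms(1)] and yK = hstrip_young(2)[OF assms(1)]
  note lc = hstrip_col_le[OF assms(1), folded l_def c_def]
  have lj: "l j = c j" using assms(4) unfolding l_def c_def .
  have jd: "j < d" "1 \<le> d" using step assms(2) unfolding d_def by auto
  have ld: "l d \<le> l j" using col_len_antimono[OF yL assms(2), of d] jd unfolding l_def by simp
  have SL: "col_prod l d j = col_prod l M j * (\<Prod>i=1..l d. T (l j - i))"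
    unfolding d_def T_def l_def using col_prod_Suc[OF yL] assms(2) step by simp
  have SK: "col_prod c d j = col_prod c M j * (\<Prod>i=1..c d. T (c j - i))"
    unfolding d_def T_def c_def using col_prod_Suc[OF yK] assms(2) step by simp
  note IH = step.IH[folded l_def c_def]
  show ?case
  proof (cases "l d = c d")
    case True
    have "{d' \<in> {j<..d}. l d' = c d' + 1} = {d' \<in> {j<..M}. l d' = c d' + 1}"
      using True jd unfolding d_def by (auto simp: le_Suc_eq)
    then have "col_prod c d j = col_prod l d j * (\<Prod>d' | d' \<in> {j<..d} \<and> l d' = c d' + 1. pair_weight kk (w d' - w j))"
      unfolding SL SK IH True lj by (simp add: mult_ac)
    then show ?thesis unfolding d_def l_def c_def .
  next
    case False
    then have ld1: "l d = Suc (c d)" using lc[of d] jd by simp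
    have "{d' \<in> {j<..d}. l d' = c d' + 1} = insert d {d' \<in> {j<..M}. l d' = c d' + 1}"
      using ld1 jd unfolding d_def by auto
    then have pr: "(\<Prod>d' | d' \<in> {j<..d} \<and> l d' = c d' + 1. pair_weight kk (w d' - w j))
      = pair_weight kk (w d - w j) * (\<Prod>d' | d' \<in> {j<..M} \<and> l d' = c d' + 1. pair_weight kk (w d' - w j))"
      by (simp add: d_def)
    have "of_nat (M - j + 1) + kk * of_nat (c j - Suc (c d)) = - (w d - w j) - kk"
      using ld[unfolded ld1 lj] step(1) unfolding w_def col_var_def c_def[symmetric] d_def
      by (simp add: of_nat_diff algebra_simps)
    then have h: "pair_weight kk (w d - w j) = inverse (T (c j - Suc (c d)))"
      unfolding T_def arm_step_def using pair_weight_reflect[of kk "w d - w j"] by simp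
    have "col_prod c d j = col_prod l d j * (pair_weight kk (w d - w j) * (\<Prod>d' | d' \<in> {j<..M} \<and> l d' = c d' + 1. pair_weight kk (w d' - w j)))"
      unfolding SL SK IH ld1 lj h using arm_step_nonzero[of "M - j" "c j - Suc (c d)"] unfolding T_def
      by (simp add: mult_ac)
    then show ?thesis unfolding pr[symmetric] unfolding d_def l_def c_def .
  qed
qed

section \<open>Phi and psi as products over pairs of columns\<close>

lemma meets_col_hstrip:
  assumes h: "hstrip L K" and s: "1 \<le> j"
  shows "meets_col (L - K) (i, j) \<longleftrightarrow> col_len L j = col_len K j + 1"
proof -
  note y = hstrip_young[OF h]
  have le: "col_len K j \<le> col_len L j" "col_len L j \<le> col_len K j + 1" using h s unfolding hstrip_def by auto
  have "meets_col (L - K) (i, j) \<longleftrightarrow> (\<exists>i. 1 \<le> i \<and> i \<le> col_len L j \<and> \<not> i \<le> col_len K j)"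
    unfolding meets_col_def using young_mem_col[OF y(1)] young_mem_col[OF y(2)] s by auto
  also have "\<dots> \<longleftrightarrow> col_len L j = col_len K j + 1"
    using le by (metis Suc_eq_plus1 le_Suc_eq le_add2 le_refl not_less_eq_eq)
  finally show ?thesis .
qed

lemma hstrip_diff:
  assumes h: "hstrip L K" and M: "cols_in M L"
  shows "L - K = (\<lambda>j. (col_len K j + 1, j)) ` {j \<in> {1..M}. col_len L j = col_len K j + 1}"
proof (intro set_eqI iffI)
  note y = hstrip_young[OF h]
  fix s assume "s \<in> L - K"
  then obtain i j where s: "s = (i, j)" "(i, j) \<in> L" "(i, j) \<notin> K" by (cases s) auto
  have ij: "1 \<le> i" "1 \<le> j" "i \<le> col_len L j" "\<not> i \<le> col_len K j"
    using s young_mem_col[OF y(1)] young_mem_col[OF y(2)] by auto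
  moreover have "j \<le> M" using s M unfolding cols_in_def by blast
  moreover have "i = col_len K j + 1" "col_len L j = col_len K j + 1" using ij hstrip_col_le[OF h ij(2)] by auto
  ultimately show "s \<in> (\<lambda>j. (col_len K j + 1, j)) ` {j \<in> {1..M}. col_len L j = col_len K j + 1}"
    unfolding s by auto
next
  note y = hstrip_young[OF h]
  fix s assume "s \<in> (\<lambda>j. (col_len K j + 1, j)) ` {j \<in> {1..M}. col_len L j = col_len K j + 1}"
  then show "s \<in> L - K" using young_mem_col[OF y(1)] young_mem_col[OF y(2)] by auto
qed

lemma prod_diagram_columns:
  assumes y: "young_diagram L" and M: "cols_in M L"
  shows "(\<Prod>s | s \<in> L \<and> Q (snd s). g s) = (\<Prod>j | j \<in> {1..M} \<and> Q j. \<Prod>i=1..col_len L j. g (i, j))"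
proof -
  have "(\<Prod>s | s \<in> L \<and> Q (snd s). g s) = (\<Prod>(j, i)\<in>(SIGMA j:{j \<in> {1..M}. Q j}. {1..col_len L j}). g (i, j))"
    by (rule prod.reindex_bij_witness[of _ "\<lambda>(j, i). (i, j)" "\<lambda>(i, j). (j, i)"])
      (use M young_mem_col[OF y] in \<open>auto simp: cols_in_def\<close>)
  also have "\<dots> = (\<Prod>j | j \<in> {1..M} \<and> Q j. \<Prod>i=1..col_len L j. g (i, j))"
    by (subst prod.Sigma) auto
  finally show ?thesis .
qed

text \<open>The last factor collects the pairs with the empty columns beyond \<open>M\<close>; that product telescopes.\<close>

lemma jack_phi_eq:
  assumes h: "hstrip L K" and M: "cols_in M L"
  defines "w \<equiv> col_var (col_len K)"
  shows "jack_phi L K = (\<Prod>j | j \<in> {1..M} \<and> col_len L j = col_len K j + 1.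
    (\<Prod>d | d \<in> {j<..M} \<and> col_len L d = col_len K d. pair_weight kk (w j - w d)) *
      ((w j + of_nat M + kk) / (w j + of_nat M + 1)))"
proof -
  note y = hstrip_young[OF h]
  have MK: "cols_in M K" using M hstrip_subset[OF h] unfolding cols_in_def by blast
  define P where "P = {j \<in> {1..M}. col_len L j = col_len K j + 1}"
  define B where "B = (\<lambda>s. bfac L s / bfac K s)"
  have "{s \<in> L. meets_col (L - K) s} = {s \<in> L. col_len L (snd s) = col_len K (snd s) + 1}"
    using meets_col_hstrip[OF h] young_mem_col[OF y(1)] by auto
  then have "jack_phi L K = (\<Prod>j\<in>P. \<Prod>i=1..col_len L j. B (i, j))"
    unfolding jack_phi_def P_def B_def
    by (simp only: prod_diagram_columns[OF y(1) M, where Q = "\<lambda>j. col_len L j = col_len K j + 1"])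
  also have "\<dots> = (\<Prod>j\<in>P. (\<Prod>d | d \<in> {j<..M} \<and> col_len L d = col_len K d. pair_weight kk (w j - w d)) *
      ((w j + of_nat M + kk) / (w j + of_nat M + 1)))"
  proof (rule prod.cong)
    fix j assume "j \<in> P"
    then have j: "1 \<le> j" "j \<le> M" "col_len L j = col_len K j + 1" unfolding P_def by auto
    \<comment> \<open>The added box lies outside \<open>K\<close>, where \<open>bfac K\<close> is 1
      by convention.\<close>
    have "(\<Prod>i=1..col_len L j. bfac K (i, j)) = (\<Prod>i=1..col_len K j. bfac K (i, j))"
    proof (rule prod.mono_neutral_right)
      show "\<forall>i\<in>{1..col_len L j} - {1..col_len K j}. bfac K (i, j) = 1"
        unfolding bfac_def using young_mem_col[OF y(2)] by auto
    qed (use j in auto)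
    then have "(\<Prod>i=1..col_len L j. B (i, j)) = (\<Prod>i=1..col_len L j. bfac L (i, j)) / (\<Prod>i=1..col_len K j. bfac K (i, j))"
      unfolding B_def by (simp add: prod_dividef)
    also have "\<dots> = col_prod (col_len L) M j / col_prod (col_len K) M j"
      by (simp only: prod_bfac_column[OF y(1) M j(1)] prod_bfac_column[OF y(2) MK j(1)])
    finally show "(\<Prod>i=1..col_len L j. B (i, j)) = (\<Prod>d | d \<in> {j<..M} \<and> col_len L d = col_len K d. pair_weight kk (w j - w d)) *
      ((w j + of_nat M + kk) / (w j + of_nat M + 1))"
      unfolding w_def using col_prod_phi[OF h j] col_prod_pos[of "col_len K" M j] by simp
  qed simp
  finally show ?thesis unfolding P_def .
qed

text \<open>A box whose row and column both miss the strip has the same arm and leg in both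
  diagrams. The row condition in psi can therefore be dropped, which leaves a condition on columns
  alone.\<close>

lemma jack_psi_eq:
  assumes h: "hstrip L K" and M: "cols_in M L"
  defines "w \<equiv> col_var (col_len K)"
  shows "jack_psi L K = (\<Prod>j | j \<in> {1..M} \<and> col_len L j = col_len K j.
    \<Prod>d | d \<in> {j<..M} \<and> col_len L d = col_len K d + 1. pair_weight kk (w d - w j))"
proof -
  note y = hstrip_young[OF h]
  have MK: "cols_in M K" using M hstrip_subset[OF h] unfolding cols_in_def by blast
  define Q where "Q = {j \<in> {1..M}. col_len L j = col_len K j}"
  define B where "B = (\<lambda>s. bfac K s / bfac L s)"
  note le = hstrip_col_le[OF h]
  have fL: "finite L" using young_finite y by blast
  have one: "bfac K s / bfac L s = 1" if s: "s \<in> L" "\<not> meets_col (L - K) s" "\<not> meets_row (L - K) s" for s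
  proof -
    obtain i j where ij: "s = (i, j)" by (cases s)
    have j: "1 \<le> j" using s ij young_mem_col[OF y(1)] by auto
    have c: "col_len L j = col_len K j" using meets_col_hstrip[OF h j] s le[OF j] ij by auto
    have "{j. (i, j) \<in> L} = {j. (i, j) \<in> K}"
      using s(3) hstrip_subset[OF h] unfolding meets_row_def ij by auto
    then have r: "row_len L i = row_len K i" unfolding row_len_def by simp
    have "(i, j) \<in> K" using s(1) c unfolding ij young_mem_col[OF y(1)] young_mem_col[OF y(2)] by simp
    then have "bfac K s = bfac L s" using s(1) unfolding ij bfac_def arm_def leg_def by (simp add: c r)
    then show ?thesis using bfac_pos[of L s] by simp
  qed
  have "jack_psi L K = (\<Prod>s | s \<in> L \<and> \<not> meets_col (L - K) s. bfac K s / bfac L s)"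
    unfolding jack_psi_def
    by (rule prod.mono_neutral_left) (use fL one in auto)
  also have "{s \<in> L. \<not> meets_col (L - K) s} = {s \<in> L. col_len L (snd s) = col_len K (snd s)}"
    using meets_col_hstrip[OF h] young_mem_col[OF y(1)] le by fastforce
  also have "(\<Prod>s | s \<in> L \<and> col_len L (snd s) = col_len K (snd s). bfac K s / bfac L s)
      = (\<Prod>j\<in>Q. \<Prod>i=1..col_len L j. B (i, j))"
    unfolding Q_def B_def by (rule prod_diagram_columns[OF y(1) M, where Q = "\<lambda>j. col_len L j = col_len K j"])
  also have "\<dots> = (\<Prod>j\<in>Q. \<Prod>d | d \<in> {j<..M} \<and> col_len L d = col_len K d + 1. pair_weight kk (w d - w j))"
  proof (rule prod.cong)
    fix j assume "j \<in> Q"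
    then have j: "1 \<le> j" "j \<le> M" "col_len L j = col_len K j" unfolding Q_def by auto
    have "(\<Prod>i=1..col_len L j. B (i, j)) = (\<Prod>i=1..col_len K j. bfac K (i, j)) / (\<Prod>i=1..col_len L j. bfac L (i, j))"
      unfolding B_def by (simp add: prod_dividef j(3))
    also have "\<dots> = col_prod (col_len K) M j / col_prod (col_len L) M j"
      by (simp only: prod_bfac_column[OF y(1) M j(1)] prod_bfac_column[OF y(2) MK j(1)])
    finally show "(\<Prod>i=1..col_len L j. B (i, j)) = (\<Prod>d | d \<in> {j<..M} \<and> col_len L d = col_len K d + 1. pair_weight kk (w d - w j))"
      unfolding w_def using col_prod_psi[OF h j] col_prod_pos[of "col_len L" M j] by simp
  qed simp
  finally show ?thesis unfolding Q_def .
qed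

section \<open>The weight W column by column\<close>

definition W_at :: "Qk fls \<Rightarrow> diagram \<Rightarrow> diagram \<Rightarrow> Qk fls" where
  "W_at U lam kap = fls_const (jack_phi lam kap) *
     (\<Prod>i=1..num_rows lam. \<Prod>j=1..row_len kap i - row_len lam (i + 1).
        U - of_nat (row_len kap i - j + 1) + of_nat i * fls_const kk) /
     (\<Prod>l=1..row_len lam 1. U - of_nat l)"

text \<open>The argument of W is made free because the skew identity also involves W at u +
  k.\<close>

lemma W_weight_eq_W_at: "W_weight lam kap = W_at uu lam kap"
  unfolding W_weight_def W_at_def ..

lemma num_rows_eq_col_len:
  assumes "young_diagram D"
  shows "num_rows D = col_len D 1"
proof -
  have "{i. row_len D i \<noteq> 0} = {i. (i, 1) \<in> D}"
  proof (intro set_eqI iffI)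
    fix i assume "i \<in> {i. row_len D i \<noteq> 0}"
    then obtain j where j: "(i, j) \<in> D" unfolding row_len_def
      by (metis (mono_tags, lifting) card.empty empty_Collect_eq mem_Collect_eq)
    then have "1 \<le> i" "1 \<le> j" using young_mem_col[OF assms] by auto
    then show "i \<in> {i. (i, 1) \<in> D}" using young_closed[OF assms j] by auto
  next
    fix i assume "i \<in> {i. (i, 1) \<in> D}"
    then show "i \<in> {i. row_len D i \<noteq> 0}" using young_mem_row[OF assms] by auto
  qed
  then show ?thesis unfolding num_rows_def col_len_def by simp
qed

text \<open>For fixed \<open>i\<close> the number \<open>row_len K i - j + 1\<close> runs through
  the columns beyond \<open>row_len L (i + 1)\<close> and up to \<open>row_len K i\<close>. These
  have length \<open>i\<close> in both diagrams, so all \<open>i\<close> together give the nonempty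
  columns that the strip misses.\<close>

lemma prod_row_gaps_eq_prod_columns:
  fixes g :: "nat \<Rightarrow> nat \<Rightarrow> 'a::comm_monoid_mult"
  assumes h: "hstrip L K"
  shows "(\<Prod>i=1..num_rows L. \<Prod>j=1..row_len K i - row_len L (i + 1). g (row_len K i - j + 1) i)
    = (\<Prod>c | c \<in> {1..row_len L 1} \<and> col_len L c = col_len K c. g c (col_len K c))"
proof -
  note y = hstrip_young[OF h]
  note le = hstrip_col_le[OF h]
  note memL = young_mem_col[OF y(1)] young_mem_row[OF y(1)]
  note memK = young_mem_col[OF y(2)] young_mem_row[OF y(2)]
  have Liff: "j \<le> row_len L i \<longleftrightarrow> i \<le> col_len L j" "j \<le> row_len K i \<longleftrightarrow> i \<le> col_len K j"
    if "1 \<le> i" "1 \<le> j" for i j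
    using memL[of i j] memK[of i j] that by blast+
  have "(\<Prod>i=1..num_rows L. \<Prod>j=1..row_len K i - row_len L (i + 1). g (row_len K i - j + 1) i)
     = (\<Prod>(i, j)\<in>(SIGMA i:{1..num_rows L}. {1..row_len K i - row_len L (i + 1)}). g (row_len K i - j + 1) i)"
    by (subst prod.Sigma) auto
  also have "\<dots> = (\<Prod>c | c \<in> {1..row_len L 1} \<and> col_len L c = col_len K c. g c (col_len K c))"
  proof (rule prod.reindex_bij_witness[of _ "\<lambda>c. (col_len K c, row_len K (col_len K c) - c + 1)" "\<lambda>(i, j). row_len K i - j + 1"])
    fix a assume "a \<in> (SIGMA i:{1..num_rows L}. {1..row_len K i - row_len L (i + 1)})"
    then obtain i j where a: "a = (i, j)" and i: "1 \<le> i" and j: "1 \<le> j" "j \<le> row_len K i - row_len L (i + 1)" by auto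
    define c where "c = row_len K i - j + 1"
    have c: "c \<le> row_len K i" "row_len L (i + 1) < c" "1 \<le> c" "j = row_len K i - c + 1" using j unfolding c_def by auto
    have 1: "i \<le> col_len K c" using Liff(2)[OF i c(3)] c(1) by simp
    have 2: "\<not> i + 1 \<le> col_len L c" using Liff(1)[of "i + 1" c] c by simp
    have eq: "col_len K c = i" "col_len L c = i" using 1 2 le[OF c(3)] by auto
    have "1 \<le> col_len L c" using eq i by simp
    then have "c \<le> row_len L 1" using Liff(1)[of 1 c] c(3) by simp
    then show "(case a of (i, j) \<Rightarrow> row_len K i - j + 1) \<in> {c \<in> {1..row_len L 1}. col_len L c = col_len K c}"
      "(col_len K (case a of (i, j) \<Rightarrow> row_len K i - j + 1), row_len K (col_len K (case a of (i, j) \<Rightarrow> row_len K i - j + 1)) - (case a of (i, j) \<Rightarrow> row_len K i - j + 1) + 1) = a"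
      "g (case a of (i, j) \<Rightarrow> row_len K i - j + 1) (col_len K (case a of (i, j) \<Rightarrow> row_len K i - j + 1)) = (case a of (i, j) \<Rightarrow> g (row_len K i - j + 1) i)"
      unfolding a prod.case c_def[symmetric] using eq c by auto
  next
    fix c assume "c \<in> {c \<in> {1..row_len L 1}. col_len L c = col_len K c}"
    then have c: "1 \<le> c" "c \<le> row_len L 1" "col_len L c = col_len K c" by auto
    define i where "i = col_len K c"
    have i1: "1 \<le> i" using Liff(1)[of 1 c] c unfolding i_def by simp
    have cK: "c \<le> row_len K i" using Liff(2)[OF i1 c(1)] unfolding i_def by simp
    have cL: "\<not> c \<le> row_len L (i + 1)" using Liff(1)[of "i + 1" c] c unfolding i_def by simp
    have iL: "i \<le> num_rows L" unfolding num_rows_eq_col_len[OF y(1)] i_def c(3)[symmetric]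
      by (rule col_len_antimono[OF y(1)]) (use c in auto)
    show "(case (col_len K c, row_len K (col_len K c) - c + 1) of (i, j) \<Rightarrow> row_len K i - j + 1) = c"
      using cK c unfolding i_def[symmetric] by simp
    show "(col_len K c, row_len K (col_len K c) - c + 1) \<in> (SIGMA i:{1..num_rows L}. {1..row_len K i - row_len L (i + 1)})"
      using i1 iL cK cL unfolding i_def[symmetric] by auto
  qed
  finally show ?thesis .
qed

text \<open>An empty column \<open>c\<close> has \<open>col_var\<close> equal to \<open>- c\<close>,
  so extending the range from the length of the first row to \<open>M\<close> multiplies numerator
  and denominator by the same factors.\<close>

lemma W_at_eq:
  assumes h: "hstrip L K" and M: "cols_in M L" and U: "\<And>l. 1 \<le> l \<Longrightarrow> l \<le> M \<Longrightarrow> U \<noteq> of_nat l"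
  shows "W_at U L K = fls_const (jack_phi L K) *
    (\<Prod>c | c \<in> {1..M} \<and> col_len L c = col_len K c. U + fls_const (col_var (col_len K) c)) / (\<Prod>l=1..M. U - of_nat l)"
proof -
  note y = hstrip_young[OF h]
  define m where "m = row_len L 1"
  have mM: "m \<le> M"
  proof (cases "m = 0")
    case False
    then have "(1, m) \<in> L" using young_mem_row[OF y(1)] unfolding m_def by auto
    then show ?thesis using M unfolding cols_in_def by blast
  qed simp
  have zero: "col_len L c = 0" "col_len K c = 0" if "c > m" for c
  proof -
    have "(1, c) \<notin> L" using that young_mem_row[OF y(1), of 1 c] unfolding m_def by auto
    then show "col_len L c = 0" using young_mem_col[OF y(1), of 1 c] that by (cases "col_len L c") auto
    then show "col_len K c = 0" using hstrip_col_le[OF h, of c] that by simp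
  qed
  define A where "A = {c \<in> {1..m}. col_len L c = col_len K c}"
  have split: "{c \<in> {1..M}. col_len L c = col_len K c} = A \<union> {m<..M}" "A \<inter> {m<..M} = {}" "finite A"
    using zero mM unfolding A_def by auto
  have cv: "fls_const (col_var (col_len K) c) = - of_nat c + of_nat (col_len K c) * fls_const kk" for c
    unfolding col_var_def by (simp add: fls_minus_const[symmetric] fls_of_nat fls_const_mult_const[symmetric] mult.commute del: fls_const_mult_const)
  have P1: "(\<Prod>i=1..num_rows L. \<Prod>j=1..row_len K i - row_len L (i + 1).
        U - of_nat (row_len K i - j + 1) + of_nat i * fls_const kk) = (\<Prod>c\<in>A. U + fls_const (col_var (col_len K) c))"
    using prod_row_gaps_eq_prod_columns[OF h, of "\<lambda>c i. U - of_nat c + of_nat i * fls_const kk"]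
    unfolding cv m_def[symmetric] A_def by (simp add: algebra_simps)
  have P2: "(\<Prod>c | c \<in> {1..M} \<and> col_len L c = col_len K c. U + fls_const (col_var (col_len K) c))
    = (\<Prod>c\<in>A. U + fls_const (col_var (col_len K) c)) * (\<Prod>c\<in>{m<..M}. U - of_nat c)"
    unfolding split(1) using split(2,3) by (subst prod.union_disjoint) (auto simp: cv zero)
  have "{1..M} = {1..m} \<union> {m<..M}" using mM by auto
  then have P3: "(\<Prod>l=1..M. U - of_nat l) = (\<Prod>l=1..m. U - of_nat l) * (\<Prod>l\<in>{m<..M}. U - of_nat l)"
    by (simp add: prod.union_disjoint ivl_disj_int)
  have "(\<Prod>l\<in>{m<..M}. U - of_nat l) \<noteq> 0" using U by auto
  then show ?thesis unfolding W_at_def P1 P2 P3 m_def[symmetric] by (simp add: mult.assoc[symmetric])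
qed

section \<open>The skew identity at positive integers\<close>

definition A_poly :: "diagram \<Rightarrow> diagram \<Rightarrow> Qk poly" where
  "A_poly lam rho = smult (jack_psi lam rho)
     (\<Prod>(i, j)\<in>lam - rho. [:of_nat (i - 1) * kk - of_nat (j - 1), 1:])"

text \<open>The box added in column \<open>j\<close> lies in row \<open>col_len G j + 1\<close>,
  hence its factor is \<open>y\<close> plus \<open>kk * col_len G j - (j - 1)\<close>.\<close>

lemma poly_A_poly:
  assumes h: "hstrip L G" and M: "cols_in M L"
  shows "poly (A_poly L G) y = jack_psi L G *
    (\<Prod>j | j \<in> {1..M} \<and> col_len L j = col_len G j + 1. y + 1 + col_var (col_len G) j)"
proof -
  have "(\<Prod>(i, j)\<in>L - G. y + (of_nat (i - 1) * kk - of_nat (j - 1))) =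
    (\<Prod>j | j \<in> {1..M} \<and> col_len L j = col_len G j + 1. y + 1 + col_var (col_len G) j)"
    unfolding hstrip_diff[OF h M]
    by (subst prod.reindex) (auto simp: inj_on_def col_var_def of_nat_diff algebra_simps intro!: prod.cong)
  then show ?thesis unfolding A_poly_def by (simp add: poly_prod case_prod_unfold add.commute)
qed

lemma fls_const_prod: "fls_const (\<Prod>a\<in>A. f a) = (\<Prod>a\<in>A. fls_const (f a :: 'a::comm_ring_1))"
  by (induction A rule: infinite_finite_induct) (auto simp del: fls_const_mult_const simp add: fls_const_mult_const[symmetric])

lemma pair_weight_fls_const: "pair_weight (fls_const k) (fls_const y) = fls_const (pair_weight (k :: Qk) y)"
  unfolding pair_weight_def
  by (simp add: fls_const_divide_const fls_plus_const fls_minus_const flip: fls_const_1)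

text \<open>The index set \<open>B\<close> may be too large, provided that inadmissible indices
  carry the value 0. These will be the subsets of columns that do not yield a partition.\<close>

lemma sum_reindex_zero:
  assumes "finite B" "inj_on \<phi> B" "A \<subseteq> \<phi> ` B" "\<And>b. b \<in> B \<Longrightarrow> \<phi> b \<notin> A \<Longrightarrow> g b = 0"
    "\<And>b. b \<in> B \<Longrightarrow> \<phi> b \<in> A \<Longrightarrow> T (\<phi> b) = g b"
  shows "(\<Sum>a\<in>A. T a) = (\<Sum>b\<in>B. g b)"
proof -
  have "(\<Sum>b\<in>B. g b) = (\<Sum>b\<in>{b \<in> B. \<phi> b \<in> A}. g b)"
    by (rule sum.mono_neutral_right) (use assms in auto)
  also have "\<dots> = (\<Sum>b\<in>{b \<in> B. \<phi> b \<in> A}. T (\<phi> b))"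
    using assms(5) by (intro sum.cong) auto
  also have "\<dots> = (\<Sum>a\<in>\<phi> ` {b \<in> B. \<phi> b \<in> A}. T a)"
    by (rule sum.reindex[symmetric, unfolded o_def]) (use assms(2) in \<open>auto simp: inj_on_def\<close>)
  also have "\<phi> ` {b \<in> B. \<phi> b \<in> A} = A" using assms(3) by auto
  finally show ?thesis by simp
qed

section \<open>Products over pairs of columns\<close>

definition pairs_prod :: "nat \<Rightarrow> (nat \<Rightarrow> nat \<Rightarrow> Qk) \<Rightarrow> Qk" where
  "pairs_prod M f = (\<Prod>i=1..M. \<Prod>d\<in>{i<..M}. f i d)"

lemma pairs_prod_mult:
  "pairs_prod M f * pairs_prod M g = pairs_prod M (\<lambda>i d. f i d * g i d)"
  unfolding pairs_prod_def by (simp add: prod.distrib)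

lemma pairs_prod_cong:
  "(\<And>i d. 1 \<le> i \<Longrightarrow> i < d \<Longrightarrow> d \<le> M \<Longrightarrow> f i d = g i d) \<Longrightarrow> pairs_prod M f = pairs_prod M g"
  unfolding pairs_prod_def by (auto intro!: prod.cong)

lemma pairs_prod_filter:
  "(\<Prod>i | i \<in> {1..M} \<and> P i. \<Prod>d | d \<in> {i<..M} \<and> Q d. f i d)
    = pairs_prod M (\<lambda>i d. if P i \<and> Q d then f i d else 1)"
proof -
  have "(\<Prod>i | i \<in> {1..M} \<and> P i. \<Prod>d | d \<in> {i<..M} \<and> Q d. f i d)
    = (\<Prod>i | i \<in> {1..M} \<and> P i. \<Prod>d\<in>{i<..M}. if Q d then f i d else 1)"
    by (intro prod.cong refl prod.inter_filter) auto
  also have "\<dots> = (\<Prod>i=1..M. if P i then \<Prod>d\<in>{i<..M}. if Q d then f i d else 1 else 1)"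
    by (rule prod.inter_filter) auto
  also have "\<dots> = pairs_prod M (\<lambda>i d. if P i \<and> Q d then f i d else 1)"
    unfolding pairs_prod_def by (intro prod.cong refl) auto
  finally show ?thesis .
qed

text \<open>An element of \<open>R \<times> (S - R)\<close> is an unordered pair of columns with one
  member in \<open>R\<close>; the two branches distinguish whether this member is on the left or on
  the right.\<close>

lemma pairs_prod_subset:
  assumes S: "S \<subseteq> {1..M}" and R: "R \<subseteq> S"
  shows "pairs_prod M (\<lambda>i d. if i \<in> R \<and> d \<in> S - R then f i d else if d \<in> R \<and> i \<in> S - R then f d i else 1)
    = (\<Prod>i\<in>R. \<Prod>d\<in>S-R. f i d)"
proof -
  have fin: "finite S" "finite R" "finite (S - R)" using S R by (auto intro: finite_subset)
  define A where "A = {(i, d). i \<in> R \<and> d \<in> S - R \<and> i < d}"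
  define B where "B = {(i, d). i \<in> R \<and> d \<in> S - R \<and> d < i}"
  define T where "T = (SIGMA i:{1..M}. {i<..M})"
  have fT: "finite T" unfolding T_def by auto
  have AB: "R \<times> (S - R) = A \<union> B" "A \<inter> B = {}" unfolding A_def B_def by (auto, metis linorder_neqE_nat)
  have fAB: "finite A" "finite B" using fin AB(1) by (metis finite_SigmaI finite_Un)+
  have AT: "A \<subseteq> T" unfolding A_def T_def using S R by auto
  have BT: "prod.swap ` B \<subseteq> T" unfolding B_def T_def using S R by auto
  have split: "(if i \<in> R \<and> d \<in> S - R then f i d else if d \<in> R \<and> i \<in> S - R then f d i else 1)
     = (if i \<in> R \<and> d \<in> S - R then f i d else 1) * (if d \<in> R \<and> i \<in> S - R then f d i else 1)" for i d
    by auto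
  have "(\<Prod>(i, d)\<in>T. if i \<in> R \<and> d \<in> S - R then f i d else 1) = (\<Prod>(i, d)\<in>A. f i d)"
    by (rule prod.mono_neutral_cong_right[OF fT AT]) (auto simp: A_def T_def split: if_splits)
  moreover have "(\<Prod>(i, d)\<in>T. if d \<in> R \<and> i \<in> S - R then f d i else 1) = (\<Prod>(i, d)\<in>prod.swap ` B. f d i)"
    by (rule prod.mono_neutral_cong_right[OF fT BT]) (auto simp: B_def T_def image_iff split: if_splits)
  moreover have "(\<Prod>(i, d)\<in>prod.swap ` B. f d i) = (\<Prod>(i, d)\<in>B. f i d)"
    by (subst prod.reindex) (auto simp: case_prod_unfold intro: prod.cong)
  ultimately have "(\<Prod>(i, d)\<in>T. if i \<in> R \<and> d \<in> S - R then f i d else if d \<in> R \<and> i \<in> S - R then f d i else 1)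
     = (\<Prod>(i, d)\<in>R \<times> (S - R). f i d)"
    unfolding split AB(1) using prod.union_disjoint[OF fAB AB(2), of "\<lambda>x. f (fst x) (snd x)"] by (simp add: case_prod_unfold prod.distrib)
  then show ?thesis
    unfolding pairs_prod_def T_def using fin by (subst prod.Sigma) (auto simp: prod.cartesian_product)
qed

text \<open>With \<open>I\<close> the set of columns met by the strip, every weight becomes one
  factor for each pair of columns and one for each column, filled up with 1. Products of weights of
  different strips can then be compared factor by factor.\<close>

lemma strip_set_formulas:
  assumes h: "hstrip L K" and M: "cols_in M L"
    and I: "\<forall>j\<in>{1..M}. col_len L j = col_len K j + of_bool (j \<in> I)"
  defines "w \<equiv> col_var (col_len K)"
  shows "jack_phi L K = pairs_prod M (\<lambda>i d. if i \<in> I \<and> d \<notin> I then pair_weight kk (w i - w d) else 1)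
      * (\<Prod>j=1..M. if j \<in> I then (w j + of_nat M + kk) / (w j + of_nat M + 1) else 1)"
    and "jack_psi L K = pairs_prod M (\<lambda>i d. if i \<notin> I \<and> d \<in> I then pair_weight kk (w d - w i) else 1)"
    and "poly (A_poly L K) y = jack_psi L K * (\<Prod>j=1..M. if j \<in> I then y + 1 + w j else 1)"
    and "\<forall>l\<in>{1..M}. U \<noteq> of_nat l \<Longrightarrow> W_at U L K = fls_const (jack_phi L K) *
      (\<Prod>j=1..M. if j \<notin> I then U + fls_const (w j) else 1) / (\<Prod>l=1..M. U - of_nat l)"
proof -
  have 1: "j \<in> {1..M} \<and> col_len L j = col_len K j + 1 \<longleftrightarrow> j \<in> {1..M} \<and> j \<in> I"
    "j \<in> {1..M} \<and> col_len L j = col_len K j \<longleftrightarrow> j \<in> {1..M} \<and> j \<notin> I" for j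
    using I by (auto simp: of_bool_def split: if_splits)
  have 2: "d \<in> {j<..M} \<and> col_len L d = col_len K d \<longleftrightarrow> d \<in> {j<..M} \<and> d \<notin> I"
    "d \<in> {j<..M} \<and> col_len L d = col_len K d + 1 \<longleftrightarrow> d \<in> {j<..M} \<and> d \<in> I" for j d
    using 1[of d] by auto
  show "jack_phi L K = pairs_prod M (\<lambda>i d. if i \<in> I \<and> d \<notin> I then pair_weight kk (w i - w d) else 1)
      * (\<Prod>j=1..M. if j \<in> I then (w j + of_nat M + kk) / (w j + of_nat M + 1) else 1)"
    unfolding jack_phi_eq[OF h M] 1 2 prod.distrib w_def
      pairs_prod_filter[where P = "\<lambda>i. i \<in> I" and Q = "\<lambda>d. d \<notin> I"]
    by (subst prod.inter_filter) auto
  show "jack_psi L K = pairs_prod M (\<lambda>i d. if i \<notin> I \<and> d \<in> I then pair_weight kk (w d - w i) else 1)"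
    unfolding jack_psi_eq[OF h M] 1 2 w_def
      pairs_prod_filter[where P = "\<lambda>i. i \<notin> I" and Q = "\<lambda>d. d \<in> I"] ..
  show "poly (A_poly L K) y = jack_psi L K * (\<Prod>j=1..M. if j \<in> I then y + 1 + w j else 1)"
    unfolding poly_A_poly[OF h M] 1 w_def by (subst prod.inter_filter) auto
  show "W_at U L K = fls_const (jack_phi L K) *
      (\<Prod>j=1..M. if j \<notin> I then U + fls_const (w j) else 1) / (\<Prod>l=1..M. U - of_nat l)"
    if "\<forall>l\<in>{1..M}. U \<noteq> of_nat l"
    by (subst W_at_eq[OF h M], use that in force, unfold 1 w_def, subst prod.inter_filter) auto
qed

text \<open>Forms of the reflection that occur when column variables are shifted by
  \<open>kk\<close> in either direction, oriented as rewrite rules.\<close>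

lemma pair_weight_kk_shift:
  "pair_weight kk (a - kk - b) = pair_weight kk (b - a)"
  "pair_weight kk (a - (b + kk)) = pair_weight kk (b - a)"
  "pair_weight kk (a - (b - kk)) = pair_weight kk (a + kk - b)"
  "pair_weight kk (a - b - 2 * kk) = pair_weight kk (b + kk - a)"
proof -
  show "pair_weight kk (a - kk - b) = pair_weight kk (b - a)"
    using pair_weight_reflect[of kk "b - a"] by (simp add: algebra_simps)
  then show "pair_weight kk (a - (b + kk)) = pair_weight kk (b - a)"
    by (simp add: algebra_simps)
  show "pair_weight kk (a - b - 2 * kk) = pair_weight kk (b + kk - a)"
    using pair_weight_reflect[of kk "b + kk - a"] by (simp add: algebra_simps)
qed (simp add: algebra_simps)

text \<open>Columns \<open>j\<close> and \<open>j + 1\<close> of equal length have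
  \<open>w (j + 1) - w j = - 1\<close>. This zero removes the subsets that would add a box to column
  \<open>j + 1\<close> but not to column \<open>j\<close>.\<close>

lemma pair_weight_minus_one: "pair_weight k (- 1) = 0"
  unfolding pair_weight_def by simp

text \<open>
  \<open>K\<close> and \<open>G\<close> play the roles of \<open>\<kappa>\<close> and \<open>\<rho>\<close>.  With the classes \<open>P\<close>, \<open>Q\<close>, \<open>S\<close> of columns
  below, the \<open>\<lambda>\<close> above both arise from \<open>\<kappa>\<close> by adding a box to the columns in \<open>P \<union> R\<close>, and the
  \<open>\<tau>\<close> below both by removing one from the columns in \<open>Q \<union> R\<close>, where \<open>R \<subseteq> S\<close>.  The subsets that
  do not lead to a partition contribute zero.
\<close>

locale strip_pair =
  fixes K G :: diagram and M :: nat and U :: "Qk fls"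
  assumes yK: "young_diagram K" and yG: "young_diagram G"
    and MK: "cols_in M K" and MG: "cols_in M G"
    and compat: "\<And>j. 1 \<le> j \<Longrightarrow> col_len K j \<le> col_len G j + 1 \<and> col_len G j \<le> col_len K j + 1"
    and U1: "\<forall>l\<in>{1..M}. U \<noteq> of_nat l" and U2: "\<forall>l\<in>{1..M}. U + fls_const kk \<noteq> of_nat l"
begin

abbreviation "c \<equiv> col_len K"
abbreviation "r \<equiv> col_len G"
abbreviation "w \<equiv> col_var c"
abbreviation "H \<equiv> pair_weight kk"

definition "P = {j \<in> {1..M}. r j = c j + 1}"
definition "Q = {j \<in> {1..M}. c j = r j + 1}"
definition "S = {j \<in> {1..M}. r j = c j}"

lemma classes: "{1..M} = P \<union> Q \<union> S" "P \<inter> Q = {}" "P \<inter> S = {}" "Q \<inter> S = {}"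
  "finite P" "finite Q" "finite S" "S \<subseteq> {1..M}"
proof -
  show "{1..M} = P \<union> Q \<union> S"
  proof (intro set_eqI iffI)
    fix j assume j: "j \<in> {1..M}"
    then show "j \<in> P \<union> Q \<union> S" using compat[of j] unfolding P_def Q_def S_def by (auto simp: le_Suc_eq)
  qed (auto simp: P_def Q_def S_def)
qed (auto simp: P_def Q_def S_def)

lemma class_eqs: "j \<in> P \<Longrightarrow> r j = c j + 1" "j \<in> Q \<Longrightarrow> c j = r j + 1" "j \<in> S \<Longrightarrow> r j = c j"
  unfolding P_def Q_def S_def by auto

lemma col_zero: "M < j \<Longrightarrow> c j = 0" "M < j \<Longrightarrow> r j = 0"
  using col_len_eq_0[OF yK MK] col_len_eq_0[OF yG MG] by auto

lemma wr: "col_var r j = (if j \<in> P then w j + kk else if j \<in> Q then w j - kk else w j)" if "1 \<le> j" "j \<le> M"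
  using compat[of j] that unfolding P_def Q_def col_var_def by (auto simp: algebra_simps le_Suc_eq)

text \<open>The factor of the columns \<open>i < d\<close> in phi of \<lambda>/\<kappa> times psi of
  \<lambda>/\<rho>; the first strip meets \<open>P \<union> R\<close>, the second
  \<open>Q \<union> R\<close>.\<close>

definition pair_above :: "nat set \<Rightarrow> nat \<Rightarrow> nat \<Rightarrow> Qk" where
  "pair_above R i d = (if i \<in> P \<union> R \<and> d \<notin> P \<union> R then H (w i - w d) else 1) *
     (if i \<notin> Q \<union> R \<and> d \<in> Q \<union> R then H (col_var r d - col_var r i) else 1)"

text \<open>The column variable of \<tau>, which loses one box of \<kappa> in each column of
  \<open>Q \<union> R\<close>.\<close>

definition below_var :: "nat set \<Rightarrow> nat \<Rightarrow> Qk" where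
  "below_var R j = (if j \<in> Q \<union> R then w j - kk else w j)"

text \<open>Now phi belongs to \<rho>/\<tau> and psi to \<kappa>/\<tau>, strips that again meet
  \<open>P \<union> R\<close> and \<open>Q \<union> R\<close>.\<close>

definition pair_below :: "nat set \<Rightarrow> nat \<Rightarrow> nat \<Rightarrow> Qk" where
  "pair_below R i d = (if i \<in> P \<union> R \<and> d \<notin> P \<union> R then H (below_var R i - below_var R d) else 1) *
     (if i \<notin> Q \<union> R \<and> d \<in> Q \<union> R then H (below_var R d - below_var R i) else 1)"

definition pair_fixed :: "nat \<Rightarrow> nat \<Rightarrow> Qk" where
  "pair_fixed i d = (if i \<in> S \<and> d \<in> S then 1 else pair_above {} i d)"

lemma class_cases:
  assumes "j \<in> {1..M}" "R \<subseteq> S"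
  obtains "j \<in> P" "j \<notin> Q" "j \<notin> S" "j \<notin> R" "j \<notin> S - R" | "j \<notin> P" "j \<in> Q" "j \<notin> S" "j \<notin> R" "j \<notin> S - R"
    | "j \<notin> P" "j \<notin> Q" "j \<in> S" "j \<in> R" "j \<notin> S - R" | "j \<notin> P" "j \<notin> Q" "j \<in> S" "j \<notin> R" "j \<in> S - R"
  using assms classes by blast

lemma col_balance:
  assumes "1 \<le> j" "j \<le> M" "R \<subseteq> S"
  shows "c j + of_bool (j \<in> P \<union> R) = r j + of_bool (j \<in> Q \<union> R)"
proof -
  have j: "j \<in> {1..M}" using assms by simp
  show ?thesis
  proof (cases rule: class_cases[OF j assms(3)])
    case 1
    then show ?thesis using class_eqs(1)[of j] by simp
  next
    case 2
    then show ?thesis using class_eqs(2)[of j] by simp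
  qed (use class_eqs(3)[of j] in simp_all)
qed

text \<open>On pairs inside \<open>S\<close> complementation exchanges the roles of phi and psi, and
  the shift of the lowered columns by \<open>kk\<close> is undone by reflection. The other pairs do
  not see \<open>R\<close> at all.\<close>

lemma pair_above_eq_pair_below:
  assumes R: "R \<subseteq> S" and i: "1 \<le> i" "i \<le> M" and d: "1 \<le> d" "d \<le> M"
  shows "pair_above R i d = pair_below (S - R) i d"
  using i d
  by (cases rule: class_cases[of i, OF _ R]; cases rule: class_cases[of d, OF _ R])
     (simp_all add: pair_above_def pair_below_def below_var_def wr pair_weight_kk_shift)

text \<open>For a column of \<open>S\<close> paired with one of \<open>P\<close> or
  \<open>Q\<close>, putting it into \<open>R\<close> at most moves a factor between phi and psi,
  with the same value by reflection. Thus \<open>R\<close> matters only for pairs inside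
  \<open>S\<close>.\<close>

lemma pair_above_factor:
  assumes R: "R \<subseteq> S" and i: "1 \<le> i" "i \<le> M" and d: "1 \<le> d" "d \<le> M"
  shows "pair_above R i d = pair_fixed i d * (if i \<in> R \<and> d \<in> S - R then H (w i - w d) else if d \<in> R \<and> i \<in> S - R then H (w d - w i) else 1)"
  using i d
  by (cases rule: class_cases[of i, OF _ R]; cases rule: class_cases[of d, OF _ R])
     (simp_all add: pair_above_def pair_fixed_def wr pair_weight_kk_shift)

definition "pairs_fixed = pairs_prod M pair_fixed"

lemma prod_pair_above:
  assumes R: "R \<subseteq> S"
  shows "pairs_prod M (pair_above R) = pairs_fixed * (\<Prod>i\<in>R. \<Prod>d\<in>S-R. H (w i - w d))"
  unfolding pairs_fixed_def pairs_prod_subset[OF classes(8) R, symmetric] pairs_prod_mult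
  by (rule pairs_prod_cong) (use pair_above_factor[OF R] in auto)

lemma prod_pair_below:
  assumes R: "R \<subseteq> S"
  shows "pairs_prod M (pair_below R) = pairs_fixed * (\<Prod>i\<in>S-R. \<Prod>d\<in>R. H (w i - w d))"
proof -
  have SS: "S - (S - R) = R" using R by blast
  have "pairs_prod M (pair_below R) = pairs_prod M (pair_above (S - R))"
    by (rule pairs_prod_cong) (use pair_above_eq_pair_below[of "S - R"] SS in auto)
  then show ?thesis using prod_pair_above[of "S - R"] SS by auto
qed

text \<open>What a single column contributes: the boundary factor of phi or the numerator factor of
  W, and the factor of A at \<open>y = M\<close>.\<close>

definition column_above :: "nat set \<Rightarrow> nat \<Rightarrow> Qk fls" where
  "column_above R j = (if j \<in> P \<union> R then fls_const ((w j + of_nat M + kk) / (w j + of_nat M + 1)) else U + fls_const (w j)) *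
     (if j \<in> Q \<union> R then fls_const (of_nat M + 1 + col_var r j) else 1)"

definition column_below :: "nat set \<Rightarrow> nat \<Rightarrow> Qk fls" where
  "column_below R j = (if j \<in> P \<union> R then fls_const ((below_var R j + of_nat M + kk) / (below_var R j + of_nat M + 1))
       else U + fls_const kk + fls_const (below_var R j)) *
     (if j \<in> Q \<union> R then fls_const (of_nat M + 1 + below_var R j) else 1)"

definition "columns_fixed = (\<Prod>j\<in>P. fls_const ((w j + of_nat M + kk) / (w j + of_nat M + 1))) *
  (\<Prod>j\<in>Q. (U + fls_const (w j)) * fls_const (of_nat M + 1 + w j - kk))"

lemma prod_classes:
  fixes f :: "nat \<Rightarrow> 'b::comm_monoid_mult"
  assumes "R \<subseteq> S"
  shows "(\<Prod>j=1..M. f j) = (\<Prod>j\<in>P. f j) * (\<Prod>j\<in>Q. f j) * ((\<Prod>j\<in>R. f j) * (\<Prod>j\<in>S-R. f j))"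
proof -
  have "(\<Prod>j=1..M. f j) = (\<Prod>j\<in>P. f j) * (\<Prod>j\<in>Q. f j) * (\<Prod>j\<in>S. f j)"
    unfolding classes(1) using classes by (subst prod.union_disjoint, auto)+
  also have "(\<Prod>j\<in>S. f j) = (\<Prod>j\<in>R. f j) * (\<Prod>j\<in>S-R. f j)"
    using prod.subset_diff[OF assms classes(7), of f] by (simp add: mult.commute)
  finally show ?thesis .
qed

lemma prod_classes_if:
  assumes "R \<subseteq> S"
  shows "(\<Prod>j=1..M. if j \<in> P then p j else if j \<in> Q then q j else if j \<in> R then a j else b j)
    = (\<Prod>j\<in>P. p j) * (\<Prod>j\<in>Q. q j) * ((\<Prod>j\<in>R. a j) * (\<Prod>j\<in>S-R. b j))"
  unfolding prod_classes[OF assms]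
  by (intro arg_cong2[of _ _ _ _ times] prod.cong) (use classes assms in auto)

lemma w_shift_nonzero:
  assumes "1 \<le> j" "j \<le> M"
  shows "w j + of_nat M + 1 \<noteq> 0" "w j - kk + of_nat M + 1 \<noteq> 0"
proof -
  have nz: "of_int (int M + 1 - int j) + of_int b * kk \<noteq> 0" for b
    using kk_affine_eq_0[of "int M + 1 - int j" b] assms by linarith
  from nz[of "int (c j)"] show "w j + of_nat M + 1 \<noteq> 0"
    by (simp add: col_var_def algebra_simps)
  from nz[of "int (c j) - 1"] show "w j - kk + of_nat M + 1 \<noteq> 0"
    by (simp add: col_var_def algebra_simps)
qed

lemma prod_column_above:
  assumes R: "R \<subseteq> S"
  shows "(\<Prod>j=1..M. column_above R j) = columns_fixed * ((\<Prod>j\<in>R. of_nat M + fls_const kk + fls_const (w j)) * (\<Prod>j\<in>S-R. U + fls_const (w j)))"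
  unfolding columns_fixed_def prod_classes_if[OF R, symmetric]
proof (rule prod.cong)
  fix j assume j: "j \<in> {1..M}"
  have e: "(w j + of_nat M + kk) / (w j + of_nat M + 1) * (of_nat M + 1 + w j) = of_nat M + kk + w j"
    using w_shift_nonzero(1)[of j] j by (simp add: ac_simps)
  show "column_above R j = (if j \<in> P then fls_const ((w j + of_nat M + kk) / (w j + of_nat M + 1))
    else if j \<in> Q then (U + fls_const (w j)) * fls_const (of_nat M + 1 + w j - kk)
    else if j \<in> R then of_nat M + fls_const kk + fls_const (w j) else U + fls_const (w j))"
  proof (cases rule: class_cases[OF j R])
    case 3
    then have "column_above R j = fls_const (of_nat M + kk + w j)"
      using j unfolding column_above_def e[symmetric] by (simp add: wr)
    then show ?thesis using 3 by (simp add: fls_of_nat fls_plus_const)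
  qed (use j in \<open>simp_all add: column_above_def wr add_diff_eq\<close>)
qed simp

text \<open>With the variables in \<open>R\<close> lowered by \<open>kk\<close>, cancellation leaves
  \<open>M + w j\<close>: compared with the strips above, the shift by \<open>kk\<close> has passed
  from the factors with \<open>M\<close> to those with \<open>U\<close>.\<close>

lemma prod_column_below:
  assumes R: "R \<subseteq> S"
  shows "(\<Prod>j=1..M. column_below R j) = columns_fixed * ((\<Prod>j\<in>R. of_nat M + fls_const (w j)) * (\<Prod>j\<in>S-R. U + fls_const kk + fls_const (w j)))"
  unfolding columns_fixed_def prod_classes_if[OF R, symmetric]
proof (rule prod.cong)
  fix j assume j: "j \<in> {1..M}"
  have "of_nat M + 1 + (w j - kk) = w j - kk + of_nat M + 1" by simp
  then have e: "(w j - kk + of_nat M + kk) / (w j - kk + of_nat M + 1) * (of_nat M + 1 + (w j - kk)) = of_nat M + w j"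
    using w_shift_nonzero(2)[of j] j
    by (simp only: nonzero_eq_divide_eq times_divide_eq_left mult.commute nonzero_mult_div_cancel_left atLeastAtMost_iff) simp
  show "column_below R j = (if j \<in> P then fls_const ((w j + of_nat M + kk) / (w j + of_nat M + 1))
    else if j \<in> Q then (U + fls_const (w j)) * fls_const (of_nat M + 1 + w j - kk)
    else if j \<in> R then of_nat M + fls_const (w j) else U + fls_const kk + fls_const (w j))"
  proof (cases rule: class_cases[OF j R])
    case 3
    then have "column_below R j = fls_const (of_nat M + w j)"
      unfolding column_below_def below_var_def e[symmetric] by simp
    then show ?thesis using 3 by (simp add: fls_of_nat fls_plus_const)
  qed (simp_all add: column_below_def below_var_def add_diff_eq fls_minus_const[symmetric])
qed simp

definition "strips_above = {L. hstrip L K \<and> hstrip L G \<and> cols_in M L}"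
definition "strips_below = {T. hstrip K T \<and> hstrip G T}"

lemma above_term:
  assumes L: "L \<in> strips_above" and R: "R \<subseteq> S"
    and col: "\<forall>j\<in>{1..M}. col_len L j = c j + of_bool (j \<in> P \<union> R)"
  shows "W_at U L K * fls_const (poly (A_poly L G) (of_nat M)) =
    fls_const (pairs_prod M (pair_above R)) * (\<Prod>j=1..M. column_above R j) / (\<Prod>l=1..M. U - of_nat l)"
proof -
  have h: "hstrip L K" "hstrip L G" "cols_in M L" using L unfolding strips_above_def by auto
  have col': "\<forall>j\<in>{1..M}. col_len L j = r j + of_bool (j \<in> Q \<union> R)"
    using col col_balance[OF _ _ R] by simp
  note f = strip_set_formulas[OF h(1,3) col] and f' = strip_set_formulas[OF h(2,3) col']
  define e where "e = pairs_prod M (\<lambda>i d. if i \<in> P \<union> R \<and> d \<notin> P \<union> R then H (w i - w d) else 1)"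
  have "pairs_prod M (pair_above R) = e * jack_psi L G"
    unfolding e_def f'(2) pairs_prod_mult pair_above_def[abs_def] ..
  moreover have "(\<Prod>j=1..M. column_above R j) = fls_const (\<Prod>j=1..M. if j \<in> P \<union> R then (w j + of_nat M + kk) / (w j + of_nat M + 1) else 1)
     * fls_const (\<Prod>j=1..M. if j \<in> Q \<union> R then of_nat M + 1 + col_var r j else 1) * (\<Prod>j=1..M. if j \<notin> P \<union> R then U + fls_const (w j) else 1)"
    unfolding fls_const_prod prod.distrib[symmetric] column_above_def by (intro prod.cong refl) auto
  ultimately show ?thesis unfolding f(4)[OF U1] f(1) f'(3) e_def[symmetric]
    by (simp add: fls_const_mult_const[symmetric] mult_ac del: fls_const_mult_const)
qed

lemma below_term:
  assumes T: "T \<in> strips_below" and R: "R \<subseteq> S"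
    and col: "\<forall>j\<in>{1..M}. c j = col_len T j + of_bool (j \<in> Q \<union> R)"
  shows "fls_const (poly (A_poly K T) (of_nat M)) * W_at (U + fls_const kk) G T =
    fls_const (pairs_prod M (pair_below R)) * (\<Prod>j=1..M. column_below R j) / (\<Prod>l=1..M. U + fls_const kk - of_nat l)"
proof -
  have h: "hstrip K T" "hstrip G T" using T unfolding strips_below_def by auto
  have col': "\<forall>j\<in>{1..M}. r j = col_len T j + of_bool (j \<in> P \<union> R)"
  proof
    fix j assume "j \<in> {1..M}"
    then show "r j = col_len T j + of_bool (j \<in> P \<union> R)"
      using col[rule_format, of j] col_balance[OF _ _ R, of j] by simp
  qed
  note f = strip_set_formulas[OF h(1) MK col] and f' = strip_set_formulas[OF h(2) MG col']
  define s where "s = col_var (col_len T)"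
  have s: "below_var R j = s j" if "1 \<le> j" "j \<le> M" for j
    using col that unfolding s_def below_var_def col_var_def by (auto simp: algebra_simps)
  define e where "e = pairs_prod M (\<lambda>i d. if i \<in> P \<union> R \<and> d \<notin> P \<union> R then H (s i - s d) else 1)"
  have "pairs_prod M (pair_below R) = e * jack_psi K T"
    unfolding e_def f(2) pairs_prod_mult s_def[symmetric]
    by (rule pairs_prod_cong) (use s in \<open>auto simp: pair_below_def\<close>)
  moreover have "(\<Prod>j=1..M. column_below R j) = fls_const (\<Prod>j=1..M. if j \<in> P \<union> R then (s j + of_nat M + kk) / (s j + of_nat M + 1) else 1)
     * fls_const (\<Prod>j=1..M. if j \<in> Q \<union> R then of_nat M + 1 + s j else 1) * (\<Prod>j=1..M. if j \<notin> P \<union> R then U + fls_const kk + fls_const (s j) else 1)"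
    unfolding fls_const_prod prod.distrib[symmetric] by (intro prod.cong refl) (use s in \<open>auto simp: column_below_def\<close>)
  ultimately show ?thesis unfolding f'(4)[OF U2] f'(1) f(3) s_def[symmetric] e_def[symmetric]
    by (simp add: fls_const_mult_const[symmetric] mult_ac del: fls_const_mult_const)
qed

section \<open>Subsets of columns versus partitions\<close>

definition "above_of R = diagram_of (\<lambda>j. c j + (if j \<in> P \<union> R then 1 else 0))"
definition "below_of R = diagram_of (\<lambda>j. c j - (if j \<in> Q \<union> R then 1 else 0))"

lemma anti: "1 \<le> j \<Longrightarrow> c (Suc j) \<le> c j" "1 \<le> j \<Longrightarrow> r (Suc j) \<le> r j"
  using col_len_antimono[OF yK, of j "Suc j"] col_len_antimono[OF yG, of j "Suc j"] by auto

lemma pair_prod_zero: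
  assumes R: "R \<subseteq> S" and j: "Suc j \<in> R" "j \<in> S - R" "c (Suc j) = c j"
  shows "(\<Prod>i\<in>R. \<Prod>d\<in>S-R. H (w i - w d)) = 0"
proof -
  have fin: "finite R" "finite (S - R)" using R classes(7) finite_subset by auto
  have "H (w (Suc j) - w j) = 0"
    using j(3) pair_weight_minus_one[of kk] by (simp add: col_var_def)
  then have "(\<Prod>d\<in>S-R. H (w (Suc j) - w d)) = 0" using j(2) fin by auto
  then show ?thesis using j(1) fin by auto
qed

text \<open>If the new lengths increased from \<open>j\<close> to \<open>j + 1\<close>, these
  columns would be equally long in \<open>K\<close> with only the second one enlarged. Monotonicity
  of \<open>r\<close> then puts both into \<open>S\<close>, and the product contains the pair weight
  at -1.\<close>

lemma above_of_above:
  assumes R: "R \<subseteq> S" and nz: "(\<Prod>i\<in>R. \<Prod>d\<in>S-R. H (w i - w d)) \<noteq> 0"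
  shows "above_of R \<in> strips_above"
proof -
  define l where "l j = c j + (if j \<in> P \<union> R then 1 else 0)" for j
  have PRM: "P \<union> R \<subseteq> {1..M}" using R classes unfolding P_def by auto
  have l0: "l j = 0" if "j > M" for j using col_zero[OF that] PRM that unfolding l_def by auto
  have la: "l (Suc j) \<le> l j" if j: "1 \<le> j" for j
  proof (rule ccontr)
    assume a: "\<not> l (Suc j) \<le> l j"
    then have 1: "Suc j \<in> P \<union> R" "j \<notin> P \<union> R" "c (Suc j) = c j"
      using anti(1)[OF j] unfolding l_def by (auto split: if_splits)
    then have M: "Suc j \<le> M" using PRM by auto
    have jS: "j \<in> {1..M}" using M j by auto
    have rj: "r j \<le> c j"
    proof -
      have "j \<in> Q \<or> j \<in> S" using classes(1) jS 1(2) by blast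
      then show ?thesis using class_eqs(2,3)[of j] by linarith
    qed
    have "Suc j \<notin> P" using class_eqs(1)[of "Suc j"] anti(2)[OF j] rj 1(3) by (intro notI) linarith
    then have R1: "Suc j \<in> R" "Suc j \<in> S" using 1(1) R by auto
    then have "j \<notin> Q" using class_eqs(2)[of j] class_eqs(3)[OF R1(2)] anti(2)[OF j] 1(3) by (intro notI) linarith
    then have "j \<in> S - R" using jS 1(2) classes(1) by blast
    then show False using pair_prod_zero[OF R R1(1) _ 1(3)] nz by simp
  qed
  have y: "young_diagram (above_of R)" unfolding above_of_def l_def[symmetric] using young_diagram_of[of l M] la l0 by auto
  have col: "col_len (above_of R) j = l j" if "1 \<le> j" for j
    unfolding above_of_def l_def[symmetric] by (rule col_len_diagram_of[OF that])
  have "r j \<le> l j \<and> l j \<le> r j + 1" if j: "1 \<le> j" for j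
  proof (cases "j \<in> {1..M}")
    case True
    then show ?thesis
      using col_balance[OF _ _ R, of j] unfolding l_def by (auto simp: of_bool_def split: if_splits)
  next
    case False
    then show ?thesis using l0[of j] col_zero[of j] j by auto
  qed
  then have "hstrip (above_of R) G" "hstrip (above_of R) K"
    unfolding hstrip_def using y yK yG col by (auto simp: l_def)
  moreover have "cols_in M (above_of R)"
    unfolding cols_in_def above_of_def l_def[symmetric] diagram_of_def using l0 by (force simp: not_less[symmetric])
  ultimately show ?thesis unfolding strips_above_def by blast
qed

text \<open>Removing boxes also requires nonempty columns. Let \<open>m\<close> be the last empty
  column in \<open>R\<close>. If \<open>m = M\<close>, the factor \<open>M + w m\<close> is 0;
  otherwise column \<open>m + 1\<close> is empty and lies in \<open>S - R\<close>, and the pair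
  weight of the two columns is 0.\<close>

lemma below_of_below:
  assumes R: "R \<subseteq> S" and nz: "(\<Prod>i\<in>S-R. \<Prod>d\<in>R. H (w i - w d)) * (\<Prod>j\<in>R. of_nat M + w j) \<noteq> 0"
  shows "below_of R \<in> strips_below" and "\<And>j. j \<in> Q \<union> R \<Longrightarrow> 1 \<le> c j"
proof -
  define t where "t j = c j - (if j \<in> Q \<union> R then 1 else 0)" for j
  have fR: "finite R" using R classes(7) finite_subset by blast
  have SR: "S - R \<subseteq> S" "S - (S - R) = R" using R by auto
  have QRM: "Q \<union> R \<subseteq> {1..M}" using R classes unfolding Q_def by auto
  have nopair: False if "Suc j \<in> S - R" "j \<in> R" "c (Suc j) = c j" for j
    using pair_prod_zero[OF SR(1) that(1) _ that(3)] that(2) nz unfolding SR(2) by simp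
  have c1: "1 \<le> c j" if "j \<in> R" for j
  proof (rule ccontr)
    define Z where "Z = {j \<in> R. c j = 0}"
    assume "\<not> 1 \<le> c j"
    then have "j \<in> Z" using that unfolding Z_def by auto
    moreover have fZ: "finite Z" using fR unfolding Z_def by auto
    ultimately have m: "Max Z \<in> Z" using Max_in by blast
    define m where "m = Max Z"
    have mR: "m \<in> R" "c m = 0" using m unfolding m_def Z_def by auto
    have mM: "1 \<le> m" "m \<le> M" using mR(1) QRM by auto
    have "m \<noteq> M"
    proof
      assume "m = M"
      then have "of_nat M + w m = 0" using mR(2) by (simp add: col_var_def)
      then have "(\<Prod>j\<in>R. of_nat M + w j) = 0" using mR(1) fR by (meson prod_zero)
      then show False using nz by simp
    qed
    then have sm: "Suc m \<in> {1..M}" using mM by auto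
    have cz: "c (Suc m) = 0" using anti(1)[OF mM(1)] mR(2) by simp
    have "r m = 0" using mR class_eqs(3)[of m] R by auto
    then have "r (Suc m) = 0" using anti(2)[OF mM(1)] by simp
    then have "Suc m \<in> S" using cz sm unfolding S_def by auto
    moreover have "Suc m \<notin> R"
    proof
      assume "Suc m \<in> R"
      then have "Suc m \<in> Z" using cz unfolding Z_def by auto
      then show False using Max_ge[OF fZ] unfolding m_def by fastforce
    qed
    ultimately show False using nopair[of m] mR cz by simp
  qed
  then show c1': "1 \<le> c j" if "j \<in> Q \<union> R" for j using that class_eqs(2)[of j] by auto
  have t0: "t j = 0" if "j > M" for j using col_zero[OF that] unfolding t_def by auto
  have ta: "t (Suc j) \<le> t j" if j: "1 \<le> j" for j
  proof (rule ccontr)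
    assume a: "\<not> t (Suc j) \<le> t j"
    then have 1: "Suc j \<notin> Q \<union> R" "j \<in> Q \<union> R" "c (Suc j) = c j"
      using anti(1)[OF j] c1'[of "Suc j"] unfolding t_def by (auto split: if_splits)
    have "1 \<le> c (Suc j)" using 1 c1'[of j] by simp
    then have M: "Suc j \<le> M" using col_zero[of "Suc j"] by (metis not_less not_one_le_zero)
    have js: "Suc j \<in> {1..M}" using M by auto
    have rj: "c j \<le> r (Suc j)"
    proof -
      have "Suc j \<in> P \<or> Suc j \<in> S" using classes(1) js 1(1) by blast
      then show ?thesis using class_eqs(1,3)[of "Suc j"] 1(3) by linarith
    qed
    then have rr: "c j \<le> r j" using anti(2)[OF j] by simp
    then have "j \<notin> Q" using class_eqs(2)[of j] by (intro notI) linarith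
    then have R1: "j \<in> R" "j \<in> S" using 1(2) R by auto
    have "Suc j \<notin> P" using class_eqs(1)[of "Suc j"] class_eqs(3)[OF R1(2)] anti(2)[OF j] 1(3) by (intro notI) linarith
    then have "Suc j \<in> S - R" using js 1(1) classes(1) by blast
    then show False using nopair[of j] R1(1) 1(3) by simp
  qed
  have y: "young_diagram (below_of R)" unfolding below_of_def t_def[symmetric] using young_diagram_of[of t M] ta t0 by auto
  have col: "col_len (below_of R) j = t j" if "1 \<le> j" for j
    unfolding below_of_def t_def[symmetric] by (rule col_len_diagram_of[OF that])
  have "t j \<le> r j \<and> r j \<le> t j + 1" if j: "1 \<le> j" for j
  proof (cases "j \<in> {1..M}")
    case True
    then show ?thesis
      using col_balance[OF _ _ R, of j] c1'[of j] unfolding t_def by (auto simp: of_bool_def split: if_splits)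
  next
    case False
    then show ?thesis using t0[of j] col_zero[of j] j by auto
  qed
  then have "hstrip G (below_of R)" "hstrip K (below_of R)"
    unfolding hstrip_def using y yK yG col by (auto simp: t_def)
  then show "below_of R \<in> strips_below" unfolding strips_below_def by blast
qed

lemma subset_sum_fls:
  "subset_sum (fls_const kk) (\<lambda>j. fls_const (w j)) S X u = (\<Sum>R\<in>Pow S. fls_const (\<Prod>i\<in>R. \<Prod>d\<in>S-R. H (w i - w d)) *
     ((\<Prod>i\<in>R. X + fls_const kk + fls_const (w i)) * (\<Prod>j\<in>S-R. u + fls_const (w j))))"
  unfolding subset_sum_def fls_const_prod fls_minus_const pair_weight_fls_const ..

lemma inj_on_diagram_of:
  assumes "A \<subseteq> Pow S" "\<And>R j. R \<in> A \<Longrightarrow> j \<in> S \<Longrightarrow> j \<in> R \<longleftrightarrow> f R j \<noteq> c j"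
  shows "inj_on (\<lambda>R. diagram_of (f R)) A"
proof (rule inj_onI)
  fix R R' assume R: "R \<in> A" "R' \<in> A" "diagram_of (f R) = diagram_of (f R')"
  have "f R j = f R' j" if "j \<in> S" for j
    using R(3) col_len_diagram_of[of j "f R"] col_len_diagram_of[of j "f R'"] that unfolding S_def by auto
  then have "j \<in> R \<longleftrightarrow> j \<in> R'" if "j \<in> S" for j using assms(2) R(1,2) that by auto
  then show "R = R'" using R(1,2) assms(1) by blast
qed

lemma sum_above:
  "(\<Sum>L\<in>strips_above. W_at U L K * fls_const (poly (A_poly L G) (of_nat M)))
    = fls_const pairs_fixed * columns_fixed * subset_sum (fls_const kk) (\<lambda>j. fls_const (w j)) S (of_nat M) U / (\<Prod>l=1..M. U - of_nat l)"
proof -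
  define g where "g R = fls_const pairs_fixed * columns_fixed * (fls_const (\<Prod>i\<in>R. \<Prod>d\<in>S-R. H (w i - w d)) *
     ((\<Prod>i\<in>R. of_nat M + fls_const kk + fls_const (w i)) * (\<Prod>j\<in>S-R. U + fls_const (w j)))) / (\<Prod>l=1..M. U - of_nat l)" for R
  have "(\<Sum>L\<in>strips_above. W_at U L K * fls_const (poly (A_poly L G) (of_nat M))) = (\<Sum>R\<in>Pow S. g R)"
  proof (rule sum_reindex_zero[where \<phi> = above_of])
    show "finite (Pow S)" using classes by simp
    show "inj_on above_of (Pow S)"
      unfolding above_of_def[abs_def] by (rule inj_on_diagram_of) (use classes in auto)
    show "strips_above \<subseteq> above_of ` Pow S"
    proof
      fix L assume L: "L \<in> strips_above"
      then have h: "hstrip L K" "hstrip L G" "cols_in M L" unfolding strips_above_def by auto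
      have y: "young_diagram L" using h unfolding hstrip_def by auto
      define R where "R = {j \<in> S. col_len L j = c j + 1}"
      have "col_len L j = c j + (if j \<in> P \<union> R then 1 else 0)" if j: "1 \<le> j" for j
      proof (cases "j \<in> {1..M}")
        case True
        have le: "c j \<le> col_len L j" "col_len L j \<le> c j + 1" "r j \<le> col_len L j" "col_len L j \<le> r j + 1"
          using h j unfolding hstrip_def by auto
        show ?thesis using le True by (auto simp: R_def P_def Q_def S_def)
      next
        case False
        then have "j > M" using j by auto
        then show ?thesis using col_len_eq_0[OF y h(3), of j] col_zero(1)[of j] classes(8) False by (auto simp: P_def R_def)
      qed
      then have "diagram_of (col_len L) = above_of R"
        unfolding above_of_def diagram_of_def by auto
      then show "L \<in> above_of ` Pow S" unfolding diagram_of_col_len[OF y] R_def by blast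
    qed
    fix R assume R: "R \<in> Pow S"
    then have RS: "R \<subseteq> S" by simp
    show "above_of R \<notin> strips_above \<Longrightarrow> g R = 0"
      using above_of_above[OF RS] unfolding g_def by force
    assume L: "above_of R \<in> strips_above"
    have col: "col_len (above_of R) j = c j + of_bool (j \<in> P \<union> R)" if "1 \<le> j" "j \<le> M" for j
      unfolding above_of_def using col_len_diagram_of[OF that(1)] by simp
    show "W_at U (above_of R) K * fls_const (poly (A_poly (above_of R) G) (of_nat M)) = g R"
      by (subst above_term[OF L RS], use col in force)
        (unfold prod_pair_above[OF RS] prod_column_above[OF RS] g_def, simp add: fls_const_mult_const[symmetric] mult_ac del: fls_const_mult_const)
  qed
  then show ?thesis unfolding subset_sum_fls g_def by (simp add: sum_distrib_left sum_divide_distrib)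
qed

lemma sum_below:
  "(\<Sum>T\<in>strips_below. fls_const (poly (A_poly K T) (of_nat M)) * W_at (U + fls_const kk) G T)
    = fls_const pairs_fixed * columns_fixed * subset_sum (fls_const kk) (\<lambda>j. fls_const (w j)) S U (of_nat M) / (\<Prod>l=1..M. U + fls_const kk - of_nat l)"
proof -
  define g where "g R = fls_const pairs_fixed * columns_fixed * (fls_const (\<Prod>i\<in>S-R. \<Prod>d\<in>R. H (w i - w d)) *
     ((\<Prod>j\<in>R. of_nat M + fls_const (w j)) * (\<Prod>j\<in>S-R. U + fls_const kk + fls_const (w j)))) / (\<Prod>l=1..M. U + fls_const kk - of_nat l)" for R
  have g0: "g R = 0" if "R \<subseteq> S" "(\<Prod>i\<in>S-R. \<Prod>d\<in>R. H (w i - w d)) * (\<Prod>j\<in>R. of_nat M + w j) = 0" for R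
  proof -
    have "g R = fls_const pairs_fixed * columns_fixed * (fls_const ((\<Prod>i\<in>S-R. \<Prod>d\<in>R. H (w i - w d)) * (\<Prod>j\<in>R. of_nat M + w j)) *
      (\<Prod>j\<in>S-R. U + fls_const kk + fls_const (w j))) / (\<Prod>l=1..M. U + fls_const kk - of_nat l)"
      unfolding g_def by (simp add: fls_const_mult_const[symmetric] fls_const_prod fls_plus_const[symmetric] fls_of_nat[symmetric] mult_ac del: fls_const_mult_const)
    then show ?thesis unfolding that(2) by simp
  qed
  \<comment> \<open>The index set is restricted first because the truncated subtraction in
    \<open>below_of\<close> is not injective on sets with empty columns; the omitted terms
    vanish.\<close>
  have "(\<Sum>T\<in>strips_below. fls_const (poly (A_poly K T) (of_nat M)) * W_at (U + fls_const kk) G T) = (\<Sum>R\<in>{R \<in> Pow S. \<forall>j\<in>R. 1 \<le> c j}. g R)"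
  proof (rule sum_reindex_zero[where \<phi> = below_of])
    show "finite {R \<in> Pow S. \<forall>j\<in>R. 1 \<le> c j}" using classes by simp
    show "inj_on below_of {R \<in> Pow S. \<forall>j\<in>R. 1 \<le> c j}"
      unfolding below_of_def[abs_def]
    proof (rule inj_on_diagram_of)
      fix R j assume R: "R \<in> {R \<in> Pow S. \<forall>j\<in>R. 1 \<le> c j}" and "j \<in> S"
      then have "j \<notin> Q" using classes(4) by blast
      then show "j \<in> R \<longleftrightarrow> c j - (if j \<in> Q \<union> R then 1 else 0) \<noteq> c j" using R by force
    qed auto
    show "strips_below \<subseteq> below_of ` {R \<in> Pow S. \<forall>j\<in>R. 1 \<le> c j}"
    proof
      fix T assume T: "T \<in> strips_below"
      then have h: "hstrip K T" "hstrip G T" unfolding strips_below_def by auto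
      have y: "young_diagram T" using h unfolding hstrip_def by auto
      define R where "R = {j \<in> S. c j = col_len T j + 1}"
      have "col_len T j = c j - (if j \<in> Q \<union> R then 1 else 0)" if j: "1 \<le> j" for j
      proof (cases "j \<in> {1..M}")
        case True
        have le: "col_len T j \<le> c j" "c j \<le> col_len T j + 1" "col_len T j \<le> r j" "r j \<le> col_len T j + 1"
          using h j unfolding hstrip_def by auto
        show ?thesis using le True by (auto simp: R_def P_def Q_def S_def)
      next
        case False
        then have "j > M" using j by auto
        moreover have "col_len T j \<le> c j" using h(1) j unfolding hstrip_def by auto
        ultimately show ?thesis using col_zero(1)[of j] by simp
      qed
      then have "diagram_of (col_len T) = below_of R"
        unfolding below_of_def diagram_of_def by auto
      then have "T = below_of R" unfolding diagram_of_col_len[OF y] .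
      then show "T \<in> below_of ` {R \<in> Pow S. \<forall>j\<in>R. 1 \<le> c j}" unfolding R_def by auto
    qed
    fix R assume R: "R \<in> {R \<in> Pow S. \<forall>j\<in>R. 1 \<le> c j}"
    then have RS: "R \<subseteq> S" and Rc: "\<And>j. j \<in> R \<Longrightarrow> 1 \<le> c j" by auto
    show "below_of R \<notin> strips_below \<Longrightarrow> g R = 0" using g0[OF RS] below_of_below(1)[OF RS] by blast
    assume T: "below_of R \<in> strips_below"
    have col: "c j = col_len (below_of R) j + of_bool (j \<in> Q \<union> R)" if "1 \<le> j" "j \<le> M" for j
      unfolding below_of_def col_len_diagram_of[OF that(1)] using Rc[of j] class_eqs(2)[of j] by auto
    show "fls_const (poly (A_poly K (below_of R)) (of_nat M)) * W_at (U + fls_const kk) G (below_of R) = g R"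
      by (subst below_term[OF T RS], use col in force)
        (unfold prod_pair_below[OF RS] prod_column_below[OF RS] g_def, simp add: fls_const_mult_const[symmetric] mult_ac del: fls_const_mult_const)
  qed
  also have "\<dots> = (\<Sum>R\<in>Pow S. g R)"
  proof (rule sum.mono_neutral_left)
    show "\<forall>R\<in>Pow S - {R \<in> Pow S. \<forall>j\<in>R. 1 \<le> c j}. g R = 0"
      using g0 below_of_below(2) by blast
  qed (use classes in auto)
  also have "\<dots> = (\<Sum>R\<in>Pow S. g (S - R))"
    by (rule sum.reindex_bij_witness[of _ "\<lambda>R. S - R" "\<lambda>R. S - R"]) (auto simp: double_diff)
  finally show ?thesis unfolding subset_sum_fls sum_distrib_left sum_divide_distrib
    by (rule trans[OF _ sum.cong[OF refl]]) (simp add: g_def double_diff mult_ac)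
qed

lemma generic_columns: "generic_points (fls_const kk) (\<lambda>j. fls_const (w j)) S"
  unfolding generic_points_def
proof (intro ballI impI)
  fix i j assume ij: "i \<in> S" "j \<in> S" "i \<noteq> j"
  have nz: "of_int (int j - int i) + of_int b * kk \<noteq> 0" for b
    using kk_affine_eq_0[of "int j - int i" b] ij(3) by linarith
  have "w i - w j \<noteq> 0"
    using nz[of "int (c i) - int (c j)"] by (simp add: col_var_def algebra_simps)
  moreover have "w i - w j + kk \<noteq> 0"
    using nz[of "int (c i) - int (c j) + 1"] by (simp add: col_var_def algebra_simps)
  ultimately show "fls_const (w i) \<noteq> fls_const (w j) \<and> fls_const (w i) - fls_const (w j) + fls_const kk \<noteq> 0"
    by (simp add: fls_minus_const fls_plus_const fls_eq_iff)
qed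

lemma skew_at_nat:
  "(\<Sum>L\<in>strips_above. W_at U L K * fls_const (poly (A_poly L G) (of_nat M)))
    = (\<Prod>l=1..M. (U + fls_const kk - of_nat l) / (U - of_nat l)) *
      (\<Sum>T\<in>strips_below. fls_const (poly (A_poly K T) (of_nat M)) * W_at (U + fls_const kk) G T)"
proof -
  have "(\<Prod>l=1..M. U + fls_const kk - of_nat l) \<noteq> 0" using U2 by simp
  moreover have "fls_const kk \<noteq> 0" using kk_pos by auto
  ultimately show ?thesis
    unfolding sum_above sum_below prod_dividef
    using subset_sum_symmetric[OF classes(7) generic_columns, of "of_nat M" U] by simp
qed

end

section \<open>The skew identity with polynomial coefficients\<close>

unbundle fps_syntax

text \<open>Stated through coefficients so that 0 has every order, whereas
  \<open>fls_subdegree 0\<close> is 0.\<close>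

definition fls_low :: "int \<Rightarrow> 'a::zero fls \<Rightarrow> bool" where
  "fls_low n f \<longleftrightarrow> (\<forall>i<n. f $$ i = 0)"

lemma fls_low_iff: "fls_low n f \<longleftrightarrow> f = 0 \<or> n \<le> fls_subdegree f"
proof
  assume "fls_low n f"
  then show "f = 0 \<or> n \<le> fls_subdegree f"
    unfolding fls_low_def using fls_subdegree_geI[of f n] by auto
qed (auto simp: fls_low_def fls_eq0_below_subdegree)

lemma fls_low_mult:
  fixes f g :: "Qk fls"
  assumes "fls_low m f" "fls_low n g"
  shows "fls_low (m + n) (f * g)"
proof (cases "f * g = 0")
  case False
  then have "f \<noteq> 0" "g \<noteq> 0" by auto
  then have "m + n \<le> fls_subdegree f + fls_subdegree g" using assms unfolding fls_low_iff by auto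
  also have "\<dots> \<le> fls_subdegree (f * g)" by (rule fls_mult_subdegree_ge[OF False])
  finally show ?thesis unfolding fls_low_iff by simp
qed (simp add: fls_low_iff)

lemma fls_low_mono: "fls_low n f \<Longrightarrow> m \<le> n \<Longrightarrow> fls_low m f"
  unfolding fls_low_def by auto

lemma fls_low_diff: "fls_low n f \<Longrightarrow> fls_low n g \<Longrightarrow> fls_low n (f - g :: Qk fls)"
  unfolding fls_low_def by auto

definition uu_shift :: "Qk \<Rightarrow> Qk fls" where
  "uu_shift s = uu + fls_const s"

lemma uu_shift_0: "uu_shift 0 = uu" unfolding uu_shift_def by simp

lemma uu_shift_add: "uu_shift s + fls_const t = uu_shift (s + t)"
  unfolding uu_shift_def by (simp add: add.assoc fls_plus_const)

lemma uu_shift_plus_const: "uu_shift s + fls_const x = uu - fls_const (- s - x)"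
  "uu_shift s - fls_const x = uu - fls_const (x - s)" "uu_shift s - of_nat n = uu - fls_const (of_nat n - s)"
  unfolding uu_shift_def by (simp_all add: fls_of_nat fls_minus_const[symmetric] algebra_simps)

lemma uu_shift_neq: "uu_shift s \<noteq> of_nat l"
proof -
  have "uu_shift s - of_nat l \<noteq> 0" unfolding uu_shift_plus_const by (rule uu_minus_const)
  then show ?thesis by simp
qed

lemma fls_low_uu_shift: "fls_low (- 1) (uu_shift s - fls_const x)" "fls_low (- 1) (uu_shift s + fls_const x)"
  unfolding fls_low_iff uu_shift_plus_const using uu_minus_const by simp_all

definition inv_falling :: "Qk \<Rightarrow> nat \<Rightarrow> Qk fls" where
  "inv_falling s l = 1 / (\<Prod>r=1..l. uu_shift s - of_nat r)"

lemma prod_uu_shift: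
  "(\<Prod>r=1..l. uu_shift s - of_nat r) \<noteq> 0" "fls_subdegree (\<Prod>r=1..l. uu_shift s - of_nat r) = - int l"
  using subdegree_prod_uu[of "{1..l}" "\<lambda>r. uu_shift s - of_nat r"] by (auto simp: uu_shift_plus_const)

lemma inv_falling_low: "fls_low (int l) (inv_falling s l)"
  unfolding fls_low_iff inv_falling_def using prod_uu_shift[of s l] by (simp add: fls_divide_subdegree)

lemma inv_falling_Suc: "(uu_shift s - of_nat (Suc l)) * inv_falling s (Suc l) = inv_falling s l"
  unfolding inv_falling_def using uu_shift_neq[of s "Suc l"] by (simp add: mult.commute)

section \<open>F as a series in 1/u with polynomial coefficients\<close>

definition falling_poly :: "nat \<Rightarrow> Qk poly" where
  "falling_poly l = (\<Prod>i<l. [:- of_nat i, 1:])"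

lemma poly_falling: "poly (falling_poly l) x = (\<Prod>i<l. x - of_nat i)"
  unfolding falling_poly_def by (simp add: poly_prod)

text \<open>The coefficient of order \<open>a\<close> in 1/u of F(x, u + s), as a polynomial in x.
  The sum stops at \<open>a\<close> because \<open>inv_falling s l\<close> has order
  \<open>l\<close>.\<close>

definition F_coef :: "Qk \<Rightarrow> nat \<Rightarrow> Qk poly" where
  "F_coef s a = (\<Sum>l\<le>a. smult (pochhammer kk l / fact l * inv_falling s l $$ int a) (falling_poly l))"

definition F_fps :: "Qk \<Rightarrow> Qk poly fps" where
  "F_fps s = Abs_fps (F_coef s)"

definition fps_eval :: "Qk \<Rightarrow> Qk poly fps \<Rightarrow> Qk fls" where
  "fps_eval x f = fps_to_fls (Abs_fps (\<lambda>n. poly (f $ n) x))"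

lemma fps_eval_nth: "fps_eval x f $$ int n = poly (f $ n) x"
  unfolding fps_eval_def by simp

lemma fps_eval_low: "fls_low 0 (fps_eval x f)"
  unfolding fls_low_def fps_eval_def by simp

lemma fps_eval_mult: "fps_eval x (f * g) = fps_eval x f * fps_eval x g"
proof -
  have "Abs_fps (\<lambda>n. poly ((f * g) $ n) x) = Abs_fps (\<lambda>n. poly (f $ n) x) * Abs_fps (\<lambda>n. poly (g $ n) x)"
    by (rule fps_ext) (simp add: fps_mult_nth poly_sum)
  then show ?thesis unfolding fps_eval_def by (simp add: fls_times_fps_to_fls)
qed

lemma fps_eval_add: "fps_eval x (f + g) = fps_eval x f + fps_eval x g"
proof -
  have "Abs_fps (\<lambda>n. poly ((f + g) $ n) x) = Abs_fps (\<lambda>n. poly (f $ n) x) + Abs_fps (\<lambda>n. poly (g $ n) x)"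
    by (rule fps_ext) simp
  then show ?thesis unfolding fps_eval_def by simp
qed

lemma fps_eval_0 [simp]: "fps_eval x 0 = 0"
proof -
  have "Abs_fps (\<lambda>n. poly ((0 :: Qk poly fps) $ n) x) = 0" by (rule fps_ext) simp
  then show ?thesis unfolding fps_eval_def by simp
qed

lemma fps_eval_sum: "fps_eval x (\<Sum>a\<in>A. f a) = (\<Sum>a\<in>A. fps_eval x (f a))"
  by (induction A rule: infinite_finite_induct) (auto simp: fps_eval_add)

lemma fps_eval_const: "fps_eval x (fps_const p) = fls_const (poly p x)"
proof -
  have "Abs_fps (\<lambda>n. poly (fps_const p $ n) x) = fps_const (poly p x)" by (rule fps_ext) simp
  then show ?thesis unfolding fps_eval_def by simp
qed

definition fls_lift :: "Qk fls \<Rightarrow> Qk poly fps" where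
  "fls_lift f = Abs_fps (\<lambda>n. [:f $$ int n:])"

lemma fls_eq_nonneg:
  assumes "fls_low 0 f" "fls_low 0 g" "\<And>n. f $$ int n = g $$ int n"
  shows "f = g"
proof (rule fls_eqI)
  fix n :: int
  show "f $$ n = g $$ n"
    using assms unfolding fls_low_def by (cases "n < 0") (simp, metis nat_0_le not_less)
qed

lemma fps_eval_fls_lift: "fls_low 0 f \<Longrightarrow> fps_eval x (fls_lift f) = f"
  by (rule fls_eq_nonneg) (auto simp: fps_eval_low fps_eval_nth fls_lift_def)

text \<open>The bound \<open>M0\<close> matters: the skew identity is applied only once
  \<open>M\<close> exceeds the sizes of the diagrams involved.\<close>

lemma poly_eq_at_large_nat:
  fixes p q :: "Qk poly"
  assumes "\<And>M. M \<ge> M0 \<Longrightarrow> poly p (of_nat M) = poly q (of_nat M)"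
  shows "p = q"
proof (rule ccontr)
  assume "p \<noteq> q"
  then have "finite {x. poly (p - q) x = 0}" by (intro poly_roots_finite) simp
  moreover have "of_nat ` {M0..} \<subseteq> {x. poly (p - q) x = 0}" using assms by auto
  ultimately have "finite ((of_nat :: nat \<Rightarrow> Qk) ` {M0..})" using finite_subset by blast
  then have "finite {M0..}" by (rule finite_imageD) (auto simp: inj_on_def)
  then show False using infinite_Ici by blast
qed

lemma fps_eval_inject:
  assumes "\<And>M. M \<ge> M0 \<Longrightarrow> fps_eval (of_nat M) f = fps_eval (of_nat M) g"
  shows "f = g"
proof (rule fps_ext)
  fix n show "f $ n = g $ n"
    by (rule poly_eq_at_large_nat[of M0]) (metis assms fps_eval_nth)
qed

definition F_at :: "Qk \<Rightarrow> Qk \<Rightarrow> Qk fls" where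
  "F_at s x = fps_eval x (F_fps s)"

definition F_part :: "Qk \<Rightarrow> Qk \<Rightarrow> nat \<Rightarrow> Qk fls" where
  "F_part s x L = (\<Sum>l\<le>L. fls_const (pochhammer kk l / fact l * poly (falling_poly l) x) * inv_falling s l)"

lemma F_at_nth: "F_at s x $$ int n = (\<Sum>l\<le>n. pochhammer kk l / fact l * poly (falling_poly l) x * inv_falling s l $$ int n)"
  unfolding F_at_def fps_eval_nth F_fps_def F_coef_def by (simp add: poly_sum mult_ac)

lemma F_at_low: "fls_low 0 (F_at s x)"
  unfolding F_at_def by (rule fps_eval_low)

lemma F_part_low: "fls_low 0 (F_part s x L)"
  unfolding fls_low_def F_part_def fls_nth_sum
  using inv_falling_low[of _ s] unfolding fls_low_def by (auto intro!: sum.neutral)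

lemma F_at_minus_part_low: "fls_low (int L + 1) (F_at s x - F_part s x L)"
proof -
  have "F_at s x $$ i = F_part s x L $$ i" if "i < int L + 1" for i
  proof (cases "i < 0")
    case True
    then show ?thesis using F_at_low[of s x] F_part_low[of s x L] unfolding fls_low_def by simp
  next
    case False
    define n where "n = nat i"
    have n: "i = int n" "n \<le> L" using False that unfolding n_def by auto
    have "F_at s x $$ i = (\<Sum>l\<le>L. pochhammer kk l / fact l * poly (falling_poly l) x * inv_falling s l $$ int n)"
      unfolding n F_at_nth
      by (rule sum.mono_neutral_left) (use n inv_falling_low[of _ s] in \<open>auto simp: fls_low_def\<close>)
    then show ?thesis unfolding F_part_def fls_nth_sum n by simp
  qed
  then show ?thesis unfolding fls_low_def by simp
qed

section \<open>The recurrence of F in its first argument\<close>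

lemma falling_shift:
  "(\<Prod>i<Suc m. x - of_nat i :: Qk) = x * (\<Prod>i<m. x - 1 - of_nat i)"
proof -
  have "(\<Prod>i<Suc m. x - of_nat i :: Qk) = x * (\<Prod>i<m. x - of_nat (Suc i))"
    by (subst prod.lessThan_Suc_shift) simp
  then show ?thesis by (simp add: algebra_simps)
qed

text \<open>The contiguous relation of the hypergeometric series telescopes: partial sums satisfy it
  up to one explicit remainder. Its form is forced, since the difference of consecutive remainders
  must be the contribution of the term of index \<open>L + 1\<close>.\<close>

lemma F_part_recurrence:
  "(uu_shift s - fls_const x) * F_part s x L - (uu_shift s - fls_const x + fls_const kk) * F_part s (x - 1) L
    = - (fls_const (pochhammer kk (Suc L) / fact L * (\<Prod>i<L. x - 1 - of_nat i)) * inv_falling s L)"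
proof (induction L)
  case 0
  show ?case by (simp add: F_part_def falling_poly_def inv_falling_def)
next
  case (Suc L)
  define U where "U = uu_shift s"
  define p where "p = (\<Prod>i<L. x - 1 - of_nat i)"
  define q where "q = inv_falling s (Suc L)"
  define b where "b = pochhammer kk (Suc L) / fact (Suc L)"
  define m where "m = (of_nat (Suc L) :: Qk)"
  have m0: "m \<noteq> 0" unfolding m_def using of_nat_eq_0_iff[of "Suc L", where ?'a = Qk] by simp
  have f1: "pochhammer kk (Suc L) / fact L = b * m"
    unfolding b_def m_def by (simp del: of_nat_Suc)
  have f2: "pochhammer kk (Suc (Suc L)) / fact (Suc L) = b * (kk + m)"
    unfolding b_def m_def pochhammer_Suc[of kk "Suc L"] by (simp del: of_nat_Suc)
  have f3: "poly (falling_poly (Suc L)) x = x * p" unfolding poly_falling falling_shift p_def ..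
  have f4: "poly (falling_poly (Suc L)) (x - 1) = p * (x - m)"
    unfolding poly_falling p_def m_def by (simp add: algebra_simps)
  have f5: "(\<Prod>i<Suc L. x - 1 - of_nat i) = p * (x - m)"
    unfolding p_def m_def by (simp add: algebra_simps)
  have q1: "inv_falling s L = (U - fls_const m) * q"
    unfolding q_def U_def m_def fls_of_nat[symmetric] inv_falling_Suc ..
  have e: "F_part s x (Suc L) = F_part s x L + fls_const (b * (x * p)) * q"
    "F_part s (x - 1) (Suc L) = F_part s (x - 1) L + fls_const (b * (p * (x - m))) * q"
    unfolding F_part_def b_def f3[symmetric] f4[symmetric] q_def by simp_all
  have IH: "(U - fls_const x) * F_part s x L - (U - fls_const x + fls_const kk) * F_part s (x - 1) L
    = - (fls_const (b * m * p) * ((U - fls_const m) * q))"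
    using Suc.IH unfolding f1 q1 p_def[symmetric] U_def .
  have c: "fls_const (y * z) = fls_const y * fls_const z" "fls_const (y - z) = fls_const y - fls_const z"
    "fls_const (y + z) = fls_const y + fls_const z" for y z :: Qk
    by (simp_all add: fls_minus_const fls_plus_const)
  show ?case
    unfolding e f2 f5 U_def[symmetric] p_def[symmetric] q_def[symmetric]
    using IH unfolding c by (simp only: distrib_left) algebra
qed

text \<open>The tail after \<open>L\<close> has order \<open>L + 1\<close>, the factor linear in u
  costs one order, and the remainder has order \<open>L\<close>. So the defect has order at least
  \<open>L\<close> for every \<open>L\<close>.\<close>

lemma F_at_recurrence:
  "(uu_shift s - fls_const x) * F_at s x = (uu_shift s - fls_const x + fls_const kk) * F_at s (x - 1)"
proof -
  define D where "D = (uu_shift s - fls_const x) * F_at s x - (uu_shift s - fls_const x + fls_const kk) * F_at s (x - 1)"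
  have e: "uu_shift s - fls_const x + fls_const kk = uu_shift s - fls_const (x - kk)"
    by (simp add: fls_minus_const[symmetric])
  have "fls_low (int L) D" for L
  proof -
    have "fls_low (-1 + (int L + 1)) ((uu_shift s - fls_const x) * (F_at s x - F_part s x L))"
      by (rule fls_low_mult[OF fls_low_uu_shift(1) F_at_minus_part_low])
    moreover have "fls_low (-1 + (int L + 1)) ((uu_shift s - fls_const x + fls_const kk) * (F_at s (x - 1) - F_part s (x - 1) L))"
      unfolding e by (rule fls_low_mult[OF fls_low_uu_shift(1) F_at_minus_part_low])
    moreover have "fls_low (0 + int L) (fls_const (pochhammer kk (Suc L) / fact L * (\<Prod>i<L. x - 1 - of_nat i)) * inv_falling s L)"
      by (rule fls_low_mult[OF _ inv_falling_low]) (simp add: fls_low_def)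
    ultimately have "fls_low (int L) ((uu_shift s - fls_const x) * (F_at s x - F_part s x L)
       - (uu_shift s - fls_const x + fls_const kk) * (F_at s (x - 1) - F_part s (x - 1) L)
       - fls_const (pochhammer kk (Suc L) / fact L * (\<Prod>i<L. x - 1 - of_nat i)) * inv_falling s L)"
      by (auto intro: fls_low_diff)
    moreover have "D = (uu_shift s - fls_const x) * (F_at s x - F_part s x L)
       - (uu_shift s - fls_const x + fls_const kk) * (F_at s (x - 1) - F_part s (x - 1) L)
       - fls_const (pochhammer kk (Suc L) / fact L * (\<Prod>i<L. x - 1 - of_nat i)) * inv_falling s L"
    proof -
      have lin: "A * F - B * F' = A * (F - P) - B * (F' - P') - g" if "A * P - B * P' = - g" for A B F F' P P' g :: "Qk fls"
        using that by algebra
      show ?thesis unfolding D_def by (rule lin[OF F_part_recurrence])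
    qed
    ultimately show ?thesis by simp
  qed
  have "D $$ i = 0" for i
    using \<open>\<And>L. fls_low (int L) D\<close>[of "nat (i + 1)"] unfolding fls_low_def by auto
  then have "D = 0" by (intro fls_eqI) simp
  then show ?thesis unfolding D_def by simp
qed

lemma F_at_0: "F_at s 0 = 1"
proof (rule fls_eq_nonneg)
  fix n
  have "poly (falling_poly l) 0 = (0::Qk)" if "l > 0" for l
    unfolding poly_falling using that by (intro prod_zero) auto
  then have "F_at s 0 $$ int n = (\<Sum>l\<in>{0}. pochhammer kk l / fact l * poly (falling_poly l) 0 * inv_falling s l $$ int n)"
    unfolding F_at_nth by (intro sum.mono_neutral_right) auto
  then show "F_at s 0 $$ int n = 1 $$ int n" by (simp add: inv_falling_def falling_poly_def)
next
  show "fls_low 0 (F_at s 0)" by (rule F_at_low)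
qed (simp add: fls_low_def)

lemma uu_shift_minus_nonzero: "uu_shift s - fls_const x \<noteq> 0"
  unfolding uu_shift_plus_const by (rule uu_minus_const)

lemma F_at_of_nat:
  "F_at s (of_nat M) = (\<Prod>l=1..M. (uu_shift s + fls_const kk - of_nat l) / (uu_shift s - of_nat l))"
proof (induction M)
  case (Suc M)
  have "(uu_shift s - fls_const (of_nat (Suc M))) * F_at s (of_nat (Suc M)) = (uu_shift s - fls_const (of_nat (Suc M)) + fls_const kk) * F_at s (of_nat M)"
    using F_at_recurrence[of s "of_nat (Suc M)"] by simp
  then have "F_at s (of_nat (Suc M)) = F_at s (of_nat M) * ((uu_shift s + fls_const kk - of_nat (Suc M)) / (uu_shift s - of_nat (Suc M)))"
    using uu_shift_minus_nonzero[of s "of_nat (Suc M)"] unfolding fls_of_nat[symmetric]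
    by (simp add: field_simps del: of_nat_Suc)
  then show ?case using Suc by simp
qed (simp add: F_at_0)

text \<open>The recurrence involves \<open>s\<close> and \<open>x\<close> only through
  \<open>s - x\<close>, so shifting both by \<open>t\<close> preserves it; the two sides agree at
  \<open>M = 0\<close>.\<close>

lemma F_at_shift_nat: "F_at (s + t) (of_nat M + t) = F_at (s + t) t * F_at s (of_nat M)"
proof (induction M)
  case (Suc M)
  define y where "y = uu_shift s - fls_const (of_nat (Suc M))"
  have y0: "y \<noteq> 0" unfolding y_def by (rule uu_shift_minus_nonzero)
  have yt: "uu_shift (s + t) - fls_const (of_nat (Suc M) + t) = y"
    unfolding y_def uu_shift_def by (simp add: fls_plus_const[symmetric] algebra_simps)
  have "y * F_at (s + t) (of_nat (Suc M) + t) = (y + fls_const kk) * F_at (s + t) (of_nat M + t)"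
    using F_at_recurrence[of "s + t" "of_nat (Suc M) + t"] unfolding yt by (simp add: algebra_simps)
  also have "\<dots> = F_at (s + t) t * ((y + fls_const kk) * F_at s (of_nat M))"
    unfolding Suc by (simp add: mult_ac)
  also have "(y + fls_const kk) * F_at s (of_nat M) = y * F_at s (of_nat (Suc M))"
    using F_at_recurrence[of s "of_nat (Suc M)"] unfolding y_def[symmetric] by simp
  finally have "y * F_at (s + t) (of_nat (Suc M) + t) = y * (F_at (s + t) t * F_at s (of_nat (Suc M)))"
    by (simp add: mult_ac)
  then show ?case using y0 by simp
qed (simp add: F_at_0)

definition fps_translate :: "Qk \<Rightarrow> Qk poly fps \<Rightarrow> Qk poly fps" where
  "fps_translate t f = Abs_fps (\<lambda>n. pcompose (f $ n) [:t, 1:])"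

lemma fps_eval_translate: "fps_eval x (fps_translate t f) = fps_eval (x + t) f"
  unfolding fps_translate_def fps_eval_def by (simp add: poly_pcompose add.commute)

text \<open>Extended from natural numbers to all x, the shift identity reads F(x + t, u + s + t) =
  F(t, u + s + t) F(x, u + s). At x = - t it shows that F(t, u + s + t) and F(- t, u + s) are
  inverse to each other.\<close>

lemma F_fps_translate:
  "fps_translate t (F_fps (s + t)) * fls_lift (F_at s (- t)) = F_fps s"
proof -
  have 1: "fps_translate t (F_fps (s + t)) = fls_lift (F_at (s + t) t) * F_fps s"
    by (rule fps_eval_inject[of 0])
      (simp add: fps_eval_translate fps_eval_mult fps_eval_fls_lift F_at_low F_at_def[symmetric] F_at_shift_nat)
  have "fps_eval (- t) (fps_translate t (F_fps (s + t))) = 1"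
    unfolding fps_eval_translate F_at_def[symmetric] by (simp add: F_at_0)
  then have 2: "F_at (s + t) t * F_at s (- t) = 1"
    unfolding 1 by (simp add: fps_eval_mult fps_eval_fls_lift F_at_low F_at_def[symmetric])
  show ?thesis
  proof (rule fps_eval_inject[of 0])
    fix M
    have "fps_eval (of_nat M) (fps_translate t (F_fps (s + t)) * fls_lift (F_at s (- t)))
        = (F_at (s + t) t * F_at s (- t)) * fps_eval (of_nat M) (F_fps s)"
      unfolding 1 by (simp add: fps_eval_mult fps_eval_fls_lift F_at_low mult_ac)
    then show "fps_eval (of_nat M) (fps_translate t (F_fps (s + t)) * fls_lift (F_at s (- t))) = fps_eval (of_nat M) (F_fps s)"
      unfolding 2 by simp
  qed
qed

section \<open>Orders in 1/u and the skew identity for series\<close>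

lemma card_hstrip:
  assumes h: "hstrip L K" and M: "cols_in M L"
  shows "card L = card K + card {j \<in> {1..M}. col_len L j = col_len K j + 1}"
proof -
  define I where "I = {j \<in> {1..M}. col_len L j = col_len K j + 1}"
  have "L - K = (\<lambda>j. (col_len K j + 1, j)) ` I" unfolding I_def by (rule hstrip_diff[OF h M])
  then have "card (L - K) = card I" by (simp add: card_image inj_on_def)
  moreover have "card L = card K + card (L - K)"
    using hstrip_subset[OF h] young_finite[OF hstrip_young(1)[OF h]]
    by (metis card_Diff_subset card_mono finite_subset le_add_diff_inverse)
  ultimately show ?thesis unfolding I_def by simp
qed

lemma cols_in_card:
  assumes "young_diagram L" "card L \<le> M"
  shows "cols_in M L"
  unfolding cols_in_def
proof clarify
  fix i j assume ij: "(i, j) \<in> L"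
  then have "1 \<le> i" using young_mem_col[OF assms(1), of i j] by simp
  then have sub: "{1} \<times> {1..j} \<subseteq> L"
    using young_closed[OF assms(1) ij] by auto
  have "card ({1::nat} \<times> {1..j}) \<le> card L" by (rule card_mono[OF young_finite[OF assms(1)] sub])
  then show "j \<le> M" using assms(2) by simp
qed

text \<open>Over \<open>M\<close> columns the numerator has a linear factor for each column missed
  by the strip and the denominator has \<open>M\<close> of them. Their difference is the number of
  columns met, that is, of boxes in the strip.\<close>

lemma W_at_low:
  assumes h: "hstrip L K"
  shows "fls_low (int (card L) - int (card K)) (W_at (uu_shift s) L K)"
proof -
  have y: "young_diagram L" using h unfolding hstrip_def by auto
  define M where "M = card L"
  have M: "cols_in M L" unfolding M_def by (rule cols_in_card[OF y]) simp
  define A where "A = {j \<in> {1..M}. col_len L j = col_len K j}"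
  define I where "I = {j \<in> {1..M}. col_len L j = col_len K j + 1}"
  have "{1..M} = A \<union> I" unfolding A_def I_def using h unfolding hstrip_def by (auto simp: le_Suc_eq)
  moreover have "A \<inter> I = {}" "finite A" "finite I" unfolding A_def I_def by auto
  ultimately have card: "M = card A + card I" by (metis card_Un_disjoint card_atLeastAtMost diff_Suc_1)
  define num where "num = (\<Prod>j\<in>A. uu_shift s + fls_const (col_var (col_len K) j))"
  define den where "den = (\<Prod>l=1..M. uu_shift s - of_nat l)"
  have "num \<noteq> 0 \<and> fls_subdegree num = - int (card A)"
    unfolding num_def by (rule subdegree_prod_uu) (auto simp: A_def uu_shift_plus_const)
  then have "fls_low (int (card I)) (num / den)"
    unfolding fls_low_iff den_def using prod_uu_shift[of s M] card by (simp add: fls_divide_subdegree)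
  then have "fls_low (0 + int (card I)) (fls_const (jack_phi L K) * (num / den))"
    by (intro fls_low_mult) (simp add: fls_low_def)
  moreover have "W_at (uu_shift s) L K = fls_const (jack_phi L K) * (num / den)"
    unfolding num_def den_def A_def by (subst W_at_eq[OF h M]) (simp_all add: uu_shift_neq)
  moreover have "int (card L) - int (card K) = int (card I)"
    using card_hstrip[OF h M] unfolding I_def by simp
  ultimately show ?thesis by simp
qed

lemma hstrip_card_le: "hstrip L K \<Longrightarrow> card K \<le> card L"
  by (rule card_mono[OF young_finite hstrip_subset]) (simp_all add: hstrip_def)

lemma W_at_low_0: "hstrip L K \<Longrightarrow> fls_low 0 (W_at (uu_shift s) L K)"
  using W_at_low[of L K s] hstrip_card_le[of L K] by (auto intro: fls_low_mono)

lemma finite_young_card: "finite {L. young_diagram L \<and> card L \<le> m}"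
proof (rule finite_subset)
  show "{L. young_diagram L \<and> card L \<le> m} \<subseteq> Pow ({1..m} \<times> {1..m})"
  proof clarify
    fix L i j assume L: "young_diagram L" "card L \<le> m" "(i, j) \<in> L"
    have "1 \<le> i" "1 \<le> j" using young_mem_col[OF L(1)] L(3) by auto
    moreover have "j \<le> m" using cols_in_card[OF L(1,2)] L(3) unfolding cols_in_def by blast
    moreover have "i \<le> m"
    proof -
      have sub: "{1..i} \<times> {1} \<subseteq> L" using young_closed[OF L(1,3)] \<open>1 \<le> j\<close> by auto
      have "card ({1..i} \<times> {1::nat}) \<le> card L" by (rule card_mono[OF young_finite[OF L(1)] sub])
      then show ?thesis using L(2) by simp
    qed
    ultimately show "i \<in> {1..m} \<and> j \<in> {1..m}" by auto
  qed
qed simp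

lemma finite_hstrip_below: "young_diagram K \<Longrightarrow> finite {T. hstrip K T}"
  by (rule finite_subset[of _ "Pow K"]) (auto dest: hstrip_subset young_finite)

text \<open>A fixed coefficient involves only finitely many \<open>L\<close>, so the sum may be cut
  at size \<open>m\<close>. For \<open>M\<close> beyond all sizes, evaluation at
  \<open>y = M\<close> reduces it to \<open>skew_at_nat\<close>.\<close>

theorem skew_fps_nth:
  assumes K: "young_diagram K" and G: "young_diagram G" and i: "card K + i \<le> m"
  shows "(\<Sum>L | hstrip L K \<and> hstrip L G \<and> card L \<le> m. fls_lift (W_at (uu_shift s) L K) * fps_const (A_poly L G)) $ i
    = (F_fps s * (\<Sum>T | hstrip K T \<and> hstrip G T. fps_const (A_poly K T) * fls_lift (W_at (uu_shift (s + kk)) G T))) $ i"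
proof (rule poly_eq_at_large_nat)
  fix M assume M: "max m (max (card K) (card G)) \<le> M"
  have MK: "cols_in M K" and MG: "cols_in M G" using cols_in_card K G M by auto
  have fin: "finite {L. hstrip L K \<and> hstrip L G \<and> card L \<le> m}"
    by (rule finite_subset[OF _ finite_young_card[of m]]) (auto simp: hstrip_def)
  define y where "y = (of_nat M :: Qk)"
  define RHS where "RHS = F_at s y * (\<Sum>T | hstrip K T \<and> hstrip G T. fls_const (poly (A_poly K T) y) * W_at (uu_shift (s + kk)) G T)"
  define upM where "upM = {L. hstrip L K \<and> hstrip L G \<and> cols_in M L}"
  have finM: "finite upM"
  proof (rule finite_subset[OF _ finite_young_card[of "card K + M"]])
    have "card {j \<in> {1..M}. Q j} \<le> M" for Q
      by (rule order_trans[OF card_mono[of "{1..M}"]]) auto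
    then show "upM \<subseteq> {L. young_diagram L \<and> card L \<le> card K + M}"
      unfolding upM_def using card_hstrip hstrip_young(1) by auto
  qed
  \<comment> \<open>If two columns differ in length by more than 1, no diagram is a strip over both
    \<open>K\<close> and \<open>G\<close> and none lies a strip below both, so both sums are
    empty.\<close>
  have main: "(\<Sum>L\<in>upM. W_at (uu_shift s) L K * fls_const (poly (A_poly L G) y)) = RHS"
  proof (cases "\<forall>j\<ge>1. col_len K j \<le> col_len G j + 1 \<and> col_len G j \<le> col_len K j + 1")
    case True
    interpret strip_pair K G M "uu_shift s"
      by unfold_locales (use K G MK MG True uu_shift_neq uu_shift_add in auto)
    show ?thesis
      using skew_at_nat unfolding strips_above_def strips_below_def upM_def RHS_def y_def F_at_of_nat uu_shift_add .
  next
    case False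
    have "upM = {}"
    proof (rule ccontr)
      assume "upM \<noteq> {}"
      then obtain L where "hstrip L K" "hstrip L G" unfolding upM_def by auto
      then show False using False unfolding hstrip_def by (meson add_le_mono1 order_trans)
    qed
    moreover have "{T. hstrip K T \<and> hstrip G T} = {}"
    proof (rule ccontr)
      assume "{T. hstrip K T \<and> hstrip G T} \<noteq> {}"
      then obtain T where "hstrip K T" "hstrip G T" by auto
      then show False using False unfolding hstrip_def by (meson add_le_mono1 order_trans)
    qed
    ultimately show ?thesis unfolding RHS_def by (simp only: sum.empty mult_zero_right)
  qed
  have "poly ((\<Sum>L | hstrip L K \<and> hstrip L G \<and> card L \<le> m. fls_lift (W_at (uu_shift s) L K) * fps_const (A_poly L G)) $ i) y
    = (\<Sum>L | hstrip L K \<and> hstrip L G \<and> card L \<le> m. W_at (uu_shift s) L K * fls_const (poly (A_poly L G) y)) $$ int i"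
    unfolding fps_eval_nth[symmetric] fps_eval_sum fps_eval_mult fps_eval_const
    by (intro arg_cong2[of _ _ _ _ fls_nth] sum.cong refl) (simp add: fps_eval_fls_lift W_at_low_0)
  \<comment> \<open>The terms added here have more than \<open>m\<close> boxes, so their weights
    begin beyond order \<open>i\<close>.\<close>
  also have "\<dots> = (\<Sum>L\<in>upM. W_at (uu_shift s) L K * fls_const (poly (A_poly L G) y)) $$ int i"
    unfolding fls_nth_sum
  proof (rule sum.mono_neutral_left[OF finM])
    show "{L. hstrip L K \<and> hstrip L G \<and> card L \<le> m} \<subseteq> upM"
      unfolding upM_def using cols_in_card M by (auto simp: hstrip_def)
    show "\<forall>L\<in>upM - {L. hstrip L K \<and> hstrip L G \<and> card L \<le> m}. (W_at (uu_shift s) L K * fls_const (poly (A_poly L G) y)) $$ int i = 0"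
    proof
      fix L assume "L \<in> upM - {L. hstrip L K \<and> hstrip L G \<and> card L \<le> m}"
      then have L: "hstrip L K" "m < card L" unfolding upM_def by auto
      have "fls_low ((int (card L) - int (card K)) + 0) (W_at (uu_shift s) L K * fls_const (poly (A_poly L G) y))"
        by (rule fls_low_mult[OF W_at_low[OF L(1)]]) (simp add: fls_low_def)
      then show "(W_at (uu_shift s) L K * fls_const (poly (A_poly L G) y)) $$ int i = 0"
        unfolding fls_low_def using L(2) i by auto
    qed
  qed
  also have "\<dots> = fps_eval y (F_fps s * (\<Sum>T | hstrip K T \<and> hstrip G T. fps_const (A_poly K T) * fls_lift (W_at (uu_shift (s + kk)) G T))) $$ int i"
    unfolding main RHS_def fps_eval_sum fps_eval_mult fps_eval_const F_at_def
    by (intro arg_cong2[of _ _ _ _ fls_nth] arg_cong2[of _ _ _ _ times] sum.cong refl) (simp add: fps_eval_fls_lift W_at_low_0)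
  finally show "poly ((\<Sum>L | hstrip L K \<and> hstrip L G \<and> card L \<le> m. fls_lift (W_at (uu_shift s) L K) * fps_const (A_poly L G)) $ i) (of_nat M)
    = poly ((F_fps s * (\<Sum>T | hstrip K T \<and> hstrip G T. fps_const (A_poly K T) * fls_lift (W_at (uu_shift (s + kk)) G T))) $ i) (of_nat M)"
    unfolding fps_eval_nth y_def .
qed

section \<open>Multivariate series up to a given degree\<close>

lemma mps_nth_simps [simp]:
  "mps_nth 0 M = 0" "mps_nth (f + g) M = mps_nth f M + mps_nth g M"
  "mps_nth (f - g) M = mps_nth f M - mps_nth g M" "mps_nth 1 M = (if M = {#} then 1 else 0)"
  by (simp_all add: zero_mps_def plus_mps_def minus_mps_def one_mps_def)

lemma mps_nth_mult: "mps_nth (f * g) M = (\<Sum>A | A \<subseteq># M. mps_nth f A * mps_nth g (M - A))"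
  by (simp add: times_mps_def)

lemma mps_nth_sum: "mps_nth (\<Sum>a\<in>A. f a) M = (\<Sum>a\<in>A. mps_nth (f a) M)"
  by (induction A rule: infinite_finite_induct) auto

definition mps_low :: "nat \<Rightarrow> ('v, 'a::zero) mps \<Rightarrow> bool" where
  "mps_low d f \<longleftrightarrow> (\<forall>M. size M < d \<longrightarrow> mps_nth f M = 0)"

definition eq_upto :: "nat \<Rightarrow> ('v, 'a::zero) mps \<Rightarrow> ('v, 'a) mps \<Rightarrow> bool" where
  "eq_upto d f g \<longleftrightarrow> (\<forall>M. size M < d \<longrightarrow> mps_nth f M = mps_nth g M)"

lemma eq_upto_refl [simp]: "eq_upto d f f" unfolding eq_upto_def by simp

lemma eq_upto_sym: "eq_upto d f g \<Longrightarrow> eq_upto d g f" unfolding eq_upto_def by simp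

lemma eq_upto_trans [trans]: "eq_upto d f g \<Longrightarrow> eq_upto d g h \<Longrightarrow> eq_upto d f h" unfolding eq_upto_def by simp

lemma eq_upto_mono: "eq_upto d f g \<Longrightarrow> d' \<le> d \<Longrightarrow> eq_upto d' f g" unfolding eq_upto_def by simp

lemma eq_upto_all: "(\<And>d. eq_upto d f g) \<Longrightarrow> f = g"
  unfolding eq_upto_def by (rule mps_eqI) blast

lemma eq_upto_iff_low: "eq_upto d f g \<longleftrightarrow> mps_low d (f - g :: ('v, 'a::comm_ring_1) mps)"
  unfolding eq_upto_def mps_low_def by simp

lemma mps_low_0 [simp]: "mps_low d (0 :: ('v, 'a::comm_ring_1) mps)" unfolding mps_low_def by simp

lemma mps_low_sum: "(\<And>a. a \<in> A \<Longrightarrow> mps_low d (f a)) \<Longrightarrow> mps_low d (\<Sum>a\<in>A. f a :: ('v, 'a::comm_ring_1) mps)"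
  unfolding mps_low_def mps_nth_sum by (simp add: sum.neutral)

lemma mps_low_mono: "mps_low d f \<Longrightarrow> d' \<le> d \<Longrightarrow> mps_low d' f"
  unfolding mps_low_def by simp

lemma mps_low_mult:
  fixes f g :: "('v, 'a::comm_ring_1) mps"
  assumes "mps_low a f" "mps_low b g"
  shows "mps_low (a + b) (f * g)"
  unfolding mps_low_def mps_nth_mult
proof (intro allI impI sum.neutral ballI)
  fix M A :: "'v multiset" assume M: "size M < a + b" and "A \<in> {A. A \<subseteq># M}"
  then have A: "A \<subseteq># M" by simp
  have "size A + size (M - A) = size M" using A by (metis size_Diff_submset size_mset_mono le_add_diff_inverse)
  then have "size A < a \<or> size (M - A) < b" using M by linarith
  then show "mps_nth f A * mps_nth g (M - A) = 0" using assms unfolding mps_low_def by auto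
qed

lemma mps_low_0_any [simp]: "mps_low 0 f" unfolding mps_low_def by simp

text \<open>A factor of order \<open>a\<close> improves the precision by \<open>a\<close>. This
  recovers in the Cauchy identity what the Pieri rule loses.\<close>

lemma eq_upto_mult_low:
  fixes f g h :: "('v, 'a::comm_ring_1) mps"
  assumes "mps_low a f" "eq_upto b g h"
  shows "eq_upto (a + b) (f * g) (f * h)"
  using mps_low_mult[OF assms(1) assms(2)[unfolded eq_upto_iff_low]] unfolding eq_upto_iff_low
  by (simp add: right_diff_distrib)

lemma eq_upto_mult_left:
  fixes f g h :: "('v, 'a::comm_ring_1) mps"
  shows "eq_upto d g h \<Longrightarrow> eq_upto d (f * g) (f * h)"
  using eq_upto_mult_low[of 0 f d g h] by simp

lemma eq_upto_mult:
  fixes f f' g g' :: "('v, 'a::comm_ring_1) mps"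
  assumes "eq_upto d f f'" "eq_upto d g g'"
  shows "eq_upto d (f * g) (f' * g')"
  using eq_upto_trans[OF eq_upto_mult_left[OF assms(2), of f] eq_upto_mult_left[OF assms(1), of g', unfolded mult.commute[of g']]] .

lemma eq_upto_sum:
  fixes f g :: "'i \<Rightarrow> ('v, 'a::comm_ring_1) mps"
  shows "(\<And>a. a \<in> A \<Longrightarrow> eq_upto d (f a) (g a)) \<Longrightarrow> eq_upto d (\<Sum>a\<in>A. f a) (\<Sum>a\<in>A. g a)"
  unfolding eq_upto_iff_low sum_subtractf[symmetric] by (rule mps_low_sum)

lemma mps_nth_const_mult: "mps_nth (mps_const c * f) M = c * mps_nth f M"
proof -
  have "mps_nth (mps_const c * f) M = (\<Sum>A | A \<subseteq># M. if A = {#} then c * mps_nth f M else 0)"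
    unfolding mps_nth_mult mps_const_def by (rule sum.cong) auto
  then show ?thesis by simp
qed

lemma mps_const_hom:
  fixes a b :: "'a::comm_ring_1"
  shows "mps_const (a + b) = mps_const a + mps_const b" "mps_const (a * b) = mps_const a * mps_const b"
  "mps_const (- a) = - mps_const a" "mps_const (a - b) = mps_const a - mps_const b"
  "mps_const (0 :: 'a::comm_ring_1) = 0" "mps_const (1 :: 'a) = 1"
proof -
  have 1: "mps_const (a + b) = mps_const a + mps_const b" for a b :: 'a
    by (rule mps_eqI) (simp add: mps_const_def)
  then show "mps_const (a + b) = mps_const a + mps_const b" .
  show "mps_const (a - b) = mps_const a - mps_const b"
    by (rule mps_eqI) (simp add: mps_const_def)
  show "mps_const (a * b) = mps_const a * mps_const b"
    by (rule mps_eqI) (simp only: mps_nth_const_mult, simp add: mps_const_def)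
  show 2: "mps_const (0 :: 'a) = 0" by (rule mps_eqI) (simp add: mps_const_def)
  show "mps_const (- a) = - mps_const a"
    unfolding eq_neg_iff_add_eq_0 1[symmetric] by (simp add: 2)
  show "mps_const (1 :: 'a) = 1" by (rule mps_eqI) (simp add: mps_const_def)
qed

lemma mps_const_of_nat: "mps_const (of_nat n :: 'a::comm_ring_1) = of_nat n"
  by (induction n) (auto simp: mps_const_hom)

section \<open>Substitution of series into polynomials and power series\<close>

definition poly_at :: "('v, 'a::comm_ring_1) mps \<Rightarrow> 'a poly \<Rightarrow> ('v, 'a) mps" where
  "poly_at x p = poly (map_poly mps_const p) x"

lemma poly_at_pCons: "poly_at x (pCons a p) = mps_const a + x * poly_at x p"
  unfolding poly_at_def by (simp add: map_poly_pCons mps_const_hom)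

lemma poly_at_0 [simp]: "poly_at x 0 = 0" unfolding poly_at_def by simp

lemma poly_at_const: "poly_at x [:c:] = mps_const c" by (simp add: poly_at_pCons)

lemma poly_at_1 [simp]: "poly_at x 1 = 1" unfolding one_pCons poly_at_const by (simp add: mps_const_hom)

lemma poly_at_add: "poly_at x (p + q) = poly_at x p + poly_at x q"
  by (induction p q rule: poly_induct2) (auto simp: poly_at_pCons mps_const_hom algebra_simps)

lemma poly_at_smult: "poly_at x (smult c p) = mps_const c * poly_at x p"
  by (induction p) (auto simp: poly_at_pCons mps_const_hom algebra_simps)

lemma poly_at_mult: "poly_at x (p * q) = poly_at x p * poly_at x q"
  by (induction p) (auto simp: poly_at_pCons poly_at_add poly_at_smult mps_const_hom algebra_simps)

lemma poly_at_sum: "poly_at x (\<Sum>a\<in>A. f a) = (\<Sum>a\<in>A. poly_at x (f a))"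
  by (induction A rule: infinite_finite_induct) (auto simp: poly_at_add)

lemma poly_at_prod: "poly_at x (\<Prod>a\<in>A. f a) = (\<Prod>a\<in>A. poly_at x (f a))"
  by (induction A rule: infinite_finite_induct) (auto simp: poly_at_mult)

lemma poly_at_pcompose: "poly_at x (pcompose p [:t, 1:]) = poly_at (x + mps_const t) p"
  by (induction p) (auto simp: pcompose_pCons poly_at_add poly_at_mult poly_at_smult poly_at_pCons mps_const_hom algebra_simps)

lemma poly_at_mps_const: "poly_at (mps_const y) p = mps_const (poly p y)"
  by (induction p) (auto simp: poly_at_pCons mps_const_hom)

lemma mps_var_mult_nth: "mps_nth (mps_var v * f) M = (if v \<in># M then mps_nth f (M - {#v#}) else 0)"
proof -
  have "mps_nth (mps_var v * f) M = (\<Sum>A | A \<subseteq># M. if A = {#v#} then mps_nth f (M - {#v#}) else 0)"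
    unfolding mps_nth_mult mps_var_def by (rule sum.cong) auto
  then show ?thesis by simp
qed

lemma mps_var_power_nth: "mps_nth (mps_var v ^ m) M = (if M = replicate_mset m v then 1 else 0)"
proof (induction m arbitrary: M)
  case (Suc m)
  have "v \<in># M \<and> M - {#v#} = replicate_mset m v \<longleftrightarrow> M = replicate_mset (Suc m) v"
    by (auto simp: add_mset_remove_trivial) (metis insert_DiffM)
  then show ?case by (auto simp: mps_var_mult_nth Suc)
qed simp

lemma mps_low_var_power: "mps_low m (mps_var v ^ m)"
  unfolding mps_low_def mps_var_power_nth by auto

text \<open>Replaces 1/u by \<open>v\<close> and the polynomial variable by \<open>x\<close>.
  Convergence comes from the powers of \<open>v\<close> alone, so \<open>x\<close> may have a
  constant term, as the \<open>y\<close> of the overview does; a monomial of degree d sees only the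
  terms with m at most d.\<close>

definition subst_fps :: "'v \<Rightarrow> ('v, Qk) mps \<Rightarrow> Qk poly fps \<Rightarrow> ('v, Qk) mps" where
  "subst_fps v x f = Abs_mps (\<lambda>M. mps_nth (\<Sum>m\<le>size M. mps_var v ^ m * poly_at x (f $ m)) M)"

lemma mps_low_var_power_mult: "d \<le> m \<Longrightarrow> mps_low d (mps_var v ^ m * f)"
  using mps_low_mult[OF mps_low_var_power[of m v], of 0 f] by (auto intro: mps_low_mono)

lemma eq_upto_sum_neutral:
  fixes f :: "'i \<Rightarrow> ('v, 'a::comm_ring_1) mps"
  assumes "finite B" "A \<subseteq> B" "\<And>b. b \<in> B - A \<Longrightarrow> mps_low d (f b)"
  shows "eq_upto d (\<Sum>b\<in>B. f b) (\<Sum>b\<in>A. f b)"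
  unfolding eq_upto_iff_low sum.subset_diff[OF assms(2,1)] using mps_low_sum[of "B - A" d f] assms(3) by simp

lemma subst_fps_eqd: "eq_upto d (subst_fps v x f) (\<Sum>m<d. mps_var v ^ m * poly_at x (f $ m))"
  unfolding eq_upto_def
proof (intro allI impI)
  fix M :: "'a multiset" assume M: "size M < d"
  have "eq_upto (Suc (size M)) (\<Sum>m<d. mps_var v ^ m * poly_at x (f $ m)) (\<Sum>m\<le>size M. mps_var v ^ m * poly_at x (f $ m))"
    by (rule eq_upto_sum_neutral) (use M in \<open>auto intro: mps_low_var_power_mult\<close>)
  then show "mps_nth (subst_fps v x f) M = mps_nth (\<Sum>m<d. mps_var v ^ m * poly_at x (f $ m)) M"
    unfolding subst_fps_def eq_upto_def by simp
qed

lemma subst_fps_eqd_cong: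
  assumes "\<And>i. i < d \<Longrightarrow> f $ i = g $ i"
  shows "eq_upto d (subst_fps v x f) (subst_fps v x g)"
proof -
  have "(\<Sum>m<d. mps_var v ^ m * poly_at x (f $ m)) = (\<Sum>m<d. mps_var v ^ m * poly_at x (g $ m))"
    using assms by simp
  then show ?thesis using eq_upto_trans[OF subst_fps_eqd[of d v x f] eq_upto_sym] subst_fps_eqd[of d v x g] by simp
qed

lemma subst_fps_mult: "subst_fps v x (f * g) = subst_fps v x f * subst_fps v x g"
proof (rule eq_upto_all)
  fix d :: nat
  define t where "t = (\<lambda>(a, b). mps_var v ^ (a + b) * (poly_at x (f $ a) * poly_at x (g $ b)))"
  define A where "A = {(a, b). a + b < d}"
  have "eq_upto d (subst_fps v x f * subst_fps v x g) ((\<Sum>m<d. mps_var v ^ m * poly_at x (f $ m)) * (\<Sum>m<d. mps_var v ^ m * poly_at x (g $ m)))"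
    by (intro eq_upto_mult subst_fps_eqd)
  also have "(\<Sum>m<d. mps_var v ^ m * poly_at x (f $ m)) * (\<Sum>m<d. mps_var v ^ m * poly_at x (g $ m)) = (\<Sum>p\<in>{..<d}\<times>{..<d}. t p)"
    unfolding sum_product sum.cartesian_product t_def by (rule sum.cong) (auto simp: power_add mult_ac)
  also have "eq_upto d \<dots> (\<Sum>p\<in>A. t p)"
    by (rule eq_upto_sum_neutral) (auto simp: A_def t_def intro!: mps_low_var_power_mult)
  also have "(\<Sum>p\<in>A. t p) = (\<Sum>(m, i)\<in>(SIGMA m:{..<d}. {0..m}). mps_var v ^ m * (poly_at x (f $ i) * poly_at x (g $ (m - i))))"
    by (rule sum.reindex_bij_witness[of _ "\<lambda>(m, i). (i, m - i)" "\<lambda>(a, b). (a + b, a)"]) (auto simp: A_def t_def)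
  also have "\<dots> = (\<Sum>m<d. mps_var v ^ m * poly_at x ((f * g) $ m))"
    by (subst sum.Sigma[symmetric]) (auto simp: fps_mult_nth poly_at_sum poly_at_mult sum_distrib_left)
  finally show "eq_upto d (subst_fps v x (f * g)) (subst_fps v x f * subst_fps v x g)"
    by (rule eq_upto_trans[OF subst_fps_eqd eq_upto_sym])
qed

lemma subst_fps_sum: "subst_fps v x (\<Sum>a\<in>A. f a) = (\<Sum>a\<in>A. subst_fps v x (f a))"
proof (rule eq_upto_all)
  fix d :: nat
  have "eq_upto d (\<Sum>a\<in>A. subst_fps v x (f a)) (\<Sum>a\<in>A. \<Sum>m<d. mps_var v ^ m * poly_at x (f a $ m))"
    by (intro eq_upto_sum subst_fps_eqd)
  also have "(\<Sum>a\<in>A. \<Sum>m<d. mps_var v ^ m * poly_at x (f a $ m)) = (\<Sum>m<d. mps_var v ^ m * poly_at x ((\<Sum>a\<in>A. f a) $ m))"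
    by (subst sum.swap) (simp add: fps_sum_nth poly_at_sum sum_distrib_left)
  finally show "eq_upto d (subst_fps v x (\<Sum>a\<in>A. f a)) (\<Sum>a\<in>A. subst_fps v x (f a))"
    by (rule eq_upto_trans[OF subst_fps_eqd eq_upto_sym])
qed

lemma subst_fps_const:
  fixes v :: 'v
  shows "subst_fps v x (fps_const p) = poly_at x p"
proof (rule mps_eqI)
  fix M :: "'v multiset"
  have "(\<Sum>m\<le>size M. mps_var v ^ m * poly_at x (fps_const p $ m)) = (\<Sum>m\<in>{0}. mps_var v ^ m * poly_at x (fps_const p $ m))"
    by (rule sum.mono_neutral_right) auto
  then show "mps_nth (subst_fps v x (fps_const p)) M = mps_nth (poly_at x p) M" unfolding subst_fps_def by simp
qed

lemma subst_fps_lift: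
  fixes v :: 'v
  shows "subst_fps v x (fls_lift f) = mps_of_fls v f"
proof (rule mps_eqI)
  fix M :: "'v multiset"
  have "mps_nth (mps_var v ^ m * poly_at x (fls_lift f $ m)) M = (if M = replicate_mset m v then f $$ int m else 0)" for m
    unfolding fls_lift_def by (simp add: poly_at_const mult.commute[of _ "mps_const _"] mps_nth_const_mult mps_var_power_nth)
  then have "mps_nth (subst_fps v x (fls_lift f)) M = (\<Sum>m\<le>size M. if M = replicate_mset m v then f $$ int m else 0)"
    unfolding subst_fps_def mps_nth_Abs mps_nth_sum by simp
  also have "\<dots> = (\<Sum>m\<in>{size M}. if M = replicate_mset m v then f $$ int m else 0)"
    by (rule sum.mono_neutral_right) auto
  finally show "mps_nth (subst_fps v x (fls_lift f)) M = mps_nth (mps_of_fls v f) M"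
    unfolding mps_of_fls_def by simp
qed

lemma subst_fps_translate: "subst_fps v x (fps_translate t f) = subst_fps v (x + mps_const t) f"
  unfolding subst_fps_def fps_translate_def by (simp add: poly_at_pcompose)

lemma subst_fps_mps_const: "subst_fps v (mps_const y) f = mps_of_fls v (fps_eval y f)"
proof -
  have "subst_fps v (mps_const y) f = subst_fps v 0 (fls_lift (fps_eval y f))"
    unfolding subst_fps_def fls_lift_def by (simp add: poly_at_mps_const poly_at_const fps_eval_nth)
  then show ?thesis unfolding subst_fps_lift .
qed

section \<open>F and W as multivariate series\<close>

lemma mps_low_of_fls: "fls_low (int d) f \<Longrightarrow> mps_low d (mps_of_fls v f)"
  unfolding mps_low_def fls_low_def mps_of_fls_def by simp

text \<open>Below degree \<open>d\<close> both sides are the sum of the first \<open>d\<close>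
  values of \<open>F_term\<close>; its value at index 0 is the separate 1 in
  \<open>F_series\<close>.\<close>

lemma F_series_eq: "F_series x j = subst_fps (UinvV j) x (F_fps 0)"
proof (rule eq_upto_all)
  fix d :: nat
  define t where "t m = fps_const (smult (pochhammer kk m / fact m) (falling_poly m)) * fls_lift (inv_falling 0 m)" for m
  have F: "F_term x j m = subst_fps (UinvV j) x (t m)" for m
    unfolding F_term_def t_def subst_fps_mult subst_fps_const subst_fps_lift poly_at_smult falling_poly_def poly_at_prod
    by (simp add: poly_at_pCons mps_const_hom mps_const_of_nat inv_falling_def uu_shift_0 algebra_simps)
  have t0: "F_term x j 0 = 1"
    unfolding F_term_def by (rule mps_eqI) (auto simp: mps_const_hom mps_of_fls_def)
  have tn: "t m $ i = smult (pochhammer kk m / fact m * inv_falling 0 m $$ int i) (falling_poly m)" for m i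
    unfolding t_def fls_lift_def by (simp add: mult.commute)
  have "eq_upto d (subst_fps (UinvV j) x (F_fps 0)) (subst_fps (UinvV j) x (\<Sum>m<d. t m))"
  proof (rule subst_fps_eqd_cong)
    fix i assume i: "i < d"
    have "(\<Sum>m<d. t m) $ i = (\<Sum>m\<le>i. t m $ i)"
      unfolding fps_sum_nth tn
      by (rule sum.mono_neutral_right) (use i inv_falling_low[of _ 0] in \<open>auto simp: fls_low_def\<close>)
    then show "F_fps 0 $ i = (\<Sum>m<d. t m) $ i" unfolding F_fps_def F_coef_def tn by simp
  qed
  moreover have "eq_upto d (F_series x j) (\<Sum>m<d. F_term x j m)"
    unfolding eq_upto_def
  proof (intro allI impI)
    fix M :: "var multiset" assume M: "size M < d"
    have lt: "m < d" if "mps_nth (F_term x j m) M \<noteq> 0" for m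
      using F_term_nth_eq_0[of M m x j] that M by linarith
    have "mps_nth (mps_infsum (F_term x j) {1..}) M = (\<Sum>a\<in>{1..<d}. mps_nth (F_term x j a) M)"
      unfolding mps_infsum_def mps_nth_Abs
      by (rule sum.mono_neutral_left) (auto dest: lt)
    moreover have "{..<d} = insert 0 {1..<d}" using M by auto
    ultimately show "mps_nth (F_series x j) M = mps_nth (\<Sum>m<d. F_term x j m) M"
      unfolding F_series_def by (simp add: t0 mps_nth_sum)
  qed
  ultimately show "eq_upto d (F_series x j) (subst_fps (UinvV j) x (F_fps 0))"
    unfolding subst_fps_sum F[symmetric] using eq_upto_trans eq_upto_sym by blast
qed

text \<open>The translation identity at \<open>s = 0\<close>, divided by a series with constant term
  1, for which the formal inverse is a true inverse.\<close>

lemma F_series_divide: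
  "F_series x j / F_series (mps_const (- t)) j = subst_fps (UinvV j) (x + mps_const t) (F_fps t)"
proof -
  define G where "G = F_series (mps_const (- t)) j"
  have G: "G = mps_of_fls (UinvV j) (F_at 0 (- t))"
    unfolding G_def F_series_eq subst_fps_mps_const F_at_def ..
  have "F_series x j = subst_fps (UinvV j) (x + mps_const t) (F_fps t) * G"
    unfolding F_series_eq G F_fps_translate[of t 0, symmetric] subst_fps_mult subst_fps_translate subst_fps_lift by simp
  moreover have "inverse G * G = 1"
    by (rule mps_inverse_mult) (simp add: G_def F_series_nth_empty)
  ultimately show ?thesis unfolding G_def[symmetric] divide_mps_def
    by (simp add: mult.assoc mult.commute[of G])
qed

definition W_ser :: "'v \<Rightarrow> Qk \<Rightarrow> diagram \<Rightarrow> diagram \<Rightarrow> ('v, Qk) mps" where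
  "W_ser v s L K = mps_of_fls v (W_at (uu_shift s) L K)"

lemma skew_series:
  assumes "young_diagram K" "young_diagram G" "card K \<le> m"
  shows "eq_upto (m - card K) (\<Sum>L | hstrip L K \<and> hstrip L G \<and> card L \<le> m. W_ser v s L K * poly_at x (A_poly L G))
    (subst_fps v x (F_fps s) * (\<Sum>T | hstrip K T \<and> hstrip G T. poly_at x (A_poly K T) * W_ser v (s + kk) G T))"
proof -
  have "eq_upto (m - card K) (subst_fps v x (\<Sum>L | hstrip L K \<and> hstrip L G \<and> card L \<le> m. fls_lift (W_at (uu_shift s) L K) * fps_const (A_poly L G)))
     (subst_fps v x (F_fps s * (\<Sum>T | hstrip K T \<and> hstrip G T. fps_const (A_poly K T) * fls_lift (W_at (uu_shift (s + kk)) G T))))"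
    by (rule subst_fps_eqd_cong, rule skew_fps_nth) (use assms in auto)
  then show ?thesis unfolding subst_fps_sum subst_fps_mult subst_fps_const subst_fps_lift W_ser_def .
qed

lemma mps_low_W_ser: "hstrip L K \<Longrightarrow> mps_low (card L - card K) (W_ser v s L K)"
  unfolding W_ser_def using W_at_low[of L K s] hstrip_card_le[of L K] by (intro mps_low_of_fls) (simp add: of_nat_diff)

section \<open>The Pieri rule and the Cauchy identity\<close>

text \<open>The argument \<open>y\<close> stands for \<open>y\<^sub>i = x\<^sub>i + (i - 1) k\<close>, which turns the branching rule into a recursion
  without shifts of the variables.\<close>

primrec interp_ser :: "nat \<Rightarrow> (nat \<Rightarrow> ('v, Qk) mps) \<Rightarrow> diagram \<Rightarrow> ('v, Qk) mps" where
  "interp_ser 0 y L = (if L = {} then 1 else 0)"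
| "interp_ser (Suc N) y L = (\<Sum>T | hstrip L T. poly_at (y 1) (A_poly L T) * interp_ser N (\<lambda>i. y (Suc i)) T)"

primrec dual_ser :: "nat \<Rightarrow> (nat \<Rightarrow> 'v) \<Rightarrow> diagram \<Rightarrow> ('v, Qk) mps" where
  "dual_ser 0 v L = (if L = {} then 1 else 0)"
| "dual_ser (Suc n) v L = (\<Sum>T | hstrip L T. W_ser (v 1) 0 L T * dual_ser n (\<lambda>i. v (Suc i)) T)"

lemma young_empty: "young_diagram {}" unfolding young_diagram_def by simp

lemma hstrip_empty_iff: "hstrip {} T \<longleftrightarrow> T = {}"
  using hstrip_subset[of "{}" T] young_empty unfolding hstrip_def by auto

lemma W_ser_empty: "W_ser v s {} {} = 1"
proof -
  have "W_at (uu_shift s) {} {} = 1"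
    by (subst W_at_eq[where M = 0]) (auto simp: hstrip_empty_iff cols_in_def jack_phi_def)
  then show ?thesis unfolding W_ser_def by (auto intro!: mps_eqI simp: mps_of_fls_def)
qed

lemma interp_ser_empty: "interp_ser N y {} = 1"
proof (induction N arbitrary: y)
  case (Suc N)
  have "A_poly {} {} = 1" unfolding A_poly_def jack_psi_def by simp
  then show ?case using Suc by (simp add: hstrip_empty_iff)
qed simp

text \<open>Each strip removes at most one box from the first column, and after \<open>N\<close>
  strips nothing may be left.\<close>

lemma interp_ser_eq_0:
  assumes "young_diagram L" "N < col_len L 1"
  shows "interp_ser N y L = 0"
  using assms
proof (induction N arbitrary: y L)
  case 0
  then have "(1, 1) \<in> L" using young_mem_col[OF 0(1), of 1 1] by auto
  then show ?case by auto
next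
  case (Suc N)
  have "interp_ser N (\<lambda>i. y (Suc i)) T = 0" if "hstrip L T" for T
  proof (rule Suc.IH)
    show "young_diagram T" using that unfolding hstrip_def by simp
    have "col_len L 1 \<le> col_len T 1 + 1" using that unfolding hstrip_def by simp
    then show "N < col_len T 1" using Suc.prems(2) by simp
  qed
  then show ?case by (simp add: sum.neutral)
qed

definition young_upto :: "nat \<Rightarrow> diagram set" where
  "young_upto m = {L. young_diagram L \<and> card L \<le> m}"

lemma finite_young_upto: "finite (young_upto m)"
  unfolding young_upto_def by (rule finite_young_card)

lemma hstrip_below_upto: "L \<in> young_upto m \<Longrightarrow> {T. hstrip L T} = {T \<in> young_upto m. hstrip L T}"
  unfolding young_upto_def using hstrip_card_le by (auto simp: hstrip_def intro: order_trans)

text \<open>The shift \<open>s\<close> takes part in the induction: moving \<open>W\<close> past the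
  variable \<open>y 1\<close> leaves \<open>W\<close> at u + s + k for the other variables. No
  precision is lost, because the lower diagrams \<open>T\<close> are contained in \<open>K\<close>,
  so the induction hypothesis for them is at least as precise.\<close>

theorem pieri_rule:
  assumes "young_diagram K" "card K \<le> m"
  shows "eq_upto (m - card K) (\<Sum>L | hstrip L K \<and> card L \<le> m. interp_ser N y L * W_ser v s L K)
    (interp_ser N y K * (\<Prod>i=1..N. subst_fps v (y i) (F_fps (s + of_nat (i - 1) * kk))))"
  using assms
proof (induction N arbitrary: y s K)
  case 0
  have fin: "finite {L. hstrip L K \<and> card L \<le> m}"
    by (rule finite_subset[OF _ finite_young_upto[of m]]) (auto simp: hstrip_def young_upto_def)
  have "(\<Sum>L | hstrip L K \<and> card L \<le> m. interp_ser 0 y L * W_ser v s L K)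
     = (\<Sum>L\<in>{L. hstrip L K \<and> card L \<le> m} \<inter> {{}}. interp_ser 0 y L * W_ser v s L K)"
    by (rule sum.mono_neutral_right[OF fin]) auto
  also have "\<dots> = (if K = {} then 1 else 0)"
  proof (cases "K = {}")
    case True
    then have "{L. hstrip L K \<and> card L \<le> m} \<inter> {{}} = {{}}" by (auto simp: hstrip_empty_iff)
    then show ?thesis using True by (simp add: W_ser_empty)
  next
    case False
    then have "{L. hstrip L K \<and> card L \<le> m} \<inter> {{}} = {}" by (auto simp: hstrip_empty_iff)
    then show ?thesis using False by simp
  qed
  finally show ?case by simp
next
  case (Suc N)
  define B where "B = young_upto m"
  have fB: "finite B" unfolding B_def by (rule finite_young_upto)
  define y' where "y' = (\<lambda>i. y (Suc i))"
  define F where "F = subst_fps v (y 1) (F_fps s)"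
  define P where "P = (\<Prod>i=1..N. subst_fps v (y' i) (F_fps (s + kk + of_nat (i - 1) * kk)))"
  have LB: "{L. hstrip L K' \<and> card L \<le> m} = {L \<in> B. hstrip L K'}" for K'
    unfolding B_def young_upto_def hstrip_def by auto
  have GB: "G \<in> B \<Longrightarrow> young_diagram G" for G unfolding B_def young_upto_def by simp
  have fK: "finite {T. hstrip K T}" by (rule finite_hstrip_below[OF Suc.prems(1)])
  have "(\<Sum>L | hstrip L K \<and> card L \<le> m. interp_ser (Suc N) y L * W_ser v s L K)
     = (\<Sum>L\<in>{L \<in> B. hstrip L K}. \<Sum>G\<in>{G \<in> B. hstrip L G}. interp_ser N y' G * (W_ser v s L K * poly_at (y 1) (A_poly L G)))"
    unfolding LB
  proof (rule sum.cong)
    fix L assume L: "L \<in> {L \<in> B. hstrip L K}"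
    then have "{G. hstrip L G} = {G \<in> B. hstrip L G}" unfolding B_def using hstrip_below_upto by blast
    then show "interp_ser (Suc N) y L * W_ser v s L K = (\<Sum>G\<in>{G \<in> B. hstrip L G}. interp_ser N y' G * (W_ser v s L K * poly_at (y 1) (A_poly L G)))"
      by (simp add: sum_distrib_left sum_distrib_right y'_def mult_ac)
  qed simp
  also have "\<dots> = (\<Sum>G\<in>B. \<Sum>L\<in>{L \<in> {L \<in> B. hstrip L K}. hstrip L G}. interp_ser N y' G * (W_ser v s L K * poly_at (y 1) (A_poly L G)))"
    by (rule sum.swap_restrict) (use fB in auto)
  also have "\<dots> = (\<Sum>G\<in>B. interp_ser N y' G * (\<Sum>L | hstrip L K \<and> hstrip L G \<and> card L \<le> m. W_ser v s L K * poly_at (y 1) (A_poly L G)))"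
  proof (rule sum.cong)
    fix G
    have "{L \<in> {L \<in> B. hstrip L K}. hstrip L G} = {L. hstrip L K \<and> hstrip L G \<and> card L \<le> m}"
      unfolding B_def young_upto_def hstrip_def by auto
    then show "(\<Sum>L\<in>{L \<in> {L \<in> B. hstrip L K}. hstrip L G}. interp_ser N y' G * (W_ser v s L K * poly_at (y 1) (A_poly L G)))
      = interp_ser N y' G * (\<Sum>L | hstrip L K \<and> hstrip L G \<and> card L \<le> m. W_ser v s L K * poly_at (y 1) (A_poly L G))"
      by (simp add: sum_distrib_left)
  qed simp
  also have "eq_upto (m - card K) \<dots> (\<Sum>G\<in>B. interp_ser N y' G * (F * (\<Sum>T\<in>{T \<in> {T. hstrip K T}. hstrip G T}. poly_at (y 1) (A_poly K T) * W_ser v (s + kk) G T)))"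
    unfolding F_def
    by (intro eq_upto_sum eq_upto_mult_left) (use skew_series[OF Suc.prems(1) GB Suc.prems(2)] in simp)
  also have "\<dots> = F * (\<Sum>G\<in>B. \<Sum>T\<in>{T \<in> {T. hstrip K T}. hstrip G T}. poly_at (y 1) (A_poly K T) * (interp_ser N y' G * W_ser v (s + kk) G T))"
    by (simp add: sum_distrib_left mult_ac)
  also have "(\<Sum>G\<in>B. \<Sum>T\<in>{T \<in> {T. hstrip K T}. hstrip G T}. poly_at (y 1) (A_poly K T) * (interp_ser N y' G * W_ser v (s + kk) G T))
    = (\<Sum>T | hstrip K T. poly_at (y 1) (A_poly K T) * (\<Sum>G | hstrip G T \<and> card G \<le> m. interp_ser N y' G * W_ser v (s + kk) G T))"
    unfolding LB sum_distrib_left by (rule sum.swap_restrict[OF fB fK])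
  also have "eq_upto (m - card K) (F * \<dots>)
    (F * (\<Sum>T | hstrip K T. poly_at (y 1) (A_poly K T) * (interp_ser N y' T * P)))"
  proof (intro eq_upto_mult_left eq_upto_sum)
    fix T assume "T \<in> {T. hstrip K T}"
    then have T: "hstrip K T" "young_diagram T" "card T \<le> card K" using hstrip_card_le by (auto simp: hstrip_def)
    show "eq_upto (m - card K) (\<Sum>G | hstrip G T \<and> card G \<le> m. interp_ser N y' G * W_ser v (s + kk) G T) (interp_ser N y' T * P)"
      unfolding P_def by (rule eq_upto_mono[OF Suc.IH[OF T(2)]]) (use T(3) Suc.prems(2) in auto)
  qed
  also have "\<dots> = interp_ser (Suc N) y K * (F * P)"
    by (simp add: y'_def sum_distrib_left sum_distrib_right mult_ac)
  also have "F * P = (\<Prod>i=1..Suc N. subst_fps v (y i) (F_fps (s + of_nat (i - 1) * kk)))"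
  proof -
    have "P = (\<Prod>i=1..N. subst_fps v (y (Suc i)) (F_fps (s + of_nat (Suc i - 1) * kk)))"
      unfolding P_def y'_def
    proof (rule prod.cong)
      fix i assume "i \<in> {1..N}"
      then obtain i' where "i = Suc i'" by (cases i) auto
      then have "s + kk + of_nat (i - 1) * kk = s + of_nat (Suc i - 1) * kk" by (simp add: algebra_simps)
      then show "subst_fps v (y (Suc i)) (F_fps (s + kk + of_nat (i - 1) * kk)) = subst_fps v (y (Suc i)) (F_fps (s + of_nat (Suc i - 1) * kk))"
        by metis
    qed simp
    also have "\<dots> = (\<Prod>i=Suc 1..Suc N. subst_fps v (y i) (F_fps (s + of_nat (i - 1) * kk)))"
      by (rule prod.shift_bounds_cl_Suc_ivl[symmetric])
    finally have P: "P = (\<Prod>i=Suc 1..Suc N. subst_fps v (y i) (F_fps (s + of_nat (i - 1) * kk)))" .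
    show ?thesis unfolding P F_def by (subst (2) prod.atLeast_Suc_atMost) simp_all
  qed
  finally show ?case .
qed

lemma mps_low_dual_ser: "young_diagram L \<Longrightarrow> mps_low (card L) (dual_ser n v L)"
proof (induction n arbitrary: v L)
  case 0
  then show ?case by (auto simp: mps_low_def)
next
  case (Suc n)
  have "mps_low (card L) (W_ser (v 1) 0 L T * dual_ser n (\<lambda>i. v (Suc i)) T)" if h: "hstrip L T" for T
  proof -
    have y: "young_diagram T" using h unfolding hstrip_def by simp
    show ?thesis using mps_low_mult[OF mps_low_W_ser[OF h] Suc.IH[OF y]] hstrip_card_le[OF h] by simp
  qed
  then show ?case by (auto intro!: mps_low_sum)
qed

text \<open>The number \<open>n\<close> of variables u is kept apart from \<open>N\<close> so that
  the induction can run over \<open>n\<close> alone, with one application of the Pieri rule in each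
  step.\<close>

theorem cauchy_identity_upto:
  "eq_upto m (\<Sum>L\<in>young_upto m. interp_ser N y L * dual_ser n v L)
    (\<Prod>j=1..n. \<Prod>i=1..N. subst_fps (v j) (y i) (F_fps (of_nat (i - 1) * kk)))"
proof (induction n arbitrary: v)
  case 0
  have "(\<Sum>L\<in>young_upto m. interp_ser N y L * dual_ser 0 v L) = (\<Sum>L\<in>{{}}. interp_ser N y L * dual_ser 0 v L)"
    by (rule sum.mono_neutral_right[OF finite_young_upto]) (auto simp: young_upto_def young_empty)
  then show ?case by (simp add: interp_ser_empty)
next
  case (Suc n)
  define v' where "v' = (\<lambda>i. v (Suc i))"
  define G where "G j = (\<Prod>i=1..N. subst_fps (v j) (y i) (F_fps (of_nat (i - 1) * kk)))" for j
  define B where "B = young_upto m"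
  have fB: "finite B" unfolding B_def by (rule finite_young_upto)
  have "(\<Sum>L\<in>B. interp_ser N y L * dual_ser (Suc n) v L)
    = (\<Sum>L\<in>B. \<Sum>T\<in>{T \<in> B. hstrip L T}. dual_ser n v' T * (interp_ser N y L * W_ser (v 1) 0 L T))"
  proof (rule sum.cong)
    fix L assume "L \<in> B"
    then have "{T. hstrip L T} = {T \<in> B. hstrip L T}" unfolding B_def by (rule hstrip_below_upto)
    then show "interp_ser N y L * dual_ser (Suc n) v L = (\<Sum>T\<in>{T \<in> B. hstrip L T}. dual_ser n v' T * (interp_ser N y L * W_ser (v 1) 0 L T))"
      by (simp add: sum_distrib_left v'_def mult_ac)
  qed simp
  also have "\<dots> = (\<Sum>T\<in>B. \<Sum>L\<in>{L \<in> B. hstrip L T}. dual_ser n v' T * (interp_ser N y L * W_ser (v 1) 0 L T))"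
    by (rule sum.swap_restrict[OF fB fB])
  also have "\<dots> = (\<Sum>T\<in>B. dual_ser n v' T * (\<Sum>L | hstrip L T \<and> card L \<le> m. interp_ser N y L * W_ser (v 1) 0 L T))"
  proof (rule sum.cong)
    fix T
    have "{L \<in> B. hstrip L T} = {L. hstrip L T \<and> card L \<le> m}"
      unfolding B_def young_upto_def hstrip_def by auto
    then show "(\<Sum>L\<in>{L \<in> B. hstrip L T}. dual_ser n v' T * (interp_ser N y L * W_ser (v 1) 0 L T))
      = dual_ser n v' T * (\<Sum>L | hstrip L T \<and> card L \<le> m. interp_ser N y L * W_ser (v 1) 0 L T)"
      by (simp add: sum_distrib_left)
  qed simp
  also have "eq_upto m \<dots> (\<Sum>T\<in>B. dual_ser n v' T * (interp_ser N y T * G 1))"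
  proof (rule eq_upto_sum)
    fix T assume "T \<in> B"
    then have T: "young_diagram T" "card T \<le> m" unfolding B_def young_upto_def by auto
    have "eq_upto (m - card T) (\<Sum>L | hstrip L T \<and> card L \<le> m. interp_ser N y L * W_ser (v 1) 0 L T) (interp_ser N y T * G 1)"
      using pieri_rule[OF T, of N y "v 1" 0] unfolding G_def by simp
    from eq_upto_mult_low[OF mps_low_dual_ser[OF T(1)] this] T(2)
    show "eq_upto m (dual_ser n v' T * (\<Sum>L | hstrip L T \<and> card L \<le> m. interp_ser N y L * W_ser (v 1) 0 L T)) (dual_ser n v' T * (interp_ser N y T * G 1))"
      by simp
  qed
  also have "\<dots> = G 1 * (\<Sum>T\<in>B. interp_ser N y T * dual_ser n v' T)"
    by (simp add: sum_distrib_left mult_ac)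
  also have "eq_upto m \<dots> (G 1 * (\<Prod>j=1..n. G (Suc j)))"
    using Suc.IH[of v'] unfolding G_def B_def v'_def by (rule eq_upto_mult_left)
  also have "(\<Prod>j=1..n. G (Suc j)) = (\<Prod>j=Suc 1..Suc n. G j)"
    by (rule prod.shift_bounds_cl_Suc_ivl[symmetric])
  also have "G 1 * (\<Prod>j=Suc 1..Suc n. G j) = (\<Prod>j=1..Suc n. G j)"
    by (subst (2) prod.atLeast_Suc_atMost) simp_all
  finally show ?case unfolding G_def B_def .
qed

section \<open>Reverse tableaux as chains of horizontal strips\<close>

definition tab_join :: "diagram \<Rightarrow> diagram \<Rightarrow> (nat \<times> nat \<Rightarrow> nat) \<Rightarrow> nat \<times> nat \<Rightarrow> nat" where
  "tab_join L K T s = (if s \<in> K then Suc (T s) else if s \<in> L then 1 else undefined)"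

lemma RTab_I:
  assumes "\<And>s. s \<in> L \<Longrightarrow> 1 \<le> T s \<and> T s \<le> N" "\<And>s. s \<notin> L \<Longrightarrow> T s = undefined"
    "\<And>i j j'. (i, j) \<in> L \<Longrightarrow> (i, j') \<in> L \<Longrightarrow> j < j' \<Longrightarrow> T (i, j') \<le> T (i, j)"
    "\<And>i i' j. (i, j) \<in> L \<Longrightarrow> (i', j) \<in> L \<Longrightarrow> i < i' \<Longrightarrow> T (i', j) < T (i, j)"
  shows "T \<in> RTab L N"
  unfolding RTab_def using assms by (auto simp: PiE_iff extensional_def)

lemma RTab_D:
  assumes "T \<in> RTab L N"
  shows "s \<in> L \<Longrightarrow> 1 \<le> T s \<and> T s \<le> N" "s \<notin> L \<Longrightarrow> T s = undefined"
    "(i, j) \<in> L \<Longrightarrow> (i, j') \<in> L \<Longrightarrow> j < j' \<Longrightarrow> T (i, j') \<le> T (i, j)"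
    "(i, j) \<in> L \<Longrightarrow> (i', j) \<in> L \<Longrightarrow> i < i' \<Longrightarrow> T (i', j) < T (i, j)"
  using assms PiE_arb[of T L "\<lambda>_. {1..N}" s] unfolding RTab_def by (auto simp: PiE_iff)

text \<open>Strict decrease leaves at most one entry 1 in each column, and monotonicity in both
  directions makes the boxes with larger entries a Young diagram.\<close>

lemma hstrip_tab_chain:
  assumes L: "young_diagram L" and T: "T \<in> RTab L N"
  shows "hstrip L (tab_chain L T 1)"
proof -
  define K where "K = tab_chain L T 1"
  have KL: "K \<subseteq> L" unfolding K_def tab_chain_def by auto
  have yK: "young_diagram K"
    unfolding young_diagram_def
  proof (intro conjI allI impI)
    show "finite K" using KL young_finite[OF L] finite_subset by blast
    show "K \<subseteq> {1..} \<times> {1..}" using KL L unfolding young_diagram_def by blast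
    fix i j i' j' assume a: "(i, j) \<in> K" "i' \<in> {1..i}" "j' \<in> {1..j}"
    then have ijL: "(i, j) \<in> L" "1 < T (i, j)" unfolding K_def tab_chain_def by auto
    have 1: "(i', j') \<in> L" "(i, j') \<in> L" using young_closed[OF L ijL(1)] a by auto
    have "T (i, j) \<le> T (i, j')" using RTab_D(3)[OF T 1(2) ijL(1)] a(3) by (cases "j' = j") auto
    moreover have "T (i, j') \<le> T (i', j')" using RTab_D(4)[OF T 1(1) 1(2)] a(2) by (cases "i' = i") auto
    ultimately show "(i', j') \<in> K" using 1(1) ijL(2) unfolding K_def tab_chain_def by auto
  qed
  have "col_len K j \<le> col_len L j \<and> col_len L j \<le> col_len K j + 1" if j: "1 \<le> j" for j
  proof -
    have 1: "col_len K j \<le> col_len L j"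
    proof (cases "col_len K j = 0")
      case False
      then have "(col_len K j, j) \<in> K" using young_mem_col[OF yK] j by auto
      then show ?thesis using KL young_mem_col[OF L] by blast
    qed simp
    moreover have "col_len L j \<le> col_len K j + 1"
    proof (rule ccontr)
      define i where "i = col_len K j + 1"
      assume "\<not> col_len L j \<le> col_len K j + 1"
      then have "(i, j) \<in> L" "(Suc i, j) \<in> L" "(i, j) \<notin> K"
        using young_mem_col[OF L, of i j] young_mem_col[OF L, of "Suc i" j] young_mem_col[OF yK, of i j] j unfolding i_def by simp_all
      then show False using RTab_D(4)[OF T, of i j "Suc i"] RTab_D(1)[OF T, of "(Suc i, j)"] unfolding K_def tab_chain_def by simp
    qed
    ultimately show ?thesis by simp
  qed
  then show ?thesis unfolding hstrip_def K_def[symmetric] using L yK by simp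
qed

text \<open>Raising the entries on \<open>K\<close> by one makes room for the value 1 on the strip,
  whose boxes are at the ends of the rows and at the bottom of the columns.\<close>

lemma tab_join_RTab:
  assumes h: "hstrip L K" and T: "T \<in> RTab K N"
  shows "tab_join L K T \<in> RTab L (Suc N)"
proof (rule RTab_I)
  have yL: "young_diagram L" and yK: "young_diagram K" using h unfolding hstrip_def by auto
  have KL: "K \<subseteq> L" by (rule hstrip_subset[OF h])
  show "1 \<le> tab_join L K T s \<and> tab_join L K T s \<le> Suc N" if "s \<in> L" for s
    using that RTab_D(1)[OF T, of s] unfolding tab_join_def by auto
  show "tab_join L K T s = undefined" if "s \<notin> L" for s
    using that KL unfolding tab_join_def by auto
  fix i j
  show "tab_join L K T (i, j') \<le> tab_join L K T (i, j)" if a: "(i, j) \<in> L" "(i, j') \<in> L" "j < j'" for j'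
  proof (cases "(i, j') \<in> K")
    case True
    have "1 \<le> i" "1 \<le> j" using young_mem_col[OF yL, of i j] a(1) by auto
    then have "(i, j) \<in> K" using young_closed[OF yK True, of i j] a(3) by auto
    then show ?thesis using True RTab_D(3)[OF T] a unfolding tab_join_def by auto
  next
    case False
    then show ?thesis using a unfolding tab_join_def by auto
  qed
  show "tab_join L K T (i', j) < tab_join L K T (i, j)" if a: "(i, j) \<in> L" "(i', j) \<in> L" "i < i'" for i'
  proof -
    have ij: "1 \<le> i" "1 \<le> j" "i' \<le> col_len L j" using young_mem_col[OF yL, of i j] young_mem_col[OF yL, of i' j] a by auto
    have "col_len L j \<le> col_len K j + 1" using h ij unfolding hstrip_def by auto
    then have iK: "(i, j) \<in> K" using young_mem_col[OF yK, of i j] ij a(3) by auto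
    show ?thesis
    proof (cases "(i', j) \<in> K")
      case True
      then show ?thesis using iK RTab_D(4)[OF T] a unfolding tab_join_def by auto
    next
      case False
      then show ?thesis using iK a RTab_D(1)[OF T iK] unfolding tab_join_def by auto
    qed
  qed
qed

text \<open>Deleting the boxes filled with 1 and lowering all other entries inverts
  \<open>tab_join\<close>. Outside its shape every tableau is \<open>undefined\<close>, so this is a
  bijection of functions.\<close>

lemma sum_RTab_Suc:
  assumes L: "young_diagram L"
  shows "(\<Sum>T\<in>RTab L (Suc N). f T) = (\<Sum>K | hstrip L K. \<Sum>T\<in>RTab K N. f (tab_join L K T))"
proof -
  have finR: "finite (RTab K N)" if "hstrip L K" for K
  proof (rule finite_subset)
    show "RTab K N \<subseteq> K \<rightarrow>\<^sub>E {1..N}" unfolding RTab_def by auto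
    show "finite (K \<rightarrow>\<^sub>E {1..N})" using that young_finite unfolding hstrip_def by (intro finite_PiE) auto
  qed
  define res where "res = (\<lambda>T. (tab_chain L T 1, \<lambda>s. if s \<in> tab_chain L T 1 then T s - 1 else undefined))"
  have "(\<Sum>T\<in>RTab L (Suc N). f T) = (\<Sum>(K, T)\<in>(SIGMA K:{K. hstrip L K}. RTab K N). f (tab_join L K T))"
  proof (rule sum.reindex_bij_witness[of _ "\<lambda>(K, T). tab_join L K T" res])
    fix T assume T: "T \<in> RTab L (Suc N)"
    define K where "K = tab_chain L T 1"
    define T' where "T' = (\<lambda>s. if s \<in> K then T s - 1 else undefined)"
    have r: "res T = (K, T')" unfolding res_def K_def T'_def ..
    have KL: "K \<subseteq> L" "\<And>s. s \<in> K \<Longrightarrow> 1 < T s" "\<And>s. s \<in> L \<Longrightarrow> s \<notin> K \<Longrightarrow> T s \<le> 1"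
      unfolding K_def tab_chain_def by auto
    have h: "hstrip L K" unfolding K_def by (rule hstrip_tab_chain[OF L T])
    have T': "T' \<in> RTab K N"
    proof (rule RTab_I)
      fix s assume s: "s \<in> K"
      have "s \<in> L" using s KL(1) by blast
      then have "1 < T s" "T s \<le> Suc N" using KL(2)[OF s] RTab_D(1)[OF T, of s] by auto
      then show "1 \<le> T' s \<and> T' s \<le> N" using s unfolding T'_def by auto
    next
      fix i j j' assume "(i, j) \<in> K" "(i, j') \<in> K" "j < j'"
      moreover from this have "T (i, j') \<le> T (i, j)" using KL(1) RTab_D(3)[OF T, of i j j'] by blast
      ultimately show "T' (i, j') \<le> T' (i, j)" unfolding T'_def by (simp add: diff_le_mono)
    next
      fix i i' j assume a: "(i, j) \<in> K" "(i', j) \<in> K" "i < i'"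
      then have "T (i', j) < T (i, j)" using KL(1) RTab_D(4)[OF T, of i j i'] by blast
      then show "T' (i', j) < T' (i, j)" using a KL(2)[OF a(2)] unfolding T'_def by (simp add: diff_less_mono)
    qed (simp add: T'_def)
    show "res T \<in> (SIGMA K:{K. hstrip L K}. RTab K N)" unfolding r using h T' by simp
    have "tab_join L K T' s = T s" for s
    proof (cases "s \<in> K")
      case True
      then show ?thesis using KL(2)[OF True] unfolding tab_join_def T'_def by simp
    next
      case False
      then show ?thesis using KL(3)[of s] RTab_D(1,2)[OF T, of s] unfolding tab_join_def
        by (cases "s \<in> L") force+
    qed
    then have "tab_join L K T' = T" by (rule ext)
    then show "(case res T of (K, T) \<Rightarrow> tab_join L K T) = T" "(case res T of (K, T) \<Rightarrow> f (tab_join L K T)) = f T"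
      unfolding r by simp_all
  next
    fix p assume "p \<in> (SIGMA K:{K. hstrip L K}. RTab K N)"
    then obtain K T where p: "p = (K, T)" "hstrip L K" "T \<in> RTab K N" by auto
    show "(case p of (K, T) \<Rightarrow> tab_join L K T) \<in> RTab L (Suc N)"
      unfolding p using tab_join_RTab[OF p(2,3)] by simp
    have 1: "tab_chain L (tab_join L K T) 1 = K"
      using hstrip_subset[OF p(2)] RTab_D(1)[OF p(3)] unfolding tab_chain_def tab_join_def by (auto simp: Suc_le_eq)
    have "(\<lambda>s. if s \<in> K then tab_join L K T s - 1 else undefined) = T"
      by (rule ext) (use RTab_D(2)[OF p(3)] in \<open>simp add: tab_join_def\<close>)
    then show "res (case p of (K, T) \<Rightarrow> tab_join L K T) = p"
      unfolding p res_def 1 prod.case by simp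
  qed
  also have "\<dots> = (\<Sum>K | hstrip L K. \<Sum>T\<in>RTab K N. f (tab_join L K T))"
    by (rule sum.Sigma[symmetric]) (use finR finite_hstrip_below[OF L] in auto)
  finally show ?thesis .
qed

lemma RTab_0: "RTab L 0 = (if L = {} then {\<lambda>_. undefined} else {})"
proof (cases "L = {}")
  case False
  then obtain s where "s \<in> L" by blast
  then have "T \<notin> RTab L 0" for T using RTab_D(1)[of T L 0 s] by fastforce
  then show ?thesis using False by auto
next
  case True
  then show ?thesis unfolding RTab_def by (auto simp: PiE_iff extensional_def)
qed

lemma tab_chain_join:
  assumes h: "hstrip L K" and T: "T \<in> RTab K N"
  shows "tab_chain L (tab_join L K T) 0 = L" "tab_chain L (tab_join L K T) (Suc i) = tab_chain K T i"
    "tab_chain K T 0 = K"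
proof -
  show "tab_chain L (tab_join L K T) 0 = L" unfolding tab_chain_def tab_join_def by auto
  show "tab_chain L (tab_join L K T) (Suc i) = tab_chain K T i"
    using hstrip_subset[OF h] unfolding tab_chain_def tab_join_def by auto
  show "tab_chain K T 0 = K" using RTab_D(1)[OF T] unfolding tab_chain_def by (auto simp: Suc_le_eq)
qed

lemma prod_tab_chain_join:
  fixes g :: "nat \<Rightarrow> diagram \<Rightarrow> diagram \<Rightarrow> 'a::comm_monoid_mult"
  assumes "hstrip L K" "T \<in> RTab K N"
  shows "(\<Prod>i=1..Suc N. g i (tab_chain L (tab_join L K T) (i - 1)) (tab_chain L (tab_join L K T) i))
    = g 1 L K * (\<Prod>i=1..N. g (Suc i) (tab_chain K T (i - 1)) (tab_chain K T i))"
proof -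
  note c = tab_chain_join[OF assms]
  have "(\<Prod>i=Suc 1..Suc N. g i (tab_chain L (tab_join L K T) (i - 1)) (tab_chain L (tab_join L K T) i))
     = (\<Prod>i=1..N. g (Suc i) (tab_chain L (tab_join L K T) (Suc i - 1)) (tab_chain L (tab_join L K T) (Suc i)))"
    by (rule prod.shift_bounds_cl_Suc_ivl)
  also have "\<dots> = (\<Prod>i=1..N. g (Suc i) (tab_chain K T (i - 1)) (tab_chain K T i))"
  proof (rule prod.cong)
    fix i assume "i \<in> {1..N}"
    then obtain i' where "i = Suc i'" by (cases i) auto
    then show "g (Suc i) (tab_chain L (tab_join L K T) (Suc i - 1)) (tab_chain L (tab_join L K T) (Suc i))
       = g (Suc i) (tab_chain K T (i - 1)) (tab_chain K T i)" using c(2) by simp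
  qed simp
  finally show ?thesis
    by (subst prod.atLeast_Suc_atMost) (simp_all add: c c(2)[of 0, simplified])
qed

lemma sum_RTab_dual:
  "young_diagram L \<Longrightarrow> (\<Sum>T\<in>RTab L n. \<Prod>i=1..n. W_ser (v i) 0 (tab_chain L T (i - 1)) (tab_chain L T i)) = dual_ser n v L"
proof (induction n arbitrary: L v)
  case 0
  then show ?case by (simp add: RTab_0)
next
  case (Suc n)
  have "(\<Sum>T\<in>RTab K n. \<Prod>i=1..Suc n. W_ser (v i) 0 (tab_chain L (tab_join L K T) (i - 1)) (tab_chain L (tab_join L K T) i))
     = W_ser (v 1) 0 L K * dual_ser n (\<lambda>i. v (Suc i)) K" if h: "hstrip L K" for K
  proof -
    have "(\<Sum>T\<in>RTab K n. \<Prod>i=1..Suc n. W_ser (v i) 0 (tab_chain L (tab_join L K T) (i - 1)) (tab_chain L (tab_join L K T) i))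
      = (\<Sum>T\<in>RTab K n. W_ser (v 1) 0 L K * (\<Prod>i=1..n. W_ser (v (Suc i)) 0 (tab_chain K T (i - 1)) (tab_chain K T i)))"
      by (rule sum.cong) (use prod_tab_chain_join[OF h, of _ n "\<lambda>i. W_ser (v i) 0"] in auto)
    also have "\<dots> = W_ser (v 1) 0 L K * dual_ser n (\<lambda>i. v (Suc i)) K"
      unfolding sum_distrib_left[symmetric] using Suc.IH[of K "\<lambda>i. v (Suc i)"] h unfolding hstrip_def by simp
    finally show ?thesis .
  qed
  then show ?case unfolding sum_RTab_Suc[OF Suc.prems] by simp
qed

lemma dual_H_eq: "young_diagram L \<Longrightarrow> dual_H L N = dual_ser N UinvV L"
  unfolding dual_H_def sum_RTab_dual[symmetric] W_ser_def uu_shift_0 W_weight_eq_W_at ..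

text \<open>An entry occurs in the factor of its box only as an index of \<open>y\<close>, so
  lowering the entries by one becomes the index shift of \<open>y\<close> in the recursion.\<close>

lemma sum_RTab_interp:
  fixes y :: "nat \<Rightarrow> ('v, Qk) mps"
  shows "young_diagram L \<Longrightarrow> (\<Sum>T\<in>RTab L N. mps_const (jack_psi_tab L N T) *
     (\<Prod>(i, j)\<in>L. y (T (i, j)) + mps_const (of_nat (i - 1) * kk - of_nat (j - 1)))) = interp_ser N y L"
proof (induction N arbitrary: L y)
  case 0
  then show ?case by (simp add: RTab_0 jack_psi_tab_def mps_const_hom)
next
  case (Suc N)
  define a where "a = (\<lambda>(i, j). mps_const (of_nat (i - 1) * kk - of_nat (j - 1)) :: ('v, Qk) mps)"
  have step: "(\<Sum>T\<in>RTab K N. mps_const (jack_psi_tab L (Suc N) (tab_join L K T)) * (\<Prod>s\<in>L. y (tab_join L K T s) + a s))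
     = poly_at (y 1) (A_poly L K) * interp_ser N (\<lambda>i. y (Suc i)) K" if h: "hstrip L K" for K
  proof -
    have fL: "finite L" using young_finite[OF Suc.prems] .
    have KL: "K \<subseteq> L" by (rule hstrip_subset[OF h])
    have A: "poly_at (y 1) (A_poly L K) = mps_const (jack_psi L K) * (\<Prod>s\<in>L - K. y 1 + a s)"
      unfolding A_poly_def poly_at_smult poly_at_prod a_def by (simp add: case_prod_unfold poly_at_pCons mps_const_hom add.commute)
    have "mps_const (jack_psi_tab L (Suc N) (tab_join L K T)) * (\<Prod>s\<in>L. y (tab_join L K T s) + a s)
      = poly_at (y 1) (A_poly L K) * (mps_const (jack_psi_tab K N T) * (\<Prod>s\<in>K. y (Suc (T s)) + a s))" if T: "T \<in> RTab K N" for T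
    proof -
      have 1: "jack_psi_tab L (Suc N) (tab_join L K T) = jack_psi L K * jack_psi_tab K N T"
        unfolding jack_psi_tab_def by (rule prod_tab_chain_join[OF h T, of "\<lambda>i. jack_psi"])
      have "(\<Prod>s\<in>L. y (tab_join L K T s) + a s) = (\<Prod>s\<in>L - K. y (tab_join L K T s) + a s) * (\<Prod>s\<in>K. y (tab_join L K T s) + a s)"
        by (rule prod.subset_diff[OF KL fL])
      also have "(\<Prod>s\<in>L - K. y (tab_join L K T s) + a s) = (\<Prod>s\<in>L - K. y 1 + a s)"
        by (rule prod.cong) (auto simp: tab_join_def)
      also have "(\<Prod>s\<in>K. y (tab_join L K T s) + a s) = (\<Prod>s\<in>K. y (Suc (T s)) + a s)"
        by (rule prod.cong) (auto simp: tab_join_def)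
      finally show ?thesis unfolding 1 A by (simp add: mps_const_hom mult_ac)
    qed
    then have "(\<Sum>T\<in>RTab K N. mps_const (jack_psi_tab L (Suc N) (tab_join L K T)) * (\<Prod>s\<in>L. y (tab_join L K T s) + a s))
      = poly_at (y 1) (A_poly L K) * (\<Sum>T\<in>RTab K N. mps_const (jack_psi_tab K N T) * (\<Prod>s\<in>K. y (Suc (T s)) + a s))"
      unfolding sum_distrib_left by (rule sum.cong[OF refl])
    also have "(\<Sum>T\<in>RTab K N. mps_const (jack_psi_tab K N T) * (\<Prod>s\<in>K. y (Suc (T s)) + a s)) = interp_ser N (\<lambda>i. y (Suc i)) K"
      using Suc.IH[of K "\<lambda>i. y (Suc i)"] h unfolding hstrip_def a_def by (simp add: case_prod_unfold)
    finally show ?thesis .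
  qed
  have "(\<Sum>T\<in>RTab L (Suc N). mps_const (jack_psi_tab L (Suc N) T) * (\<Prod>s\<in>L. y (T s) + a s)) = interp_ser (Suc N) y L"
    unfolding sum_RTab_Suc[OF Suc.prems] using step by simp
  then show ?case unfolding a_def by (simp add: case_prod_unfold)
qed

text \<open>The multiple \<open>T + i - 2\<close> of \<open>kk\<close> splits into
  \<open>T - 1\<close>, which goes into the variable, and \<open>i - 1\<close>, which belongs to the
  box. The natural subtractions are exact since entries and row indices are at least 1.\<close>

lemma interp_jack_eq:
  assumes "young_diagram L"
  shows "interp_jack L N x = interp_ser N (\<lambda>i. x i + mps_const (of_nat (i - 1) * kk)) L"
  unfolding sum_RTab_interp[OF assms, symmetric] interp_jack_def
proof (intro sum.cong arg_cong2[of _ _ _ _ times] prod.cong refl)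
  fix T s assume T: "T \<in> RTab L N" and s: "s \<in> L"
  obtain i j where ij: "s = (i, j)" by (cases s)
  have "1 \<le> i" using s young_mem_col[OF assms, of i j] unfolding ij by simp
  moreover have "1 \<le> T (i, j)" using RTab_D(1)[OF T s] unfolding ij by simp
  ultimately have "T (i, j) + i - 2 = (T (i, j) - 1) + (i - 1)" by simp
  then show "(case s of (i, j) \<Rightarrow> x (T (i, j)) - of_nat (j - 1) + of_nat (T (i, j) + i - 2) * mps_const kk) =
     (case s of (i, j) \<Rightarrow> x (T (i, j)) + mps_const (of_nat (T (i, j) - 1) * kk) + mps_const (of_nat (i - 1) * kk - of_nat (j - 1)))"
    unfolding ij by (simp add: mps_const_hom mps_const_of_nat algebra_simps)
qed

section \<open>The sum over all diagrams\<close>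

lemma mps_has_sum_cong:
  assumes "\<And>a. a \<in> A \<Longrightarrow> f a = g a" "mps_has_sum g A s"
  shows "mps_has_sum f A s"
proof -
  have "{a \<in> A. mps_nth (f a) M \<noteq> 0} = {a \<in> A. mps_nth (g a) M \<noteq> 0}" for M
    using assms(1) by auto
  moreover from this have "(\<Sum>a | a \<in> A \<and> mps_nth (f a) M \<noteq> 0. mps_nth (f a) M)
      = (\<Sum>a | a \<in> A \<and> mps_nth (g a) M \<noteq> 0. mps_nth (g a) M)" for M
    using assms(1) by (intro sum.cong) auto
  ultimately show ?thesis
    using assms(2) unfolding mps_has_sum_def mps_summable_def mps_infsum_def by simp
qed

theorem theorem8p1:
  fixes N :: nat
  assumes "N \<ge> 1"
  shows "mps_has_sum
    (\<lambda>\<mu>. interp_jack \<mu> N (\<lambda>i. mps_var (XV i)) * dual_H \<mu> N)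
    (Young N)
    (\<Prod>i=1..N. \<Prod>j=1..N.
       F_series (mps_var (XV i)) j / F_series (mps_const (- (of_nat (i - 1) * kk))) j)"
proof -
  define y :: "nat \<Rightarrow> series" where "y = (\<lambda>i. mps_var (XV i) + mps_const (of_nat (i - 1) * kk))"
  define f where "f L = interp_ser N y L * dual_ser N UinvV L" for L
  define R where "R = (\<Prod>j=1..N. \<Prod>i=1..N. subst_fps (UinvV j) (y i) (F_fps (of_nat (i - 1) * kk)))"
  have low: "mps_nth (f L) M = 0" if "young_diagram L" "size M < card L" for L M
  proof -
    have "mps_low (0 + card L) (f L)" unfolding f_def by (rule mps_low_mult[OF mps_low_0_any mps_low_dual_ser[OF that(1)]])
    then show ?thesis using that(2) unfolding mps_low_def by simp
  qed
  \<comment> \<open>The identity up to a degree runs over all diagrams of bounded size; those with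
    more than \<open>N\<close> rows contribute 0.\<close>
  have f0: "f L = 0" if "young_diagram L" "L \<notin> Young N" for L
  proof -
    have "N < col_len L 1" using that num_rows_eq_col_len[OF that(1)] unfolding Young_def by simp
    then have "interp_ser N y L = 0" by (rule interp_ser_eq_0[OF that(1)])
    then show ?thesis unfolding f_def by simp
  qed
  \<comment> \<open>\<open>eq_upto\<close> is strict in the degree, hence the bound
    \<open>Suc (size M)\<close>.\<close>
  have sub: "{L \<in> Young N. mps_nth (f L) M \<noteq> 0} \<subseteq> young_upto (Suc (size M))" for M
  proof
    fix L assume "L \<in> {L \<in> Young N. mps_nth (f L) M \<noteq> 0}"
    then have "young_diagram L" "\<not> size M < card L" using low[of L M] unfolding Young_def by auto
    then show "L \<in> young_upto (Suc (size M))" unfolding young_upto_def by simp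
  qed
  have "mps_summable f (Young N)"
    unfolding mps_summable_def using finite_subset[OF sub finite_young_upto] by blast
  moreover have "mps_infsum f (Young N) = R"
  proof (rule mps_eqI)
    fix M
    have "mps_nth (mps_infsum f (Young N)) M = (\<Sum>L | L \<in> Young N \<and> mps_nth (f L) M \<noteq> 0. mps_nth (f L) M)"
      unfolding mps_infsum_def by simp
    also have "\<dots> = (\<Sum>L\<in>young_upto (Suc (size M)). mps_nth (f L) M)"
    proof (rule sum.mono_neutral_left[OF finite_young_upto sub])
      show "\<forall>L\<in>young_upto (Suc (size M)) - {L \<in> Young N. mps_nth (f L) M \<noteq> 0}. mps_nth (f L) M = 0"
      proof
        fix L assume "L \<in> young_upto (Suc (size M)) - {L \<in> Young N. mps_nth (f L) M \<noteq> 0}"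
        then show "mps_nth (f L) M = 0" using f0[of L] unfolding young_upto_def by (cases "L \<in> Young N") auto
      qed
    qed
    also have "\<dots> = mps_nth R M"
      using cauchy_identity_upto[of "Suc (size M)" N y N UinvV] unfolding eq_upto_def R_def f_def mps_nth_sum by simp
    finally show "mps_nth (mps_infsum f (Young N)) M = mps_nth R M" .
  qed
  moreover have "R = (\<Prod>i=1..N. \<Prod>j=1..N. F_series (mps_var (XV i)) j / F_series (mps_const (- (of_nat (i - 1) * kk))) j)"
    unfolding R_def F_series_divide y_def by (rule prod.swap)
  ultimately have "mps_has_sum f (Young N) (\<Prod>i=1..N. \<Prod>j=1..N. F_series (mps_var (XV i)) j / F_series (mps_const (- (of_nat (i - 1) * kk))) j)"
    unfolding mps_has_sum_def by simp
  then show ?thesis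
  proof (rule mps_has_sum_cong[rotated])
    fix L assume "L \<in> Young N"
    then have "young_diagram L" unfolding Young_def by simp
    then show "interp_jack L N (\<lambda>i. mps_var (XV i)) * dual_H L N = f L"
      unfolding f_def y_def by (simp only: interp_jack_eq dual_H_eq)
  qed
qed

end
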